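(* Let $\kappa<0$ and $\tau>0$, and put $\varepsilon=\arctan\frac{\tau}{\sqrt{-\kappa}}$. On $\widetilde{SL_2}(\kappa,\tau)$: (i) every maximal geodesic is one-to-one; (ii) a geodesic is isotropic if and only if its slope angle $\theta$ belongs to $[\varepsilon,\pi-\varepsilon]$.
   Context: $\widetilde{SL_2}(\kappa,\tau)$ is the connected, simply connected 3-dimensional Lie group whose Lie algebra has a basis $\{u_1,u_2,u_3\}$ with $[u_1,u_2]=\tau u_3$, $[u_2,u_3]=\frac{\kappa}{\tau}u_1$, $[u_3,u_1]=\frac{\kappa}{\tau}u_2$ (where $\kappa<0$), equipped with the left-invariant Riemannian metric for which $\{u_1,u_2,u_3\}$ is orthonormal. $\xi=u_3$ is the Hopf vector field (a unit Killing field). The slope angle of a unit-speed geodesic $\gamma$ is the (constant) angle $\theta\in[0,\pi]$ between $\gamma'$ and $\xi$. A Jacobi field along a geodesic $\gamma$ is isotropic if it is the restriction to $\gamma$ of a Killing vector field. A point $\gamma(t)$ conjugate to $p=\gamma(0)$ along $\gamma$ is isotropic if some nonzero isotropic Jacobi field along $\gamma$ vanishes at $0$ and $t$. A geodesic $\gamma$ starting at $p$ is isotropic if every conjugate point to $p$ along $\gamma$ is isotropic (in particular this holds if there are no conjugate points). *)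

theory Defs
  imports "HOL-Analysis.Analysis" "HOL-Algebra.Group"
begin

text \<open>
  Manifolds are open subsets \<^term>\<open>U\<close> of a Euclidean space, with tangent space \<^typ>\<open>'a\<close> at every
  point. Every connected, simply connected Lie group with the Lie algebra below is diffeomorphic to
  \<open>\<real>\<^sup>3\<close>, so each of them is isomorphic to one carried by such a set.
\<close>

section \<open>Smooth maps, vector fields, Lie groups\<close>

primrec Ck_on :: "nat \<Rightarrow> 'a::real_normed_vector set \<Rightarrow> ('a \<Rightarrow> 'b::real_normed_vector) \<Rightarrow> bool" where
  "Ck_on 0 S f \<longleftrightarrow> continuous_on S f"
| "Ck_on (Suc k) S f \<longleftrightarrow> (\<forall>x\<in>S. f differentiable (at x)) \<and>
     (\<forall>v. Ck_on k S (\<lambda>x. frechet_derivative f (at x) v))"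

text \<open>Only used for open sets in finite dimension, where this is the usual notion.\<close>

definition smooth_on :: "'a::real_normed_vector set \<Rightarrow> ('a \<Rightarrow> 'b::real_normed_vector) \<Rightarrow> bool" where
  "smooth_on S f \<longleftrightarrow> (\<forall>k. Ck_on k S f)"

definition lie_bracket :: "('a::real_normed_vector \<Rightarrow> 'a) \<Rightarrow> ('a \<Rightarrow> 'a) \<Rightarrow> 'a \<Rightarrow> 'a" where
  "lie_bracket X Y x = frechet_derivative Y (at x) (X x) - frechet_derivative X (at x) (Y x)"

definition lie_group :: "'a::euclidean_space monoid \<Rightarrow> bool" where
  "lie_group G \<longleftrightarrow> group G \<and> open (carrier G) \<and>
     smooth_on (carrier G \<times> carrier G) (\<lambda>(x, y). x \<otimes>\<^bsub>G\<^esub> y) \<and>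
     smooth_on (carrier G) (m_inv G)"

definition d_left :: "'a::euclidean_space monoid \<Rightarrow> 'a \<Rightarrow> 'a \<Rightarrow> 'a \<Rightarrow> 'a" where
  "d_left G a x = frechet_derivative (\<lambda>y. a \<otimes>\<^bsub>G\<^esub> y) (at x)"

definition left_invariant_field :: "'a::euclidean_space monoid \<Rightarrow> ('a \<Rightarrow> 'a) \<Rightarrow> bool" where
  "left_invariant_field G X \<longleftrightarrow> smooth_on (carrier G) X \<and>
     (\<forall>a\<in>carrier G. \<forall>x\<in>carrier G. X (a \<otimes>\<^bsub>G\<^esub> x) = d_left G a x (X x))"

section \<open>Riemannian metrics\<close>

type_synonym 'a metric_tensor = "'a \<Rightarrow> 'a \<Rightarrow> 'a \<Rightarrow> real"

definition riemannian_metric :: "'a::euclidean_space set \<Rightarrow> 'a metric_tensor \<Rightarrow> bool" where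
  "riemannian_metric U m \<longleftrightarrow>
     (\<forall>x\<in>U. bilinear (m x) \<and> (\<forall>v w. m x v w = m x w v) \<and> (\<forall>v. v \<noteq> 0 \<longrightarrow> m x v v > 0)) \<and>
     (\<forall>v w. smooth_on U (\<lambda>x. m x v w))"

definition left_invariant_metric :: "'a::euclidean_space monoid \<Rightarrow> 'a metric_tensor \<Rightarrow> bool" where
  "left_invariant_metric G m \<longleftrightarrow> riemannian_metric (carrier G) m \<and>
     (\<forall>a\<in>carrier G. \<forall>x\<in>carrier G. \<forall>v w.
        m (a \<otimes>\<^bsub>G\<^esub> x) (d_left G a x v) (d_left G a x w) = m x v w)"

text \<open>
  The Levi-Civita connection is \<open>\<nabla>\<^sub>X Y = DY(X) + \<Gamma>(X, Y)\<close>; the Christoffel term \<open>\<Gamma>\<close> comes from the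
  Koszul formula for constant fields, whose brackets vanish.
\<close>

definition christoffel :: "'a::euclidean_space metric_tensor \<Rightarrow> 'a \<Rightarrow> 'a \<Rightarrow> 'a \<Rightarrow> 'a" where
  "christoffel m x v w = (THE c. \<forall>z. 2 * m x c z =
       frechet_derivative (\<lambda>y. m y w z) (at x) v
     + frechet_derivative (\<lambda>y. m y v z) (at x) w
     - frechet_derivative (\<lambda>y. m y v w) (at x) z)"

definition nabla :: "'a::euclidean_space metric_tensor \<Rightarrow> ('a \<Rightarrow> 'a) \<Rightarrow> ('a \<Rightarrow> 'a) \<Rightarrow> 'a \<Rightarrow> 'a" where
  "nabla m X Y x = frechet_derivative Y (at x) (X x) + christoffel m x (X x) (Y x)"

text \<open>
  \<open>R(X,Y)Z = \<nabla>\<^sub>X\<nabla>\<^sub>Y Z - \<nabla>\<^sub>Y\<nabla>\<^sub>X Z - \<nabla>\<^bsub>[X,Y]\<^esub> Z\<close> is tensorial, so it is evaluated on constant fields.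
\<close>

definition curvature :: "'a::euclidean_space metric_tensor \<Rightarrow> 'a \<Rightarrow> 'a \<Rightarrow> 'a \<Rightarrow> 'a \<Rightarrow> 'a" where
  "curvature m x v w z =
     nabla m (\<lambda>_. v) (nabla m (\<lambda>_. w) (\<lambda>_. z)) x - nabla m (\<lambda>_. w) (nabla m (\<lambda>_. v) (\<lambda>_. z)) x"

definition velocity :: "(real \<Rightarrow> 'a::euclidean_space) \<Rightarrow> real \<Rightarrow> 'a" where
  "velocity \<gamma> t = vector_derivative \<gamma> (at t)"

definition cov_deriv_along ::
  "'a::euclidean_space metric_tensor \<Rightarrow> (real \<Rightarrow> 'a) \<Rightarrow> (real \<Rightarrow> 'a) \<Rightarrow> real \<Rightarrow> 'a" where
  "cov_deriv_along m \<gamma> V t = vector_derivative V (at t) + christoffel m (\<gamma> t) (velocity \<gamma> t) (V t)"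

definition metric_angle :: "'a::euclidean_space metric_tensor \<Rightarrow> 'a \<Rightarrow> 'a \<Rightarrow> 'a \<Rightarrow> real" where
  "metric_angle m x v w = arccos (m x v w / (sqrt (m x v v) * sqrt (m x w w)))"

section \<open>Geodesics, Jacobi fields, Killing fields\<close>

definition geodesic ::
  "'a::euclidean_space set \<Rightarrow> 'a metric_tensor \<Rightarrow> real set \<Rightarrow> (real \<Rightarrow> 'a) \<Rightarrow> bool" where
  "geodesic U m I \<gamma> \<longleftrightarrow> open I \<and> is_interval I \<and> I \<noteq> {} \<and> smooth_on I \<gamma> \<and> \<gamma> ` I \<subseteq> U \<and>
     (\<forall>t\<in>I. cov_deriv_along m \<gamma> (velocity \<gamma>) t = 0)"

definition maximal_geodesic ::
  "'a::euclidean_space set \<Rightarrow> 'a metric_tensor \<Rightarrow> real set \<Rightarrow> (real \<Rightarrow> 'a) \<Rightarrow> bool" where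
  "maximal_geodesic U m I \<gamma> \<longleftrightarrow> geodesic U m I \<gamma> \<and>
     (\<forall>J \<delta>. geodesic U m J \<delta> \<and> I \<subseteq> J \<and> (\<forall>t\<in>I. \<delta> t = \<gamma> t) \<longrightarrow> J = I)"

definition unit_speed ::
  "'a::euclidean_space metric_tensor \<Rightarrow> real set \<Rightarrow> (real \<Rightarrow> 'a) \<Rightarrow> bool" where
  "unit_speed m I \<gamma> \<longleftrightarrow> (\<forall>t\<in>I. m (\<gamma> t) (velocity \<gamma> t) (velocity \<gamma> t) = 1)"

definition jacobi_field ::
  "'a::euclidean_space metric_tensor \<Rightarrow> real set \<Rightarrow> (real \<Rightarrow> 'a) \<Rightarrow> (real \<Rightarrow> 'a) \<Rightarrow> bool" where
  "jacobi_field m I \<gamma> J \<longleftrightarrow> smooth_on I J \<and>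
     (\<forall>t\<in>I. cov_deriv_along m \<gamma> (cov_deriv_along m \<gamma> J) t
             + curvature m (\<gamma> t) (J t) (velocity \<gamma> t) (velocity \<gamma> t) = 0)"

text \<open>The second condition is \<open>\<L>\<^sub>K m = 0\<close>, evaluated on constant fields.\<close>

definition killing_field ::
  "'a::euclidean_space set \<Rightarrow> 'a metric_tensor \<Rightarrow> ('a \<Rightarrow> 'a) \<Rightarrow> bool" where
  "killing_field U m K \<longleftrightarrow> smooth_on U K \<and>
     (\<forall>x\<in>U. \<forall>v w. frechet_derivative (\<lambda>y. m y v w) (at x) (K x)
        + m x (frechet_derivative K (at x) v) w + m x v (frechet_derivative K (at x) w) = 0)"

definition isotropic_jacobi_field ::
  "'a::euclidean_space set \<Rightarrow> 'a metric_tensor \<Rightarrow> real set \<Rightarrow> (real \<Rightarrow> 'a) \<Rightarrow> (real \<Rightarrow> 'a) \<Rightarrow> bool" where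
  "isotropic_jacobi_field U m I \<gamma> J \<longleftrightarrow> jacobi_field m I \<gamma> J \<and>
     (\<exists>K. killing_field U m K \<and> (\<forall>t\<in>I. J t = K (\<gamma> t)))"

text \<open>Conjugate points are identified by their parameter; the base point is \<open>\<gamma> 0\<close>.\<close>

definition conjugate_at ::
  "'a::euclidean_space metric_tensor \<Rightarrow> real set \<Rightarrow> (real \<Rightarrow> 'a) \<Rightarrow> real \<Rightarrow> bool" where
  "conjugate_at m I \<gamma> t \<longleftrightarrow> t \<in> I \<and> t \<noteq> 0 \<and>
     (\<exists>J. jacobi_field m I \<gamma> J \<and> (\<exists>s\<in>I. J s \<noteq> 0) \<and> J 0 = 0 \<and> J t = 0)"

definition isotropic_conjugate_at ::
  "'a::euclidean_space set \<Rightarrow> 'a metric_tensor \<Rightarrow> real set \<Rightarrow> (real \<Rightarrow> 'a) \<Rightarrow> real \<Rightarrow> bool" where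
  "isotropic_conjugate_at U m I \<gamma> t \<longleftrightarrow> conjugate_at m I \<gamma> t \<and>
     (\<exists>J. isotropic_jacobi_field U m I \<gamma> J \<and> (\<exists>s\<in>I. J s \<noteq> 0) \<and> J 0 = 0 \<and> J t = 0)"

definition isotropic_geodesic ::
  "'a::euclidean_space set \<Rightarrow> 'a metric_tensor \<Rightarrow> real set \<Rightarrow> (real \<Rightarrow> 'a) \<Rightarrow> bool" where
  "isotropic_geodesic U m I \<gamma> \<longleftrightarrow>
     (\<forall>t. conjugate_at m I \<gamma> t \<longrightarrow> isotropic_conjugate_at U m I \<gamma> t)"

section \<open>The space\<close>

text \<open>
  \<^term>\<open>m\<close> is the left-invariant metric with orthonormal frame \<open>u1, u2, u3\<close>. Since the dimension is 3,
  orthonormality makes the frame a basis of the Lie algebra. The Hopf field is \<open>u3\<close>.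
\<close>

definition SL2_tilde :: "real \<Rightarrow> real \<Rightarrow> 'a::euclidean_space monoid \<Rightarrow> 'a metric_tensor \<Rightarrow>
    ('a \<Rightarrow> 'a) \<Rightarrow> ('a \<Rightarrow> 'a) \<Rightarrow> ('a \<Rightarrow> 'a) \<Rightarrow> bool" where
  "SL2_tilde \<kappa> \<tau> G m u1 u2 u3 \<longleftrightarrow>
     DIM('a) = 3 \<and> lie_group G \<and> connected (carrier G) \<and> simply_connected (carrier G) \<and>
     left_invariant_field G u1 \<and> left_invariant_field G u2 \<and> left_invariant_field G u3 \<and>
     (\<forall>x\<in>carrier G. lie_bracket u1 u2 x = \<tau> *\<^sub>R u3 x \<and>
                    lie_bracket u2 u3 x = (\<kappa> / \<tau>) *\<^sub>R u1 x \<and>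
                    lie_bracket u3 u1 x = (\<kappa> / \<tau>) *\<^sub>R u2 x) \<and>
     left_invariant_metric G m \<and>
     (\<forall>x\<in>carrier G. m x (u1 x) (u1 x) = 1 \<and> m x (u2 x) (u2 x) = 1 \<and> m x (u3 x) (u3 x) = 1 \<and>
                    m x (u1 x) (u2 x) = 0 \<and> m x (u2 x) (u3 x) = 0 \<and> m x (u3 x) (u1 x) = 0)"

definition slope_angle ::
  "'a::euclidean_space metric_tensor \<Rightarrow> ('a \<Rightarrow> 'a) \<Rightarrow> (real \<Rightarrow> 'a) \<Rightarrow> real \<Rightarrow> real" where
  "slope_angle m \<xi> \<gamma> t = metric_angle m (\<gamma> t) (velocity \<gamma> t) (\<xi> (\<gamma> t))"

end

theory Submission
  imports Defs
begin

text \<open>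
  In the left-invariant orthonormal frame a geodesic \<open>\<gamma>\<close> is a solution of \<open>\<gamma>' = E \<gamma> v\<close>, \<open>v' = - lc v v\<close>, where
  \<open>lc\<close> is the Levi-Civita product on the Lie algebra; \<open>v\<close> rotates uniformly about the Hopf direction.

  (i) Right-invariant fields have frame coordinates \<open>c\<close> with \<open>c' = [c, v]\<close> along \<open>\<gamma>\<close>. The products \<open>v \<bullet> c\<close> are
  constant, so a geodesic loop closes smoothly. If \<open>c\<close> is null for the Killing form, then
  its angle \<open>\<phi>\<close> lifts to a real function on the simply connected group, and
  \<open>v\<^sub>3 \<phi> + (v\<^sub>2 cos \<phi> - v\<^sub>1 sin \<phi>) / \<mu>\<close>, with \<open>\<mu> = \<tau> / sqrt (- \<kappa>)\<close>, is monotone along \<open>\<gamma>\<close>; this excludes loops.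

  (ii) Put \<open>D = \<tau>\<^sup>2 v\<^sub>3\<^sup>2 + \<kappa> (v\<^sub>1\<^sup>2 + v\<^sub>2\<^sup>2)\<close>, so that the slope condition reads \<open>D \<le> 0\<close>. A Jacobi field vanishing twice
  reduces to \<open>y'' + D y = \<tau> c\<close>, \<open>z' = c - \<tau> y\<close> with \<open>c\<close> constant. For \<open>D \<le> 0\<close> the function
  \<open>y y' + c z\<close> is nondecreasing and there are no conjugate points. For \<open>D > 0\<close> there is a conjugate point at
  \<open>2 x / sqrt D\<close>, where \<open>sin x = (1 - D / \<tau>\<^sup>2) x cos x\<close> and \<open>\<pi> \<le> x < 3 \<pi> / 2\<close>. A Killing field restricts to a solution with \<open>c = 0\<close>,
  which cannot vanish there unless it vanishes identically.
\<close>

section \<open>Smooth maps\<close>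

text \<open>Part (i) fails in the quotient SL(2,R), where the Hopf fibres are closed geodesics.
  Simple connectedness must therefore be used; it enters only where \<phi> becomes real-valued. Up
  to the factor \<open>1 / (\<kappa> \<tau>\<^sup>2)\<close>, \<open>D\<close> is the dual of the
  invariant form \<open>\<tau>\<^sup>2 (c\<^sub>1\<^sup>2 + c\<^sub>2\<^sup>2) + \<kappa>
  c\<^sub>3\<^sup>2\<close>, evaluated on the conserved momentum \<open>v\<close>. In (ii), on a
  geodesic that is not vertical, a solution with \<open>c = 0\<close> and \<open>D > 0\<close>
  vanishes again only at multiples of \<open>2 pi / sqrt D\<close>. Nonzero \<open>c\<close> adds
  the conjugate points with tan x = (1 - D / \<open>\<tau>\<^sup>2\<close>) x, and the first one
  beyond x = pi is the witness. Killing fields have \<open>c = 0\<close> because they commute with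
  the Hopf field, which in turn holds because \<tau> differs from \<kappa> / \<tau>. The witness
  must lie in the domain of the geodesic; this is why unit-speed maximal geodesics are shown to be
  complete.\<close>

abbreviation fderiv :: "('a::real_normed_vector \<Rightarrow> 'b::real_normed_vector) \<Rightarrow> 'a \<Rightarrow> 'a \<Rightarrow> 'b" where
  "fderiv f x \<equiv> frechet_derivative f (at x)"

lemma fderiv_eqI: "(f has_derivative f') (at x) \<Longrightarrow> fderiv f x = f'"
  using frechet_derivative_at by metis

lemma Ck_on_subset: "Ck_on k S f \<Longrightarrow> T \<subseteq> S \<Longrightarrow> Ck_on k T f"
  by (induction k arbitrary: f) (auto intro: continuous_on_subset)

lemma Ck_on_cong:
  assumes "open S" "\<And>x. x \<in> S \<Longrightarrow> f x = g x" "Ck_on k S f"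
  shows "Ck_on k S g"
  using assms(2,3)
proof (induction k arbitrary: f g)
  case 0
  then show ?case by (simp cong: continuous_on_cong)
next
  case (Suc k)
  have d: "(g has_derivative fderiv f x) (at x)" if "x \<in> S" for x
    by (rule has_derivative_transform_within_open[of f _ x _ S])
       (use Suc.prems that assms(1) in \<open>auto simp: frechet_derivative_works\<close>)
  then have "fderiv f x v = fderiv g x v" if "x \<in> S" for x v
    using that fderiv_eqI by metis
  then have "Ck_on k S (\<lambda>x. fderiv g x v)" for v
    using Suc.IH[of "\<lambda>x. fderiv f x v"] Suc.prems by simp
  then show ?case using d by (auto simp: differentiable_def)
qed

text \<open>Lets an explicit derivative, known only on the open set \<open>S\<close>, stand in for
  \<open>frechet_derivative\<close> in the recursion of \<open>Ck_on\<close>.\<close>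

lemma Ck_on_Suc_cong:
  assumes "open S" "\<And>x. x \<in> S \<Longrightarrow> (f has_derivative f' x) (at x)" "\<And>v. Ck_on k S (\<lambda>x. f' x v)"
  shows "Ck_on (Suc k) S f"
proof -
  have "Ck_on k S (\<lambda>x. fderiv f x v)" for v
    using Ck_on_cong[OF assms(1) _ assms(3)[of v], of "\<lambda>x. fderiv f x v"] fderiv_eqI[OF assms(2)] by simp
  then show ?thesis using assms(2) by (auto simp: differentiable_def)
qed

lemma Ck_on_SucD: "Ck_on (Suc k) S f \<Longrightarrow> Ck_on k S f"
proof (induction k arbitrary: f)
  case 0
  then show ?case
    by (auto intro!: differentiable_imp_continuous_on differentiable_at_imp_differentiable_on)
next
  case (Suc k)
  then show ?case by (metis Ck_on.simps(2))
qed

lemma Ck_on_const: "Ck_on k S (\<lambda>_. c)"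
  by (induction k arbitrary: c) auto

lemma Ck_on_linear:
  assumes "bounded_linear f" "open S" shows "Ck_on k S f"
proof (cases k)
  case 0
  then show ?thesis using assms linear_continuous_on by auto
next
  case (Suc n)
  then show ?thesis using Ck_on_Suc_cong[OF assms(2), of f "\<lambda>_. f" n] assms
    by (auto intro: bounded_linear_imp_has_derivative Ck_on_const)
qed

lemma Ck_on_add:
  assumes "open S" "Ck_on k S f" "Ck_on k S g" shows "Ck_on k S (\<lambda>x. f x + g x)"
  using assms(2,3)
proof (induction k arbitrary: f g)
  case 0
  then show ?case by (auto intro: continuous_intros)
next
  case (Suc k)
  then show ?case
    by (intro Ck_on_Suc_cong[OF assms(1), where f'="\<lambda>x v. fderiv f x v + fderiv g x v"])
       (auto intro!: derivative_eq_intros simp: frechet_derivative_works)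
qed

lemma Ck_on_sum:
  assumes "open S" "finite A" "\<And>i. i \<in> A \<Longrightarrow> Ck_on k S (f i)"
  shows "Ck_on k S (\<lambda>x. \<Sum>i\<in>A. f i x)"
  using assms(2,3) by (induction A) (auto intro: Ck_on_const Ck_on_add[OF assms(1)])

lemma Ck_on_bilinear:
  assumes "bounded_bilinear h" "open S" "Ck_on k S f" "Ck_on k S g"
  shows "Ck_on k S (\<lambda>x. h (f x) (g x))"
  using assms(3,4)
proof (induction k arbitrary: f g)
  case 0
  then show ?case by (auto intro: bounded_bilinear.continuous_on[OF assms(1)])
next
  case (Suc k)
  have "((\<lambda>x. h (f x) (g x)) has_derivative (\<lambda>v. h (f x) (fderiv g x v) + h (fderiv f x v) (g x))) (at x)"
    if "x \<in> S" for x
    using that Suc.prems by (intro bounded_bilinear.FDERIV[OF assms(1)]) (auto simp: frechet_derivative_works)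
  moreover have "Ck_on k S f" "Ck_on k S g" using Suc.prems Ck_on_SucD by blast+
  ultimately show ?case
    using Suc by (intro Ck_on_Suc_cong[OF assms(2), where f'="\<lambda>x v. h (f x) (fderiv g x v) + h (fderiv f x v) (g x)"]
        Ck_on_add[OF assms(2)]) auto
qed

lemma Ck_on_bounded_linear_comp:
  assumes "bounded_linear h" "open S" "Ck_on k S f"
  shows "Ck_on k S (\<lambda>x. h (f x))"
  using assms(3)
proof (induction k arbitrary: f)
  case 0
  then show ?case using assms(1) by (auto intro: linear_continuous_on_compose continuous_on_compose2 linear_continuous_on)
next
  case (Suc k)
  have "((\<lambda>x. h (f x)) has_derivative (\<lambda>v. h (fderiv f x v))) (at x)" if "x \<in> S" for x
    by (rule bounded_linear.has_derivative[OF assms(1)]) (use that Suc.prems in \<open>auto simp: frechet_derivative_works\<close>)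
  then show ?case using Suc by (intro Ck_on_Suc_cong[OF assms(2), where f'="\<lambda>x v. h (fderiv f x v)"]) auto
qed

lemma linear_expand:
  fixes f :: "'a::euclidean_space \<Rightarrow> 'b::real_vector"
  assumes "linear f" shows "f v = (\<Sum>b\<in>Basis. (v \<bullet> b) *\<^sub>R f b)"
  using assms by (metis (no_types, lifting) euclidean_representation linear_sum linear_scale sum.cong)

text \<open>In the chain rule the direction \<open>fderiv g x v\<close> varies with the point.
  Expanding it in \<open>Basis\<close> leaves products of functions to which the induction
  hypothesis and the product rule apply.\<close>

lemma Ck_on_compose:
  fixes f :: "'a::euclidean_space \<Rightarrow> 'b::real_normed_vector" and g :: "'c::real_normed_vector \<Rightarrow> 'a"
  assumes "open S" "open T" "Ck_on k T f" "Ck_on k S g" "g ` S \<subseteq> T"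
  shows "Ck_on k S (\<lambda>x. f (g x))"
  using assms(3,4)
proof (induction k arbitrary: f)
  case 0
  then show ?case using assms(5) by (auto intro: continuous_on_compose2)
next
  case (Suc k)
  let ?d = "\<lambda>x v. \<Sum>b\<in>Basis. (fderiv g x v \<bullet> b) *\<^sub>R fderiv f (g x) b"
  have d: "((\<lambda>x. f (g x)) has_derivative ?d x) (at x)" if "x \<in> S" for x
  proof -
    have f: "f differentiable at (g x)" using Suc.prems assms(5) that by auto
    have "((\<lambda>x. f (g x)) has_derivative (\<lambda>v. fderiv f (g x) (fderiv g x v))) (at x)"
      using Suc.prems that f by (intro has_derivative_compose[of g _ x _ f]) (auto simp: frechet_derivative_works)
    moreover have "(\<lambda>v. fderiv f (g x) (fderiv g x v)) = ?d x"
      by (rule ext, rule linear_expand[OF linear_frechet_derivative[OF f]])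
    ultimately show ?thesis by metis
  qed
  have "Ck_on k S (\<lambda>x. fderiv f (g x) b)" for b
    using Suc.IH[of "\<lambda>x. fderiv f x b"] Suc.prems Ck_on_SucD by auto
  moreover have "Ck_on k S (\<lambda>x. fderiv g x v \<bullet> b)" for v b
    using Suc.prems by (auto intro: Ck_on_bounded_linear_comp[OF bounded_linear_inner_left] assms(1))
  ultimately show ?case
    using d by (intro Ck_on_Suc_cong[OF assms(1), where f'="?d"] Ck_on_sum assms(1)
        Ck_on_bilinear[OF bounded_bilinear_scaleR]) auto
qed

lemma smooth_on_cong: "open S \<Longrightarrow> (\<And>x. x \<in> S \<Longrightarrow> f x = g x) \<Longrightarrow> smooth_on S f \<Longrightarrow> smooth_on S g"
  unfolding smooth_on_def using Ck_on_cong by blast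

lemma smooth_on_subset: "smooth_on S f \<Longrightarrow> T \<subseteq> S \<Longrightarrow> smooth_on T f"
  unfolding smooth_on_def using Ck_on_subset by blast

lemma smooth_on_const: "smooth_on S (\<lambda>_. c)"
  unfolding smooth_on_def using Ck_on_const by blast

lemma smooth_on_linear: "bounded_linear f \<Longrightarrow> open S \<Longrightarrow> smooth_on S f"
  unfolding smooth_on_def using Ck_on_linear by blast

lemma smooth_on_add: "open S \<Longrightarrow> smooth_on S f \<Longrightarrow> smooth_on S g \<Longrightarrow> smooth_on S (\<lambda>x. f x + g x)"
  unfolding smooth_on_def using Ck_on_add by blast

lemma smooth_on_sum: "open S \<Longrightarrow> finite A \<Longrightarrow> (\<And>i. i \<in> A \<Longrightarrow> smooth_on S (f i)) \<Longrightarrow> smooth_on S (\<lambda>x. \<Sum>i\<in>A. f i x)"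
  unfolding smooth_on_def using Ck_on_sum by blast

lemma smooth_on_bilinear:
  "bounded_bilinear h \<Longrightarrow> open S \<Longrightarrow> smooth_on S f \<Longrightarrow> smooth_on S g \<Longrightarrow> smooth_on S (\<lambda>x. h (f x) (g x))"
  unfolding smooth_on_def using Ck_on_bilinear by blast

lemma smooth_on_bounded_linear_comp:
  "bounded_linear h \<Longrightarrow> open S \<Longrightarrow> smooth_on S f \<Longrightarrow> smooth_on S (\<lambda>x. h (f x))"
  unfolding smooth_on_def using Ck_on_bounded_linear_comp by blast

lemma smooth_on_compose:
  fixes f :: "'a::euclidean_space \<Rightarrow> 'b::real_normed_vector" and g :: "'c::real_normed_vector \<Rightarrow> 'a"
  shows "open S \<Longrightarrow> open T \<Longrightarrow> smooth_on T f \<Longrightarrow> smooth_on S g \<Longrightarrow> g ` S \<subseteq> T \<Longrightarrow> smooth_on S (\<lambda>x. f (g x))"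
  unfolding smooth_on_def using Ck_on_compose by blast

lemmas smooth_on_scaleR = smooth_on_bilinear[OF bounded_bilinear_scaleR]
  and smooth_on_mult = smooth_on_bilinear[OF bounded_bilinear_mult]

lemma smooth_on_imp_has_derivative:
  "smooth_on S f \<Longrightarrow> x \<in> S \<Longrightarrow> (f has_derivative fderiv f x) (at x)"
  unfolding smooth_on_def using Ck_on.simps(2)[of 0 S f] by (auto simp: frechet_derivative_works)

lemma smooth_on_fderiv: "smooth_on S f \<Longrightarrow> smooth_on S (\<lambda>x. fderiv f x v)"
  unfolding smooth_on_def by (metis Ck_on.simps(2))

lemma smooth_on_imp_continuous_on: "smooth_on S f \<Longrightarrow> continuous_on S f"
  unfolding smooth_on_def using Ck_on.simps(1) by blast

lemma smooth_on_Suc: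
  assumes "open S" "\<And>x. x \<in> S \<Longrightarrow> (f has_derivative f' x) (at x)" "\<And>v. smooth_on S (\<lambda>x. f' x v)"
  shows "smooth_on S f"
  unfolding smooth_on_def
proof
  fix k show "Ck_on k S f"
    using Ck_on_Suc_cong[OF assms(1,2)] assms(3) Ck_on_SucD unfolding smooth_on_def by blast
qed

text \<open>\<open>Ck_on\<close> controls derivatives in fixed directions only; a variable direction
  is reduced to these by its coordinates.\<close>

lemma smooth_on_fderiv_field:
  fixes f :: "'a::euclidean_space \<Rightarrow> 'b::real_normed_vector"
  assumes "open S" "smooth_on S f" "smooth_on S X"
  shows "smooth_on S (\<lambda>x. fderiv f x (X x))"
proof -
  have "fderiv f x (X x) = (\<Sum>b\<in>Basis. (X x \<bullet> b) *\<^sub>R fderiv f x b)" if "x \<in> S" for x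
    by (rule linear_expand[OF has_derivative_linear[OF smooth_on_imp_has_derivative[OF assms(2) that]]])
  moreover have "smooth_on S (\<lambda>x. \<Sum>b\<in>Basis. (X x \<bullet> b) *\<^sub>R fderiv f x b)"
    by (intro smooth_on_sum smooth_on_scaleR smooth_on_fderiv assms
        smooth_on_bounded_linear_comp[OF bounded_linear_inner_left]) auto
  ultimately show ?thesis using smooth_on_cong[OF assms(1)] by (metis (no_types, lifting))
qed

section \<open>Symmetry of second derivatives\<close>

lemma has_real_derivative_along_line:
  fixes f :: "'a::real_normed_vector \<Rightarrow> real"
  assumes "(f has_derivative f') (at (x + s *\<^sub>R u))"
  shows "((\<lambda>s. f (x + s *\<^sub>R u)) has_real_derivative f' u) (at s)"
proof -
  have "((\<lambda>s. x + s *\<^sub>R u) has_derivative (\<lambda>d. d *\<^sub>R u)) (at s)" by (auto intro!: derivative_eq_intros)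
  from has_derivative_compose[OF this assms]
  show ?thesis using linear_scale[OF has_derivative_linear[OF assms]]
    by (simp add: has_field_derivative_def fun_eq_iff mult_commute_abs)
qed

text \<open>The second difference over a parallelogram, evaluated by the mean value theorem in either order.\<close>

lemma symmetric_second_fderiv_real:
  fixes f :: "'a::real_normed_vector \<Rightarrow> real"
  assumes S: "open S" "x \<in> S" and f: "Ck_on 2 S f"
  shows "fderiv (\<lambda>y. fderiv f y u) x v = fderiv (\<lambda>y. fderiv f y v) x u"
proof -
  define g where "g u v y = fderiv (\<lambda>y. fderiv f y u) y v" for u v y
  have f1: "(f has_derivative fderiv f y) (at y)" if "y \<in> S" for y
    using f that by (simp add: numeral_2_eq_2 frechet_derivative_works)
  have f2: "((\<lambda>y. fderiv f y w) has_derivative fderiv (\<lambda>y. fderiv f y w) y) (at y)" if "y \<in> S" for y w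
    using f that by (simp add: numeral_2_eq_2 frechet_derivative_works)
  have cont: "continuous_on S (g u v)" for u v
    using f unfolding g_def by (simp add: numeral_2_eq_2)
  obtain r where r: "r > 0" "ball x r \<subseteq> S" using S open_contains_ball by blast
  have key: "\<exists>y. norm (y - x) \<le> h * (norm u + norm v) \<and>
      f (x + h *\<^sub>R u + h *\<^sub>R v) - f (x + h *\<^sub>R u) - f (x + h *\<^sub>R v) + f x = h * h * g u v y"
    if h: "h > 0" "h * (norm u + norm v) < r" for h u v
  proof -
    have nrm: "norm (s *\<^sub>R u + t *\<^sub>R v) \<le> h * (norm u + norm v)" if "0 \<le> s" "s \<le> h" "0 \<le> t" "t \<le> h" for s t
    proof -
      have "norm (s *\<^sub>R u + t *\<^sub>R v) \<le> s * norm u + t * norm v"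
        using that norm_triangle_ineq[of "s *\<^sub>R u" "t *\<^sub>R v"] by simp
      also have "\<dots> \<le> h * norm u + h * norm v" using that by (intro add_mono mult_right_mono) auto
      finally show ?thesis by (simp add: algebra_simps)
    qed
    have inS: "x + s *\<^sub>R u + t *\<^sub>R v \<in> S" if "0 \<le> s" "s \<le> h" "0 \<le> t" "t \<le> h" for s t
    proof -
      have "x + s *\<^sub>R u + t *\<^sub>R v - x = s *\<^sub>R u + t *\<^sub>R v" by simp
      then have "norm (x + s *\<^sub>R u + t *\<^sub>R v - x) < r" using nrm[OF that] h(2) by simp
      then have "x + s *\<^sub>R u + t *\<^sub>R v \<in> ball x r" by (simp only: mem_ball dist_norm norm_minus_commute)
      then show ?thesis using r(2) by blast
    qed
    define p where "p s = f (x + s *\<^sub>R u + h *\<^sub>R v) - f (x + s *\<^sub>R u)" for s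
    have dp: "(p has_real_derivative (fderiv f (x + s *\<^sub>R u + h *\<^sub>R v) u - fderiv f (x + s *\<^sub>R u) u)) (at s)"
      if "0 \<le> s" "s \<le> h" for s
    proof -
      have 1: "x + s *\<^sub>R u + h *\<^sub>R v \<in> S" "x + s *\<^sub>R u \<in> S" using inS[of s h] inS[of s 0] that h by auto
      have "((\<lambda>s. f (x + h *\<^sub>R v + s *\<^sub>R u)) has_real_derivative fderiv f (x + s *\<^sub>R u + h *\<^sub>R v) u) (at s)"
        using f1[OF 1(1)] by (intro has_real_derivative_along_line) (simp add: algebra_simps)
      moreover have "((\<lambda>s. f (x + s *\<^sub>R u)) has_real_derivative fderiv f (x + s *\<^sub>R u) u) (at s)"
        using f1[OF 1(2)] by (intro has_real_derivative_along_line)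
      ultimately show ?thesis unfolding p_def by (auto simp: add_ac intro: DERIV_diff)
    qed
    obtain s where s: "0 < s" "s < h" "p h - p 0 = h * (fderiv f (x + s *\<^sub>R u + h *\<^sub>R v) u - fderiv f (x + s *\<^sub>R u) u)"
      using MVT2[OF h(1) dp] by auto
    define q where "q t = fderiv f (x + s *\<^sub>R u + t *\<^sub>R v) u" for t
    have dq: "(q has_real_derivative g u v (x + s *\<^sub>R u + t *\<^sub>R v)) (at t)" if "0 \<le> t" "t \<le> h" for t
    proof -
      have 1: "x + s *\<^sub>R u + t *\<^sub>R v \<in> S" using inS[of s t] that s by auto
      show ?thesis unfolding q_def g_def by (rule has_real_derivative_along_line) (rule f2[OF 1])
    qed
    obtain t where t: "0 < t" "t < h" "q h - q 0 = h * g u v (x + s *\<^sub>R u + t *\<^sub>R v)"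
      using MVT2[OF h(1) dq] by auto
    have "norm (x + s *\<^sub>R u + t *\<^sub>R v - x) \<le> h * (norm u + norm v)"
      using nrm[of s t] s t by (simp add: add.assoc)
    moreover have "f (x + h *\<^sub>R u + h *\<^sub>R v) - f (x + h *\<^sub>R u) - f (x + h *\<^sub>R v) + f x = h * h * g u v (x + s *\<^sub>R u + t *\<^sub>R v)"
      using s(3) t(3) unfolding p_def q_def by (simp add: algebra_simps)
    ultimately show ?thesis by blast
  qed
  \<comment> \<open>The summand 1 keeps \<open>N\<close> positive when \<open>u\<close> and
    \<open>v\<close> are both 0.\<close>
  define N where "N = norm u + norm v + 1"
  have N: "N > 0" unfolding N_def by (simp add: add_nonneg_pos)
  have "\<bar>g u v x - g v u x\<bar> < e" if e: "e > 0" for e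
  proof -
    have near: "\<exists>d>0. \<forall>y\<in>S. dist y x < d \<longrightarrow> dist (g u v y) (g u v x) < e/2" for u v
      using cont[of u v] S(2) half_gt_zero[OF e] unfolding continuous_on_iff by blast
    obtain d1 where d1: "d1 > 0" "\<And>y. y \<in> S \<Longrightarrow> dist y x < d1 \<Longrightarrow> dist (g u v y) (g u v x) < e/2"
      using near[of u v] by blast
    obtain d2 where d2: "d2 > 0" "\<And>y. y \<in> S \<Longrightarrow> dist y x < d2 \<Longrightarrow> dist (g v u y) (g v u x) < e/2"
      using near[of v u] by blast
    define h where "h = min r (min d1 d2) / (2 * N)"
    have h: "h > 0" using r d1 d2 N unfolding h_def by auto
    have "norm u + norm v < 2 * N" using add_nonneg_pos[of "norm u + norm v" 2] unfolding N_def by (simp add: algebra_simps)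
    then have "h * (norm u + norm v) < h * (2 * N)" using h by (rule mult_strict_left_mono)
    then have hs: "h * (norm u + norm v) < min r (min d1 d2)" using N unfolding h_def by simp
    obtain y where y: "norm (y - x) \<le> h * (norm u + norm v)"
      "f (x + h *\<^sub>R u + h *\<^sub>R v) - f (x + h *\<^sub>R u) - f (x + h *\<^sub>R v) + f x = h * h * g u v y"
      using key[OF h, of u v] hs by auto
    obtain z where z: "norm (z - x) \<le> h * (norm v + norm u)"
      "f (x + h *\<^sub>R v + h *\<^sub>R u) - f (x + h *\<^sub>R v) - f (x + h *\<^sub>R u) + f x = h * h * g v u z"
      using key[OF h, of v u] hs by (auto simp: add.commute)
    have "h * h * g u v y = h * h * g v u z" using y(2) z(2) by (simp add: algebra_simps)
    then have "g u v y = g v u z" using h by simp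
    moreover have "dist (g u v y) (g u v x) < e/2"
      using y(1) hs r by (intro d1(2)) (auto simp: dist_norm subset_iff norm_minus_commute)
    moreover have "dist (g v u z) (g v u x) < e/2"
      using z(1) hs r by (intro d2(2)) (auto simp: dist_norm subset_iff norm_minus_commute add.commute)
    ultimately show ?thesis unfolding dist_real_def by (smt (verit) field_sum_of_halves)
  qed
  from this[of "\<bar>g u v x - g v u x\<bar>"] show ?thesis unfolding g_def by fastforce
qed

lemma symmetric_second_fderiv:
  fixes f :: "'a::real_normed_vector \<Rightarrow> 'b::euclidean_space"
  assumes S: "open S" "x \<in> S" and f: "smooth_on S f"
  shows "fderiv (\<lambda>y. fderiv f y u) x v = fderiv (\<lambda>y. fderiv f y v) x u"
proof (rule euclidean_eqI)
  fix b :: 'b assume "b \<in> Basis"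
  have d1: "fderiv (\<lambda>y. f y \<bullet> b) y w = fderiv f y w \<bullet> b" if "y \<in> S" for y w
    by (subst fderiv_eqI[OF has_derivative_inner_left[OF smooth_on_imp_has_derivative[OF f that]]]) simp
  have d2: "fderiv (\<lambda>y. fderiv (\<lambda>y. f y \<bullet> b) y w) x w' = fderiv (\<lambda>y. fderiv f y w) x w' \<bullet> b" for w w'
  proof -
    have "((\<lambda>y. fderiv f y w \<bullet> b) has_derivative (\<lambda>w'. fderiv (\<lambda>y. fderiv f y w) x w' \<bullet> b)) (at x)"
      by (intro has_derivative_inner_left smooth_on_imp_has_derivative[OF smooth_on_fderiv[OF f] S(2)])
    then have "((\<lambda>y. fderiv (\<lambda>y. f y \<bullet> b) y w) has_derivative (\<lambda>w'. fderiv (\<lambda>y. fderiv f y w) x w' \<bullet> b)) (at x)"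
      by (rule has_derivative_transform_within_open[OF _ S]) (simp add: d1)
    then show ?thesis by (simp add: fderiv_eqI)
  qed
  have "Ck_on 2 S (\<lambda>y. f y \<bullet> b)"
    using smooth_on_bounded_linear_comp[OF bounded_linear_inner_left S(1) f] unfolding smooth_on_def by blast
  from symmetric_second_fderiv_real[OF S this, of u v] d2
  show "fderiv (\<lambda>y. fderiv f y u) x v \<bullet> b = fderiv (\<lambda>y. fderiv f y v) x u \<bullet> b" by simp
qed

section \<open>The left-invariant frame\<close>

text \<open>Built from \<open>axis\<close> vectors, so that smoothness and derivatives reduce to
  sums of scalar multiples.\<close>

definition vec3 :: "real \<Rightarrow> real \<Rightarrow> real \<Rightarrow> real^3" where
  "vec3 a b c = a *\<^sub>R axis 1 1 + b *\<^sub>R axis 2 1 + c *\<^sub>R axis 3 1"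

lemma vec3_nth [simp]: "vec3 a b c $ 1 = a" "vec3 a b c $ 2 = b" "vec3 a b c $ 3 = c"
  by (simp_all add: vec3_def axis_def)

lemma vec3_eq_iff: "(c::real^3) = d \<longleftrightarrow> c $ 1 = d $ 1 \<and> c $ 2 = d $ 2 \<and> c $ 3 = d $ 3"
  by (simp add: vec_eq_iff forall_3)

lemma inner_vec3: "(c::real^3) \<bullet> d = c $ 1 * d $ 1 + c $ 2 * d $ 2 + c $ 3 * d $ 3"
  by (simp add: inner_vec_def sum_3)

lemma smooth_on_vec3:
  assumes "open S" "smooth_on S f" "smooth_on S g" "smooth_on S h"
  shows "smooth_on S (\<lambda>x. vec3 (f x) (g x) (h x))"
  unfolding vec3_def by (intro smooth_on_add smooth_on_scaleR smooth_on_const assms)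

lemma smooth_on_nth: "open S \<Longrightarrow> smooth_on S f \<Longrightarrow> smooth_on S (\<lambda>x. f x $ i :: real)"
  by (rule smooth_on_bounded_linear_comp[OF bounded_linear_vec_nth])

lemma bilinear_expand:
  fixes f :: "'a::euclidean_space \<Rightarrow> 'a \<Rightarrow> real"
  assumes "bilinear f" shows "f v w = (\<Sum>b\<in>Basis. \<Sum>b'\<in>Basis. (v \<bullet> b) *\<^sub>R (w \<bullet> b') *\<^sub>R f b b')"
proof -
  have "f v w = (\<Sum>b\<in>Basis. (v \<bullet> b) *\<^sub>R f b w)"
    using assms by (intro linear_expand) (auto simp: bilinear_def)
  also have "\<dots> = (\<Sum>b\<in>Basis. (v \<bullet> b) *\<^sub>R (\<Sum>b'\<in>Basis. (w \<bullet> b') *\<^sub>R f b b'))"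
    using assms by (intro sum.cong refl arg_cong[of _ _ "(*\<^sub>R) _"] linear_expand) (auto simp: bilinear_def)
  finally show ?thesis by (simp add: sum_distrib_left scaleR_right.sum)
qed

locale sl2_tilde =
  fixes \<kappa> \<tau> :: real and G :: "'a::euclidean_space monoid" and m :: "'a metric_tensor"
    and u1 u2 u3 :: "'a \<Rightarrow> 'a"
  assumes kappa_neg: "\<kappa> < 0" and tau_pos: "\<tau> > 0" and space: "SL2_tilde \<kappa> \<tau> G m u1 u2 u3"
begin

abbreviation "U \<equiv> carrier G"

definition k where "k = \<kappa> / \<tau>"

lemma k_neg: "k < 0" unfolding k_def using kappa_neg tau_pos by (simp add: divide_neg_pos)

definition br :: "real^3 \<Rightarrow> real^3 \<Rightarrow> real^3" where
  "br c d = vec3 (k * (c $ 2 * d $ 3 - c $ 3 * d $ 2)) (k * (c $ 3 * d $ 1 - c $ 1 * d $ 3))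
     (\<tau> * (c $ 1 * d $ 2 - c $ 2 * d $ 1))"

text \<open>The coefficients are forced by \<open>lc_koszul\<close>: inner products of
  left-invariant orthonormal fields are constant, so only the brackets survive in the Koszul
  formula.\<close>

definition lc :: "real^3 \<Rightarrow> real^3 \<Rightarrow> real^3" where
  "lc c d = vec3 (\<tau>/2 * c $ 2 * d $ 3 + (\<tau>/2 - k) * c $ 3 * d $ 2)
     (- \<tau>/2 * c $ 1 * d $ 3 + (k - \<tau>/2) * c $ 3 * d $ 1)
     (\<tau>/2 * (c $ 1 * d $ 2 - c $ 2 * d $ 1))"

lemma lc_torsion_free: "lc c d - lc d c = br c d"
  by (simp add: lc_def br_def vec3_eq_iff algebra_simps)

lemma lc_koszul: "2 * (lc a b \<bullet> c) = br a b \<bullet> c - b \<bullet> br a c - a \<bullet> br b c"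
  by (simp add: lc_def br_def inner_vec3 algebra_simps)

lemma bounded_bilinear_lc: "bounded_bilinear lc"
  unfolding bilinear_conv_bounded_bilinear[symmetric] bilinear_def
  by (auto intro!: linearI simp: lc_def vec3_eq_iff algebra_simps add_divide_distrib)

lemma bounded_bilinear_br: "bounded_bilinear br"
  unfolding bilinear_conv_bounded_bilinear[symmetric] bilinear_def
  by (auto intro!: linearI simp: br_def vec3_eq_iff algebra_simps)

sublocale lc: bounded_bilinear lc by (rule bounded_bilinear_lc)
sublocale br: bounded_bilinear br by (rule bounded_bilinear_br)

lemma
  shows dim3: "DIM('a) = 3" and group: "group G" and open_U: "open U"
    and connected_U: "connected U" and simply_connected_U: "simply_connected U"
    and smooth_mult: "smooth_on (U \<times> U) (\<lambda>(x, y). x \<otimes>\<^bsub>G\<^esub> y)"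
    and smooth_u: "smooth_on U u1" "smooth_on U u2" "smooth_on U u3"
    and metric: "riemannian_metric U m"
  using space unfolding SL2_tilde_def lie_group_def left_invariant_field_def left_invariant_metric_def by auto

lemma brackets:
  assumes "x \<in> U"
  shows "lie_bracket u1 u2 x = \<tau> *\<^sub>R u3 x" "lie_bracket u2 u3 x = k *\<^sub>R u1 x" "lie_bracket u3 u1 x = k *\<^sub>R u2 x"
  using space assms unfolding SL2_tilde_def k_def by auto

lemma orthonormal:
  assumes "x \<in> U"
  shows "m x (u1 x) (u1 x) = 1" "m x (u2 x) (u2 x) = 1" "m x (u3 x) (u3 x) = 1"
    "m x (u1 x) (u2 x) = 0" "m x (u2 x) (u1 x) = 0" "m x (u2 x) (u3 x) = 0" "m x (u3 x) (u2 x) = 0"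
    "m x (u3 x) (u1 x) = 0" "m x (u1 x) (u3 x) = 0"
  using space assms metric unfolding SL2_tilde_def riemannian_metric_def by auto

lemma
  assumes "x \<in> U"
  shows bilinear_m: "bilinear (m x)" and m_pos: "v \<noteq> 0 \<Longrightarrow> m x v v > 0"
  using metric assms unfolding riemannian_metric_def by auto

lemma m_linear:
  assumes "x \<in> U"
  shows "linear (m x v)" "linear (\<lambda>v. m x v w)"
  using bilinear_m[OF assms] unfolding bilinear_def by auto

lemma
  assumes "x \<in> U"
  shows m_add_left: "m x (v + v') w = m x v w + m x v' w"
    and m_scaleR_left: "m x (r *\<^sub>R v) w = r * m x v w"
    and m_add_right: "m x w (v + v') = m x w v + m x w v'"
    and m_scaleR_right: "m x w (r *\<^sub>R v) = r * m x w v"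
  using linear_add[OF m_linear(2)[OF assms]] linear_scale[OF m_linear(2)[OF assms]]
    linear_add[OF m_linear(1)[OF assms]] linear_scale[OF m_linear(1)[OF assms]] by auto

lemmas m_simps = m_add_left m_scaleR_left m_add_right m_scaleR_right

text \<open>\<open>riemannian_metric\<close> provides smoothness for constant arguments only; both
  fields are expanded in the standard basis.\<close>

lemma smooth_on_m:
  assumes "open S" "S \<subseteq> U" "smooth_on S f" "smooth_on S g"
  shows "smooth_on S (\<lambda>x. m x (f x) (g x))"
proof (rule smooth_on_cong[OF assms(1)])
  show "smooth_on S (\<lambda>x. \<Sum>b\<in>Basis. \<Sum>b'\<in>Basis. (f x \<bullet> b) *\<^sub>R (g x \<bullet> b') *\<^sub>R m x b b')"
    using metric smooth_on_subset[OF _ assms(2), of "\<lambda>x. m x _ _"] unfolding riemannian_metric_def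
    by (intro smooth_on_sum smooth_on_scaleR smooth_on_bounded_linear_comp[OF bounded_linear_inner_left] assms) auto
qed (use assms bilinear_expand[OF bilinear_m] in \<open>auto\<close>)

section \<open>The frame, its dual coframe and their derivatives\<close>

definition E :: "'a \<Rightarrow> real^3 \<Rightarrow> 'a" where
  "E x c = (c $ 1) *\<^sub>R u1 x + (c $ 2) *\<^sub>R u2 x + (c $ 3) *\<^sub>R u3 x"

text \<open>The left Maurer-Cartan form. Since the frame is orthonormal, products against it read
  off the coordinates.\<close>

definition Phi :: "'a \<Rightarrow> 'a \<Rightarrow> real^3" where
  "Phi x v = vec3 (m x v (u1 x)) (m x v (u2 x)) (m x v (u3 x))"

lemma linear_E: "linear (E x)"
  by (auto intro!: linearI simp: E_def algebra_simps)

lemma linear_Phi: "x \<in> U \<Longrightarrow> linear (Phi x)"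
  by (auto intro!: linearI simp: Phi_def vec3_eq_iff m_simps)

lemma m_E: "x \<in> U \<Longrightarrow> m x (E x c) (E x d) = c \<bullet> d"
  by (simp add: E_def inner_vec3 m_simps orthonormal)

lemma Phi_E [simp]: "x \<in> U \<Longrightarrow> Phi x (E x c) = c"
  by (simp add: Phi_def E_def vec3_eq_iff orthonormal m_simps)

text \<open>\<open>E x\<close> has a left inverse and is therefore injective; as \<open>'a\<close>
  has dimension 3, it is onto. This is where the dimension enters.\<close>

lemma E_Phi [simp]:
  assumes "x \<in> U" shows "E x (Phi x v) = v"
proof -
  have "inj (E x)" using Phi_E[OF assms] by (metis injI)
  then have "dim (range (E x)) = dim (UNIV :: (real^3) set)"
    using dim_image_eq[OF linear_E, of x UNIV] by simp
  then have "dim (range (E x)) = DIM('a)" using dim3 by simp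
  then have "span (range (E x)) = UNIV" using dim_eq_full by blast
  then have "range (E x) = UNIV" using linear_subspace_image[OF linear_E subspace_UNIV] span_eq_iff by metis
  then obtain c where "v = E x c" by blast
  then show ?thesis using assms by simp
qed

lemma m_Phi: "x \<in> U \<Longrightarrow> m x v w = Phi x v \<bullet> Phi x w"
  using m_E[of x "Phi x v" "Phi x w"] by simp

lemma smooth_on_Phi:
  assumes "open S" "S \<subseteq> U" "smooth_on S f" shows "smooth_on S (\<lambda>x. Phi x (f x))"
  unfolding Phi_def
  by (intro smooth_on_vec3 smooth_on_m assms smooth_on_subset[OF smooth_u(1) assms(2)]
      smooth_on_subset[OF smooth_u(2) assms(2)] smooth_on_subset[OF smooth_u(3) assms(2)])

lemma smooth_on_E_comp:
  fixes g :: "'c::euclidean_space \<Rightarrow> 'a"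
  assumes "open S" "smooth_on S g" "g ` S \<subseteq> U" "smooth_on S c"
  shows "smooth_on S (\<lambda>s. E (g s) (c s))"
proof -
  have u: "smooth_on S (\<lambda>s. u (g s))" if "smooth_on U u" for u :: "'a \<Rightarrow> 'a"
    by (rule smooth_on_compose[OF assms(1) open_U that assms(2,3)])
  show ?thesis unfolding E_def
    by (intro smooth_on_add smooth_on_scaleR smooth_on_nth u smooth_u assms)
qed

lemma smooth_on_E: "smooth_on U (\<lambda>x. E x c)"
  by (rule smooth_on_E_comp[where g="\<lambda>x. x"])
     (auto intro: open_U smooth_on_const smooth_on_linear bounded_linear_ident)

definition DE :: "'a \<Rightarrow> 'a \<Rightarrow> real^3 \<Rightarrow> 'a" where
  "DE x w c = fderiv (\<lambda>y. E y c) x w"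

definition dPhi :: "'a \<Rightarrow> 'a \<Rightarrow> 'a \<Rightarrow> real^3" where
  "dPhi x w v = fderiv (\<lambda>y. Phi y v) x w"

lemma has_derivative_E_const: "x \<in> U \<Longrightarrow> ((\<lambda>y. E y c) has_derivative (\<lambda>w. DE x w c)) (at x)"
  unfolding DE_def by (rule smooth_on_imp_has_derivative[OF smooth_on_E])

lemma DE_eq:
  "x \<in> U \<Longrightarrow> DE x w c = (c $ 1) *\<^sub>R fderiv u1 x w + (c $ 2) *\<^sub>R fderiv u2 x w + (c $ 3) *\<^sub>R fderiv u3 x w"
  unfolding DE_def E_def using smooth_u[THEN smooth_on_imp_has_derivative]
  by (intro fderiv_eqI[THEN fun_cong] has_derivative_add has_derivative_scaleR_right) auto

lemma linear_DE_dir: "x \<in> U \<Longrightarrow> linear (\<lambda>w. DE x w c)"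
  using has_derivative_linear[OF has_derivative_E_const] .

lemma has_derivative_E [derivative_intros]:
  fixes g :: "'c::real_normed_vector \<Rightarrow> 'a"
  assumes "(g has_derivative g') (at s)" "(c has_derivative c') (at s)" "g s \<in> U"
  shows "((\<lambda>s. E (g s) (c s)) has_derivative (\<lambda>h. DE (g s) (g' h) (c s) + E (g s) (c' h))) (at s)"
proof -
  have u: "((\<lambda>s. u (g s)) has_derivative (\<lambda>h. fderiv u (g s) (g' h))) (at s)" if "smooth_on U u" for u :: "'a \<Rightarrow> 'a"
    using has_derivative_compose[OF assms(1), of u "fderiv u (g s)"] smooth_on_imp_has_derivative[OF that assms(3)] by blast
  note u = u[OF smooth_u(1)] u[OF smooth_u(2)] u[OF smooth_u(3)]
  have n: "((\<lambda>s. c s $ i) has_derivative (\<lambda>h. c' h $ i)) (at s)" for i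
    by (rule bounded_linear.has_derivative[OF bounded_linear_vec_nth assms(2)])
  show ?thesis
    unfolding E_def DE_eq[OF assms(3)]
    by (rule has_derivative_eq_rhs[OF has_derivative_add[OF has_derivative_add[OF
          has_derivative_scaleR[OF n u(1)] has_derivative_scaleR[OF n u(2)]] has_derivative_scaleR[OF n u(3)]]])
       (auto simp: algebra_simps fun_eq_iff)
qed

lemma has_derivative_Phi_const: "x \<in> U \<Longrightarrow> ((\<lambda>y. Phi y v) has_derivative (\<lambda>w. dPhi x w v)) (at x)"
  unfolding dPhi_def by (rule smooth_on_imp_has_derivative[OF smooth_on_Phi[OF open_U order_refl smooth_on_const]])

text \<open>Differentiating \<open>E x (Phi x v) = v\<close> in \<open>x\<close>.\<close>

lemma E_dPhi:
  assumes x: "x \<in> U" shows "E x (dPhi x w v) = - DE x w (Phi x v)"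
proof -
  have "((\<lambda>y. E y (Phi y v)) has_derivative (\<lambda>h. DE x h (Phi x v) + E x (dPhi x h v))) (at x)"
    by (intro has_derivative_E has_derivative_ident has_derivative_Phi_const x)
  then have "((\<lambda>y. v) has_derivative (\<lambda>h. DE x h (Phi x v) + E x (dPhi x h v))) (at x)"
    by (rule has_derivative_transform_within_open[OF _ open_U x]) simp
  from fderiv_eqI[OF this] have "DE x w (Phi x v) + E x (dPhi x w v) = 0"
    by (metis frechet_derivative_const)
  then show ?thesis by (simp add: eq_neg_iff_add_eq_0 add.commute)
qed

lemma dPhi_eq: "x \<in> U \<Longrightarrow> dPhi x w v = - Phi x (DE x w (Phi x v))"
  by (metis E_dPhi Phi_E linear_Phi linear_neg)

lemma lie_bracket_E:
  assumes x: "x \<in> U" shows "DE x (E x a) b - DE x (E x b) a = E x (br a b)"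
proof -
  have l: "linear (fderiv u1 x)" "linear (fderiv u2 x)" "linear (fderiv u3 x)"
    using smooth_u[THEN smooth_on_imp_has_derivative, OF x] has_derivative_linear by blast+
  have "fderiv u2 x (u1 x) = fderiv u1 x (u2 x) + \<tau> *\<^sub>R u3 x"
    "fderiv u3 x (u2 x) = fderiv u2 x (u3 x) + k *\<^sub>R u1 x"
    "fderiv u1 x (u3 x) = fderiv u3 x (u1 x) + k *\<^sub>R u2 x"
    using brackets[OF x] unfolding lie_bracket_def by (simp_all add: algebra_simps)
  note d = this
  show ?thesis unfolding DE_eq[OF x] E_def
    by (simp add: l[THEN linear_add] l[THEN linear_scale] d br_def algebra_simps)
qed

text \<open>This is \<open>lie_bracket_E\<close> read through \<open>E_dPhi\<close>. Later it turns
  every antisymmetrised derivative of frame coordinates into a bracket.\<close>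

lemma maurer_cartan:
  assumes x: "x \<in> U" shows "dPhi x v w - dPhi x w v = - br (Phi x v) (Phi x w)"
proof -
  have "E x (dPhi x v w - dPhi x w v) = - E x (br (Phi x v) (Phi x w))"
    using lie_bracket_E[OF x, of "Phi x v" "Phi x w", symmetric] x by (simp add: linear_diff[OF linear_E] E_dPhi)
  then have "E x (dPhi x v w - dPhi x w v) = E x (- br (Phi x v) (Phi x w))"
    by (simp only: linear_neg[OF linear_E])
  then have "Phi x (E x (dPhi x v w - dPhi x w v)) = Phi x (E x (- br (Phi x v) (Phi x w)))" by (rule arg_cong)
  then show ?thesis using x by simp
qed

section \<open>Levi-Civita connection and curvature in the frame\<close>

lemma fderiv_m:
  assumes x: "x \<in> U"
  shows "fderiv (\<lambda>y. m y v w) x h = dPhi x h v \<bullet> Phi x w + Phi x v \<bullet> dPhi x h w"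
proof -
  have "((\<lambda>y. Phi y v \<bullet> Phi y w) has_derivative (\<lambda>h. Phi x v \<bullet> dPhi x h w + dPhi x h v \<bullet> Phi x w)) (at x)"
    by (intro has_derivative_inner has_derivative_Phi_const x)
  then have "((\<lambda>y. m y v w) has_derivative (\<lambda>h. Phi x v \<bullet> dPhi x h w + dPhi x h v \<bullet> Phi x w)) (at x)"
    by (rule has_derivative_transform_within_open[OF _ open_U x]) (simp add: m_Phi)
  then show ?thesis by (simp add: fderiv_eqI)
qed

text \<open>The arguments are constant fields, whose frame coordinates vary. Expressing the metric
  derivatives by \<open>dPhi\<close> and exchanging its arguments with \<open>maurer_cartan\<close>
  turns the defining equation into \<open>lc_koszul\<close>.\<close>

lemma christoffel_eq:
  assumes x: "x \<in> U"
  shows "christoffel m x v w = E x (lc (Phi x v) (Phi x w) + dPhi x v w)" (is "_ = ?c")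
proof -
  have mc: "dPhi x a b \<bullet> c = dPhi x b a \<bullet> c - br (Phi x a) (Phi x b) \<bullet> c" for a b c
    using arg_cong[OF maurer_cartan[OF x, of a b], of "\<lambda>v. v \<bullet> c"] by (simp add: inner_diff_left)
  have c: "2 * m x ?c z = fderiv (\<lambda>y. m y w z) x v + fderiv (\<lambda>y. m y v z) x w - fderiv (\<lambda>y. m y v w) x z" for z
  proof -
    have "2 * m x ?c z = 2 * (lc (Phi x v) (Phi x w) \<bullet> Phi x z) + 2 * (dPhi x v w \<bullet> Phi x z)"
      using x by (simp add: m_Phi inner_add_left)
    then show ?thesis unfolding lc_koszul fderiv_m[OF x]
      using mc[of v z "Phi x w"] mc[of w z "Phi x v"] mc[of v w "Phi x z"]
      by (simp only: inner_commute[of "Phi x _"]) (simp add: algebra_simps)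
  qed
  show ?thesis unfolding christoffel_def
  proof (rule the_equality)
    show "\<forall>z. 2 * m x ?c z = fderiv (\<lambda>y. m y w z) x v + fderiv (\<lambda>y. m y v z) x w - fderiv (\<lambda>y. m y v w) x z"
      using c by blast
  next
    fix c assume "\<forall>z. 2 * m x c z = fderiv (\<lambda>y. m y w z) x v + fderiv (\<lambda>y. m y v z) x w - fderiv (\<lambda>y. m y v w) x z"
    then have "m x c z = m x ?c z" for z using c[of z] by (metis mult_cancel_left zero_neq_numeral)
    then have "m x (c - ?c) (c - ?c) = 0" using linear_diff[OF m_linear(2)[OF x]] by simp
    then show "c = ?c" using m_pos[OF x, of "c - ?c"] by (cases "c - ?c = 0") auto
  qed
qed

lemma nabla_const:
  "x \<in> U \<Longrightarrow> nabla m (\<lambda>_. w) (\<lambda>_. z) x = E x (lc (Phi x w) (Phi x z) + dPhi x w z)"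
  by (simp add: nabla_def christoffel_eq)

lemma nabla_E:
  assumes x: "x \<in> U" and c: "(c has_derivative c') (at x)" and Y: "\<And>y. y \<in> U \<Longrightarrow> Y y = E y (c y)"
  shows "nabla m X Y x = E x (c' (X x) + lc (Phi x (X x)) (c x))"
proof -
  have "(Y has_derivative (\<lambda>h. DE x h (c x) + E x (c' h))) (at x)"
    by (rule has_derivative_transform_within_open[OF _ open_U x, of "\<lambda>y. E y (c y)"])
       (use Y in \<open>auto intro!: derivative_intros c x\<close>)
  then have "fderiv Y x (X x) = DE x (X x) (c x) + E x (c' (X x))" by (simp add: fderiv_eqI)
  then show ?thesis unfolding nabla_def christoffel_eq[OF x]
    by (simp add: Y x linear_add[OF linear_E] E_dPhi)
qed

text \<open>The second derivatives of \<open>Phi\<close> are symmetric and cancel between the two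
  terms. The first derivatives survive only in antisymmetrised form and become
  \<open>br\<close>.\<close>

lemma curvature_E:
  assumes x: "x \<in> U"
  shows "curvature m x v w z = E x (lc (Phi x v) (lc (Phi x w) (Phi x z))
    - lc (Phi x w) (lc (Phi x v) (Phi x z)) - lc (br (Phi x v) (Phi x w)) (Phi x z))"
proof -
  have *: "nabla m (\<lambda>_. v) (nabla m (\<lambda>_. w) (\<lambda>_. z)) x =
      E x ((lc (Phi x w) (dPhi x v z) + lc (dPhi x v w) (Phi x z)) + fderiv (\<lambda>y. fderiv (\<lambda>y. Phi y z) y w) x v
        + lc (Phi x v) (lc (Phi x w) (Phi x z) + dPhi x w z))" for v w
  proof (rule nabla_E[OF x])
    have "smooth_on U (\<lambda>y. Phi y z)" by (rule smooth_on_Phi[OF open_U order_refl smooth_on_const])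
    from smooth_on_imp_has_derivative[OF smooth_on_fderiv[OF this] x]
    have "((\<lambda>y. dPhi y w z) has_derivative fderiv (\<lambda>y. fderiv (\<lambda>y. Phi y z) y w) x) (at x)"
      unfolding dPhi_def .
    then show "((\<lambda>y. lc (Phi y w) (Phi y z) + dPhi y w z) has_derivative
      (\<lambda>v. lc (Phi x w) (dPhi x v z) + lc (dPhi x v w) (Phi x z) + fderiv (\<lambda>y. fderiv (\<lambda>y. Phi y z) y w) x v)) (at x)"
      by (intro has_derivative_add lc.FDERIV has_derivative_Phi_const x)
  qed (rule nabla_const)
  have sym: "fderiv (\<lambda>y. fderiv (\<lambda>y. Phi y z) y w) x v = fderiv (\<lambda>y. fderiv (\<lambda>y. Phi y z) y v) x w"
    by (rule symmetric_second_fderiv[OF open_U x smooth_on_Phi[OF open_U order_refl smooth_on_const]])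
  have mc: "dPhi x v w = dPhi x w v - br (Phi x v) (Phi x w)"
    using maurer_cartan[OF x, of v w] by (simp add: algebra_simps)
  show ?thesis unfolding curvature_def * sym linear_diff[OF linear_E, symmetric]
    by (simp add: mc lc.diff_left lc.add_right algebra_simps)
qed

end

section \<open>Geodesics and Jacobi fields in the frame\<close>

lemma Ck_on_Suc_vector:
  fixes f :: "real \<Rightarrow> 'a::real_normed_vector"
  assumes "open S" "\<And>t. t \<in> S \<Longrightarrow> (f has_vector_derivative f' t) (at t)" "Ck_on k S f'"
  shows "Ck_on (Suc k) S f"
  using assms
  by (intro Ck_on_Suc_cong[where f'="\<lambda>t v. v *\<^sub>R f' t"] Ck_on_bounded_linear_comp[OF bounded_linear_scaleR_right])
     (auto simp: has_vector_derivative_def)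

lemma smooth_on_imp_has_vector_derivative:
  fixes f :: "real \<Rightarrow> 'a::real_normed_vector"
  assumes "smooth_on S f" "t \<in> S"
  shows "(f has_vector_derivative fderiv f t 1) (at t)"
proof -
  note d = smooth_on_imp_has_derivative[OF assms]
  have "fderiv f t h = h *\<^sub>R fderiv f t 1" for h
    using linear_scale[OF has_derivative_linear[OF d], of h 1] by (metis mult.right_neutral real_scaleR_def)
  then have "fderiv f t = (\<lambda>h. h *\<^sub>R fderiv f t 1)" by (rule ext)
  then show ?thesis using d unfolding has_vector_derivative_def by metis
qed

lemma has_vector_derivative_transform:
  assumes "(f has_vector_derivative f') (at t)" "open S" "t \<in> S" "\<And>s. s \<in> S \<Longrightarrow> f s = g s"
  shows "(g has_vector_derivative f') (at t)"
  using assms has_vector_derivative_transform_within_open by blast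

context sl2_tilde
begin

lemma has_vector_derivative_E:
  assumes "(g has_vector_derivative g') (at t)" "(c has_vector_derivative c') (at t)" "g t \<in> U"
  shows "((\<lambda>t. E (g t) (c t)) has_vector_derivative (DE (g t) g' (c t) + E (g t) c')) (at t)"
  using has_derivative_E[OF assms(1,2)[unfolded has_vector_derivative_def] assms(3)]
    linear_scale[OF linear_DE_dir[OF assms(3)]] linear_scale[OF linear_E]
  by (simp add: has_vector_derivative_def algebra_simps)

lemma smooth_on_Phi_comp:
  fixes g :: "'c::euclidean_space \<Rightarrow> 'a"
  assumes "open S" "smooth_on S g" "g ` S \<subseteq> U" "smooth_on S f"
  shows "smooth_on S (\<lambda>s. Phi (g s) (f s))"
proof (rule smooth_on_cong[OF assms(1)])
  have "smooth_on S (\<lambda>s. Phi (g s) b)" for b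
    by (rule smooth_on_compose[OF assms(1) open_U smooth_on_Phi[OF open_U order_refl smooth_on_const] assms(2,3)])
  then show "smooth_on S (\<lambda>s. \<Sum>b\<in>Basis. (f s \<bullet> b) *\<^sub>R Phi (g s) b)"
    by (intro smooth_on_sum smooth_on_scaleR smooth_on_bounded_linear_comp[OF bounded_linear_inner_left] assms) auto
next
  fix s assume "s \<in> S"
  then show "(\<Sum>b\<in>Basis. (f s \<bullet> b) *\<^sub>R Phi (g s) b) = Phi (g s) (f s)"
    using assms(3) by (intro linear_expand[OF linear_Phi, symmetric]) auto
qed

text \<open>The movement of the frame along the curve, \<open>DE\<close>, cancels against the
  summand \<open>dPhi\<close> of the Christoffel term.\<close>

lemma cov_deriv_along_E:
  assumes S: "open S" "t \<in> S" and V: "\<And>s. s \<in> S \<Longrightarrow> V s = E (\<gamma> s) (j s)"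
    and \<gamma>: "\<gamma> t \<in> U" "(\<gamma> has_vector_derivative E (\<gamma> t) v) (at t)"
    and j: "(j has_vector_derivative j') (at t)"
  shows "cov_deriv_along m \<gamma> V t = E (\<gamma> t) (j' + lc v (j t))"
proof -
  have "(V has_vector_derivative (DE (\<gamma> t) (E (\<gamma> t) v) (j t) + E (\<gamma> t) j')) (at t)"
    by (rule has_vector_derivative_transform[OF has_vector_derivative_E[OF \<gamma>(2) j \<gamma>(1)] S]) (simp add: V)
  then show ?thesis
    using \<gamma> unfolding cov_deriv_along_def velocity_def christoffel_eq[OF \<gamma>(1)]
    by (simp add: vector_derivative_at V[OF S(2)] linear_add[OF linear_E] E_dPhi)
qed

text \<open>\<open>v\<close> is a separate argument because its equation is closed: it can be solved
  on the Lie algebra first, as \<open>euler_flow\<close> does, and \<open>\<gamma>\<close> recovered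
  afterwards.\<close>

definition geo_flow :: "real set \<Rightarrow> (real \<Rightarrow> 'a) \<Rightarrow> (real \<Rightarrow> real^3) \<Rightarrow> bool" where
  "geo_flow I \<gamma> v \<longleftrightarrow> (\<forall>t\<in>I. \<gamma> t \<in> U \<and> (\<gamma> has_vector_derivative E (\<gamma> t) (v t)) (at t) \<and>
     (v has_vector_derivative - lc (v t) (v t)) (at t))"

lemma geo_flowD:
  assumes "geo_flow I \<gamma> v" "t \<in> I"
  shows "\<gamma> t \<in> U" "(\<gamma> has_vector_derivative E (\<gamma> t) (v t)) (at t)" "velocity \<gamma> t = E (\<gamma> t) (v t)"
    "(v has_vector_derivative - lc (v t) (v t)) (at t)"
  using assms by (auto simp: geo_flow_def velocity_def vector_derivative_at)

text \<open>Bootstrapping: the right-hand sides are smooth in the solution, so each order of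
  differentiability yields the next. \<open>v\<close> comes first because the equation of
  \<open>\<gamma>\<close> contains it.\<close>

lemma geo_flow_smooth:
  assumes "open I" "geo_flow I \<gamma> v"
  shows "smooth_on I v" "smooth_on I \<gamma>"
proof -
  have cont: "continuous_on I v" "continuous_on I \<gamma>"
    using geo_flowD[OF assms(2)]
    by (meson continuous_at_imp_continuous_on has_vector_derivative_continuous)+
  have v: "Ck_on k I v" for k
  proof (induction k)
    case (Suc k)
    have "Ck_on k I (\<lambda>t. - lc (v t) (v t))"
      using Ck_on_bounded_linear_comp[OF bounded_linear_minus[OF bounded_linear_ident] assms(1)
          Ck_on_bilinear[OF bounded_bilinear_lc assms(1) Suc Suc]] .
    then show ?case using geo_flowD[OF assms(2)] by (intro Ck_on_Suc_vector[OF assms(1)]) auto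
  qed (use cont in auto)
  have u: "Ck_on k U u1" "Ck_on k U u2" "Ck_on k U u3" for k
    using smooth_u by (auto simp: smooth_on_def)
  have "Ck_on k I \<gamma>" for k
  proof (induction k)
    case (Suc k)
    have "Ck_on k I (\<lambda>t. u (\<gamma> t))" if "Ck_on k U u" for u :: "'a \<Rightarrow> 'a"
      by (rule Ck_on_compose[OF assms(1) open_U that Suc]) (use geo_flowD[OF assms(2)] in auto)
    note C = this[OF u(1)] this[OF u(2)] this[OF u(3)]
    have "Ck_on k I (\<lambda>t. E (\<gamma> t) (v t))"
      unfolding E_def
      by (intro Ck_on_add Ck_on_bilinear[OF bounded_bilinear_scaleR] C assms(1)
          Ck_on_bounded_linear_comp[OF bounded_linear_vec_nth] v)
    then show ?case using geo_flowD[OF assms(2)] by (intro Ck_on_Suc_vector[OF assms(1)]) auto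
  qed (use cont in auto)
  with v show "smooth_on I v" "smooth_on I \<gamma>" by (auto simp: smooth_on_def)
qed

lemma geodesic_iff_geo_flow:
  "geodesic U m I \<gamma> \<longleftrightarrow> open I \<and> is_interval I \<and> I \<noteq> {} \<and> (\<exists>v. geo_flow I \<gamma> v)"
proof
  assume g: "geodesic U m I \<gamma>"
  then have I: "open I" and \<gamma>: "smooth_on I \<gamma>" "\<gamma> ` I \<subseteq> U" unfolding geodesic_def by auto
  define v where "v t = Phi (\<gamma> t) (fderiv \<gamma> t 1)" for t
  have d: "(\<gamma> has_vector_derivative fderiv \<gamma> t 1) (at t)" if "t \<in> I" for t
    using smooth_on_imp_has_vector_derivative[OF \<gamma>(1) that] .
  have E: "velocity \<gamma> t = E (\<gamma> t) (v t)" if "t \<in> I" for t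
    unfolding velocity_def v_def using vector_derivative_at[OF d[OF that]] \<gamma>(2) that by auto
  have v: "smooth_on I v" unfolding v_def
    by (rule smooth_on_Phi_comp[OF I \<gamma> smooth_on_fderiv[OF \<gamma>(1)]])
  have "geo_flow I \<gamma> v"
    unfolding geo_flow_def
  proof (intro ballI conjI)
    fix t assume t: "t \<in> I"
    then show U: "\<gamma> t \<in> U" using \<gamma> by auto
    show d': "(\<gamma> has_vector_derivative E (\<gamma> t) (v t)) (at t)"
      using d[OF t] E[OF t] vector_derivative_at unfolding velocity_def by metis
    note vd = smooth_on_imp_has_vector_derivative[OF v t]
    have "E (\<gamma> t) (fderiv v t 1 + lc (v t) (v t)) = 0"
      using cov_deriv_along_E[OF I t E U d' vd] g t unfolding geodesic_def by auto
    then have "fderiv v t 1 + lc (v t) (v t) = 0"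
      by (metis Phi_E U linear_0 linear_Phi)
    then have "fderiv v t 1 = - lc (v t) (v t)" by (simp only: eq_neg_iff_add_eq_0)
    then show "(v has_vector_derivative - lc (v t) (v t)) (at t)" using vd by simp
  qed
  then show "open I \<and> is_interval I \<and> I \<noteq> {} \<and> (\<exists>v. geo_flow I \<gamma> v)"
    using g unfolding geodesic_def by auto
next
  assume "open I \<and> is_interval I \<and> I \<noteq> {} \<and> (\<exists>v. geo_flow I \<gamma> v)"
  then obtain v where I: "open I" "is_interval I" "I \<noteq> {}" and v: "geo_flow I \<gamma> v" by blast
  have "cov_deriv_along m \<gamma> (velocity \<gamma>) t = 0" if "t \<in> I" for t
    using cov_deriv_along_E[OF I(1) that geo_flowD(3)[OF v] geo_flowD(1)[OF v that] geo_flowD(2)[OF v that] geo_flowD(4)[OF v that]]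
    by (simp add: linear_0[OF linear_E])
  then show "geodesic U m I \<gamma>"
    using I geo_flow_smooth[OF I(1) v] geo_flowD(1)[OF v] unfolding geodesic_def by auto
qed

text \<open>In the left-invariant frame the Jacobi equation is the linearisation of \<open>\<gamma>' = E \<gamma> v\<close>,
  \<open>v' = - lc v v\<close>, with \<open>d\<close> the variation of \<open>v\<close>.\<close>

definition jacobi_flow :: "real set \<Rightarrow> (real \<Rightarrow> real^3) \<Rightarrow> (real \<Rightarrow> real^3) \<Rightarrow> (real \<Rightarrow> real^3) \<Rightarrow> bool" where
  "jacobi_flow I v j d \<longleftrightarrow> (\<forall>t\<in>I. (j has_vector_derivative d t - br (v t) (j t)) (at t) \<and>
     (d has_vector_derivative - (lc (d t) (v t) + lc (v t) (d t))) (at t))"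

text \<open>The derivative \<open>p'\<close> of the first covariant derivative is left open. A given
  Jacobi field supplies it by smoothness, a solution of \<open>jacobi_flow\<close> by its
  equations.\<close>

lemma jacobi_operator_E:
  assumes I: "open I" and v: "geo_flow I \<gamma> v" and J: "\<And>s. s \<in> I \<Longrightarrow> J s = E (\<gamma> s) (j s)"
    and j: "\<And>s. s \<in> I \<Longrightarrow> (j has_vector_derivative j' s) (at s)"
    and p: "((\<lambda>s. j' s + lc (v s) (j s)) has_vector_derivative p') (at t)" and t: "t \<in> I"
  shows "cov_deriv_along m \<gamma> (cov_deriv_along m \<gamma> J) t + curvature m (\<gamma> t) (J t) (velocity \<gamma> t) (velocity \<gamma> t)
    = E (\<gamma> t) (p' + lc (v t) (j' t + lc (v t) (j t)) + lc (j t) (lc (v t) (v t))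
        - lc (v t) (lc (j t) (v t)) - lc (br (j t) (v t)) (v t))"
proof -
  note D = geo_flowD[OF v]
  have 1: "cov_deriv_along m \<gamma> J s = E (\<gamma> s) (j' s + lc (v s) (j s))" if "s \<in> I" for s
    by (rule cov_deriv_along_E[OF I that J D(1)[OF that] D(2)[OF that] j[OF that]])
  show ?thesis
    by (simp add: cov_deriv_along_E[OF I t 1 D(1)[OF t] D(2)[OF t] p] curvature_E[OF D(1)[OF t]] J D t
        linear_add[OF linear_E, symmetric] algebra_simps)
qed

lemma jacobi_field_imp_flow:
  assumes I: "open I" and v: "geo_flow I \<gamma> v" and J: "jacobi_field m I \<gamma> J"
  obtains j d where "jacobi_flow I v j d" "\<And>t. t \<in> I \<Longrightarrow> J t = E (\<gamma> t) (j t)" "\<And>t. j t = Phi (\<gamma> t) (J t)"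
proof -
  note D = geo_flowD[OF v]
  define j where "j t = Phi (\<gamma> t) (J t)" for t
  have j: "smooth_on I j" unfolding j_def
    by (rule smooth_on_Phi_comp[OF I geo_flow_smooth(2)[OF I v]]) (use D J in \<open>auto simp: jacobi_field_def\<close>)
  have Jj: "J t = E (\<gamma> t) (j t)" if "t \<in> I" for t using D(1)[OF that] unfolding j_def by simp
  define j' where "j' t = fderiv j t 1" for t
  have dj: "(j has_vector_derivative j' t) (at t)" if "t \<in> I" for t
    unfolding j'_def by (rule smooth_on_imp_has_vector_derivative[OF j that])
  have "smooth_on I j'" unfolding j'_def by (rule smooth_on_fderiv[OF j])
  then have sp: "smooth_on I (\<lambda>s. j' s + lc (v s) (j s))"
    by (intro smooth_on_add smooth_on_bilinear[OF bounded_bilinear_lc] I j geo_flow_smooth(1)[OF I v])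
  \<comment> \<open>For a variation of geodesics, equality of mixed derivatives reads
    \<open>j' = d - br v j\<close>. This is that relation solved for \<open>d\<close>.\<close>
  define d where "d t = j' t + lc (v t) (j t) - lc (j t) (v t)" for t
  have "jacobi_flow I v j d"
    unfolding jacobi_flow_def
  proof (intro ballI conjI)
    fix t assume t: "t \<in> I"
    have j't: "j' t = d t - br (v t) (j t)"
      unfolding d_def lc_torsion_free[symmetric] by simp
    then show "(j has_vector_derivative d t - br (v t) (j t)) (at t)" using dj[OF t] by simp
    define p' where "p' = fderiv (\<lambda>s. j' s + lc (v s) (j s)) t 1"
    have dp: "((\<lambda>s. j' s + lc (v s) (j s)) has_vector_derivative p') (at t)"
      unfolding p'_def by (rule smooth_on_imp_has_vector_derivative[OF sp t])
    have "E (\<gamma> t) (p' + lc (v t) (j' t + lc (v t) (j t)) + lc (j t) (lc (v t) (v t))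
        - lc (v t) (lc (j t) (v t)) - lc (br (j t) (v t)) (v t)) = 0"
      using jacobi_operator_E[OF I v Jj dj dp t] J t unfolding jacobi_field_def by simp
    then have p': "p' + lc (v t) (j' t + lc (v t) (j t)) + lc (j t) (lc (v t) (v t))
        - lc (v t) (lc (j t) (v t)) - lc (br (j t) (v t)) (v t) = 0"
      by (metis Phi_E D(1)[OF t] linear_0 linear_Phi)
    have "(d has_vector_derivative p' - (lc (j t) (- lc (v t) (v t)) + lc (j' t) (v t))) (at t)"
      unfolding d_def by (intro has_vector_derivative_diff dp lc.has_vector_derivative dj t D)
    moreover have "p' - (lc (j t) (- lc (v t) (v t)) + lc (j' t) (v t)) = - (lc (d t) (v t) + lc (v t) (d t))"
    proof -
      have "p' = - lc (v t) (j' t + lc (v t) (j t)) - lc (j t) (lc (v t) (v t))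
        + lc (v t) (lc (j t) (v t)) + lc (br (j t) (v t)) (v t)"
        using p' by (simp add: algebra_simps eq_neg_iff_add_eq_0)
      then show ?thesis
        by (simp add: d_def lc_torsion_free[symmetric] lc.add_right lc.diff_right lc.diff_left lc.add_left
            lc.minus_right lc.minus_left)
    qed
    ultimately show "(d has_vector_derivative - (lc (d t) (v t) + lc (v t) (d t))) (at t)" by simp
  qed
  then show thesis using that Jj j_def by blast
qed

lemma jacobi_flow_imp_field:
  assumes I: "open I" and v: "geo_flow I \<gamma> v" and jd: "jacobi_flow I v j d"
  shows "jacobi_field m I \<gamma> (\<lambda>t. E (\<gamma> t) (j t))"
proof -
  note D = geo_flowD[OF v]
  have dj: "(j has_vector_derivative d t - br (v t) (j t)) (at t)"
    and dd: "(d has_vector_derivative - (lc (d t) (v t) + lc (v t) (d t))) (at t)" if "t \<in> I" for t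
    using jd that unfolding jacobi_flow_def by auto
  have v': "Ck_on k I v" for k using geo_flow_smooth(1)[OF I v] by (simp add: smooth_on_def)
  have "continuous_on I j" "continuous_on I d"
    using dj dd by (meson continuous_at_imp_continuous_on has_vector_derivative_continuous)+
  moreover have m: "Ck_on k I (\<lambda>t. - f t)" if "Ck_on k I f" for k and f :: "real \<Rightarrow> real^3"
    by (rule Ck_on_bounded_linear_comp[OF bounded_linear_minus[OF bounded_linear_ident] I that])
  ultimately have "Ck_on k I j \<and> Ck_on k I d" for k
  proof (induction k)
    case (Suc k)
    then have *: "Ck_on k I j" "Ck_on k I d" by auto
    have "Ck_on k I (\<lambda>t. d t + - br (v t) (j t))" "Ck_on k I (\<lambda>t. - (lc (d t) (v t) + lc (v t) (d t)))"
      by (intro Ck_on_add m Ck_on_bilinear[OF bounded_bilinear_lc] Ck_on_bilinear[OF bounded_bilinear_br] I * v')+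
    then show ?case using dj dd by (auto intro!: Ck_on_Suc_vector[OF I] simp del: Ck_on.simps)
  qed auto
  then have j: "smooth_on I j" by (auto simp: smooth_on_def)
  show ?thesis unfolding jacobi_field_def
  proof (intro conjI ballI)
    show "smooth_on I (\<lambda>t. E (\<gamma> t) (j t))"
      by (rule smooth_on_E_comp[OF I geo_flow_smooth(2)[OF I v] _ j]) (use D in auto)
  next
    fix t assume t: "t \<in> I"
    \<comment> \<open>Torsion-freeness removes \<open>br\<close> from the first covariant
      derivative; what is left is differentiated by the flow equations.\<close>
    have p: "d s - br (v s) (j s) + lc (v s) (j s) = d s + lc (j s) (v s)" for s
      unfolding lc_torsion_free[symmetric] by simp
    have "((\<lambda>s. d s - br (v s) (j s) + lc (v s) (j s)) has_vector_derivative
      - (lc (d t) (v t) + lc (v t) (d t)) + (lc (j t) (- lc (v t) (v t)) + lc (d t - br (v t) (j t)) (v t))) (at t)"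
      unfolding p by (intro has_vector_derivative_add lc.has_vector_derivative dj dd t D)
    note q = jacobi_operator_E[where J="\<lambda>t. E (\<gamma> t) (j t)", OF I v refl dj this t]
    show "cov_deriv_along m \<gamma> (cov_deriv_along m \<gamma> (\<lambda>t. E (\<gamma> t) (j t))) t
        + curvature m (\<gamma> t) (E (\<gamma> t) (j t)) (velocity \<gamma> t) (velocity \<gamma> t) = 0"
    proof (rule trans[OF q])
      have "- (lc (d t) (v t) + lc (v t) (d t)) + (lc (j t) (- lc (v t) (v t)) + lc (d t - br (v t) (j t)) (v t)) +
          lc (v t) (d t + lc (j t) (v t)) + lc (j t) (lc (v t) (v t)) - lc (v t) (lc (j t) (v t)) -
          lc (br (j t) (v t)) (v t) = 0"
        by (simp add: lc_torsion_free[symmetric] lc.add_right lc.diff_right lc.diff_left lc.add_left lc.minus_right)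
      then show "E (\<gamma> t) (- (lc (d t) (v t) + lc (v t) (d t)) +
          (lc (j t) (- lc (v t) (v t)) + lc (d t - br (v t) (j t)) (v t)) +
          lc (v t) (d t - br (v t) (j t) + lc (v t) (j t)) + lc (j t) (lc (v t) (v t)) -
          lc (v t) (lc (j t) (v t)) - lc (br (j t) (v t)) (v t)) = 0"
        unfolding p by (simp add: linear_0[OF linear_E])
    qed
  qed
qed

end

section \<open>Geodesics are injective\<close>

lemma has_vector_derivative_zero_const:
  fixes f :: "real \<Rightarrow> 'a::real_normed_vector"
  assumes "is_interval I" "\<And>t. t \<in> I \<Longrightarrow> (f has_vector_derivative 0) (at t)" "s \<in> I" "t \<in> I"
  shows "f s = f t"
proof -
  have "(f has_derivative (\<lambda>h. 0)) (at x within I)" if "x \<in> I" for x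
    using assms(2)[OF that] by (auto simp: has_vector_derivative_def intro: has_derivative_at_withinI)
  then show ?thesis
    using has_derivative_zero_unique[of I f t s] assms is_interval_convex by metis
qed

text \<open>Near \<open>r\<close> the increment of \<open>\<phi>\<close> stays below
  \<open>pi / 2\<close>, so \<open>arcsin\<close> recovers it from
  \<open>sin (\<phi> t - \<phi> r)\<close>, which the addition formula writes in terms of the two
  differentiable functions.\<close>

lemma continuous_angle_has_derivative:
  fixes \<phi> :: "real \<Rightarrow> real"
  assumes cont: "isCont \<phi> r"
    and c: "((\<lambda>t. cos (\<phi> t)) has_real_derivative c') (at r)"
    and s: "((\<lambda>t. sin (\<phi> t)) has_real_derivative s') (at r)"
  shows "(\<phi> has_real_derivative (s' * cos (\<phi> r) - c' * sin (\<phi> r))) (at r)"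
proof -
  let ?w = "\<lambda>t. sin (\<phi> t) * cos (\<phi> r) - cos (\<phi> t) * sin (\<phi> r)"
  have w: "?w t = sin (\<phi> t - \<phi> r)" for t by (simp add: sin_diff)
  have "(?w has_real_derivative (s' * cos (\<phi> r) - c' * sin (\<phi> r))) (at r)"
    by (rule DERIV_diff[OF DERIV_cmult_right[OF s] DERIV_cmult_right[OF c]])
  moreover have "(arcsin has_real_derivative 1) (at (?w r))"
    using DERIV_arcsin[of 0] by simp
  ultimately have "((\<lambda>t. arcsin (?w t)) has_real_derivative 1 * (s' * cos (\<phi> r) - c' * sin (\<phi> r))) (at r)"
    by (rule DERIV_chain2[rotated])
  then have 1: "((\<lambda>t. \<phi> r + arcsin (?w t)) has_real_derivative (s' * cos (\<phi> r) - c' * sin (\<phi> r))) (at r)"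
    using DERIV_add[OF DERIV_const, of "\<lambda>t. arcsin (?w t)" _ r UNIV "\<phi> r"] by simp
  obtain e where e: "e > 0" "\<And>t. dist t r < e \<Longrightarrow> dist (\<phi> t) (\<phi> r) < pi / 2"
    using cont pi_half_gt_zero unfolding continuous_at_eps_delta by (metis dist_real_def)
  show ?thesis
  proof (rule has_field_derivative_transform_within_open[OF 1])
    show "open (ball r e)" "r \<in> ball r e" using e by auto
    fix t assume "t \<in> ball r e"
    then have "dist (\<phi> t) (\<phi> r) < pi / 2" using e(2) by (metis mem_ball dist_commute)
    then show "\<phi> r + arcsin (?w t) = \<phi> t"
      unfolding w dist_real_def by (subst arcsin_sin) linarith+
  qed
qed

text \<open>A positive derivative at \<open>s\<close> would move \<open>f\<close> strictly away from
  \<open>f s\<close> on the side of \<open>t\<close>, and monotonicity would forbid the return. Used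
  for loops and again for pairs of zeros of a Jacobi field.\<close>

lemma return_imp_zero_derivative:
  fixes f :: "real \<Rightarrow> real"
  assumes I: "is_interval I" and d: "\<And>r. r \<in> I \<Longrightarrow> (f has_real_derivative f' r) (at r)"
    and nn: "\<And>r. r \<in> I \<Longrightarrow> f' r \<ge> 0" and st: "s \<in> I" "t \<in> I" "s \<noteq> t" "f s = f t"
  shows "f' s = 0"
proof (rule ccontr)
  assume "f' s \<noteq> 0"
  then have pos: "f' s > 0" using nn[OF st(1)] by simp
  have sub: "r \<in> I" if "min s t \<le> r" "r \<le> max s t" for r
    using I st that unfolding is_interval_1 by (metis max_def min_def)
  have mono: "f x \<le> f y" if "x \<le> y" "min s t \<le> x" "y \<le> max s t" for x y
  proof (rule DERIV_nonneg_imp_nondecreasing[OF that(1)])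
    fix r assume "x \<le> r" "r \<le> y"
    then have "r \<in> I" using sub[of r] that by linarith
    then show "\<exists>y. DERIV f r :> y \<and> y \<ge> 0" using d nn by blast
  qed
  show False
  proof (cases "s < t")
    case True
    obtain e where e: "e > 0" "\<And>h. h > 0 \<Longrightarrow> h < e \<Longrightarrow> f s < f (s + h)"
      using DERIV_pos_inc_right[OF d[OF st(1)] pos] by blast
    define h where "h = min (e/2) (t - s)"
    have "h > 0" "h < e" "s + h \<le> t" using e True unfolding h_def by auto
    then show False using e(2)[of h] mono[of "s + h" t] st(4) True by auto
  next
    case False
    obtain e where e: "e > 0" "\<And>h. h > 0 \<Longrightarrow> h < e \<Longrightarrow> f (s - h) < f s"
      using DERIV_pos_inc_left[OF d[OF st(1)] pos] by blast
    define h where "h = min (e/2) (s - t)"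
    have "h > 0" "h < e" "t \<le> s - h" using e False st(3) unfolding h_def by auto
    then show False using e(2)[of h] mono[of t "s - h"] st(4) False by auto
  qed
qed

section \<open>Right-invariant fields and conserved momenta\<close>

context sl2_tilde
begin

text \<open>Left invariance is phrased with the derivative of the multiplication as one map on
  pairs, so that symmetry of its second derivatives can be used.\<close>

lemma left_invariant_E:
  assumes "a \<in> U" "x \<in> U"
  shows "E (a \<otimes>\<^bsub>G\<^esub> x) c = fderiv (\<lambda>(x, y). x \<otimes>\<^bsub>G\<^esub> y) (a, x) (0, E x c)"
proof -
  let ?M = "\<lambda>(x, y). x \<otimes>\<^bsub>G\<^esub> y"
  have M: "(?M has_derivative fderiv ?M (a, x)) (at (a, x))"
    by (rule smooth_on_imp_has_derivative[OF smooth_mult]) (use assms in auto)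
  have "((\<lambda>y. (a, y)) has_derivative (\<lambda>h. (0, h))) (at x)" by (auto intro!: derivative_eq_intros)
  from has_derivative_compose[OF this M]
  have d: "d_left G a x v = fderiv ?M (a, x) (0, v)" for v
    unfolding d_left_def by (simp add: fderiv_eqI)
  have l: "linear (\<lambda>v. fderiv ?M (a, x) (0, v))"
    using linear_compose[of "\<lambda>v. (0, v)" "fderiv ?M (a, x)"] has_derivative_linear[OF M]
    by (simp add: o_def linear_iff)
  have "u1 (a \<otimes>\<^bsub>G\<^esub> x) = d_left G a x (u1 x)" "u2 (a \<otimes>\<^bsub>G\<^esub> x) = d_left G a x (u2 x)"
    "u3 (a \<otimes>\<^bsub>G\<^esub> x) = d_left G a x (u3 x)"
    using space assms unfolding SL2_tilde_def left_invariant_field_def by auto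
  then show ?thesis unfolding E_def d by (simp add: linear_add[OF l] linear_scale[OF l])
qed

text \<open>Right-invariant fields commute with left-invariant ones; in the left-invariant frame this says that
  their coordinates \<open>c\<close>, that is \<open>Ad (x\<^sup>-\<^sup>1) w\<close>, satisfy \<open>dc = [c, Phi]\<close>.\<close>

lemma right_invariant_coordinates:
  assumes g: "g \<in> U"
  obtains c where "\<And>x. x \<in> U \<Longrightarrow> (c has_derivative (\<lambda>h. br (c x) (Phi x h))) (at x)" "c g = p"
    "p \<noteq> 0 \<Longrightarrow> \<forall>x\<in>U. c x \<noteq> 0"
proof -
  let ?M = "\<lambda>(x, y). x \<otimes>\<^bsub>G\<^esub> y"
  interpret G: group G by (rule group)
  have op: "open (U \<times> U)" using open_U by (simp add: open_Times)
  define D where "D p q = fderiv ?M p q" for p q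
  \<comment> \<open>The right-invariant field with value \<open>w\<close> at the identity: the
    derivative of \<open>a \<mapsto> a x\<close> there.\<close>
  define \<rho> where "\<rho> w x = D (\<one>\<^bsub>G\<^esub>, x) (w, 0)" for w x
  have M: "(?M has_derivative D (a, x)) (at (a, x))" if "a \<in> U" "x \<in> U" for a x
    unfolding D_def by (rule smooth_on_imp_has_derivative[OF smooth_mult]) (use that in auto)
  have pr: "((\<lambda>a. (a, x)) has_derivative (\<lambda>h. (h, 0))) (at a)" "((\<lambda>x. (a, x)) has_derivative (\<lambda>h. (0, h))) (at x)"
    for a x :: 'a by (auto intro!: derivative_eq_intros)
  have D2: "((\<lambda>p. D p q) has_derivative fderiv (\<lambda>p. D p q) (a, x)) (at (a, x))" if "a \<in> U" "x \<in> U" for q a x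
    unfolding D_def by (rule smooth_on_imp_has_derivative[OF smooth_on_fderiv[OF smooth_mult]]) (use that in auto)
  have sym: "fderiv (\<lambda>p. D p q) (a, x) r = fderiv (\<lambda>p. D p r) (a, x) q" if "a \<in> U" "x \<in> U" for q r a x
    unfolding D_def by (rule symmetric_second_fderiv[OF op _ smooth_mult]) (use that in auto)
  have R: "((\<lambda>y. y \<otimes>\<^bsub>G\<^esub> x) has_derivative (\<lambda>h. D (a, x) (h, 0))) (at a)" if "a \<in> U" "x \<in> U" for a x
    using has_derivative_compose[OF pr(1) M[OF that]] by simp
  \<comment> \<open>Both sides are the mixed second derivative of the multiplication at the identity
    and \<open>x\<close>, taken in the two orders.\<close>
  have comm: "DE x (\<rho> w x) c = fderiv (\<rho> w) x (E x c)" if x: "x \<in> U" for x w c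
  proof -
    have "((\<lambda>a. E (a \<otimes>\<^bsub>G\<^esub> x) c) has_derivative (\<lambda>h. DE (\<one>\<^bsub>G\<^esub> \<otimes>\<^bsub>G\<^esub> x) (D (\<one>\<^bsub>G\<^esub>, x) (h, 0)) c + E (\<one>\<^bsub>G\<^esub> \<otimes>\<^bsub>G\<^esub> x) 0)) (at \<one>\<^bsub>G\<^esub>)"
      by (intro has_derivative_E R has_derivative_const) (use x in auto)
    then have "((\<lambda>a. E (a \<otimes>\<^bsub>G\<^esub> x) c) has_derivative (\<lambda>h. DE x (\<rho> h x) c)) (at \<one>\<^bsub>G\<^esub>)"
      using x by (simp add: \<rho>_def linear_0[OF linear_E])
    then have "((\<lambda>a. D (a, x) (0, E x c)) has_derivative (\<lambda>h. DE x (\<rho> h x) c)) (at \<one>\<^bsub>G\<^esub>)"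
      by (rule has_derivative_transform_within_open[OF _ open_U])
         (use x left_invariant_E in \<open>auto simp: D_def\<close>)
    from fderiv_eqI[OF this] fderiv_eqI[OF has_derivative_compose[OF pr(1) D2[OF G.one_closed x, of "(0, E x c)"]]]
    have 1: "DE x (\<rho> w x) c = fderiv (\<lambda>p. D p (0, E x c)) (\<one>\<^bsub>G\<^esub>, x) (w, 0)" by metis
    have 2: "(\<rho> w has_derivative (\<lambda>h. fderiv (\<lambda>p. D p (w, 0)) (\<one>\<^bsub>G\<^esub>, x) (0, h))) (at x)"
      unfolding \<rho>_def by (rule has_derivative_compose[OF pr(2) D2[OF G.one_closed x]])
    show "DE x (\<rho> w x) c = fderiv (\<rho> w) x (E x c)"
      unfolding fderiv_eqI[OF 2] 1 by (rule sym[OF G.one_closed x])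
  qed
  \<comment> \<open>Right translation by the inverse of \<open>x\<close> undoes the translation in
    \<open>\<rho> w x\<close>. Hence \<open>\<rho>\<close> is injective in \<open>w\<close>, and any
    value can be prescribed at \<open>g\<close>.\<close>
  have inv: "D (x, inv\<^bsub>G\<^esub> x) (\<rho> w x, 0) = w" if x: "x \<in> U" for x w
  proof -
    have x1: "\<one>\<^bsub>G\<^esub> \<otimes>\<^bsub>G\<^esub> x = x" using x by simp
    have "((\<lambda>y. (y \<otimes>\<^bsub>G\<^esub> x) \<otimes>\<^bsub>G\<^esub> inv\<^bsub>G\<^esub> x) has_derivative (\<lambda>h. D (x, inv\<^bsub>G\<^esub> x) (D (\<one>\<^bsub>G\<^esub>, x) (h, 0), 0))) (at \<one>\<^bsub>G\<^esub>)"
      using has_derivative_compose[OF R[OF G.one_closed x], of "\<lambda>y. y \<otimes>\<^bsub>G\<^esub> inv\<^bsub>G\<^esub> x"] R[OF x G.inv_closed[OF x]]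
      by (simp add: x1)
    then have "((\<lambda>y. y) has_derivative (\<lambda>h. D (x, inv\<^bsub>G\<^esub> x) (D (\<one>\<^bsub>G\<^esub>, x) (h, 0), 0))) (at \<one>\<^bsub>G\<^esub>)"
      by (rule has_derivative_transform_within_open[OF _ open_U]) (use x in \<open>auto simp: G.m_assoc\<close>)
    from fderiv_eqI[OF this] show ?thesis unfolding \<rho>_def by (metis frechet_derivative_ident)
  qed
  have lin: "linear (\<lambda>w. \<rho> w x)" if x: "x \<in> U" for x
    using linear_compose[of "\<lambda>v. (v, 0)" "D (\<one>\<^bsub>G\<^esub>, x)"] has_derivative_linear[OF M[OF G.one_closed x]]
    by (simp add: o_def linear_iff \<rho>_def)
  have inj: "inj (\<lambda>w. \<rho> w x)" if x: "x \<in> U" for x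
    by (rule injI) (metis inv[OF x])
  obtain w where w: "\<rho> w g = E g p"
    using linear_injective_imp_surjective[OF lin[OF g] inj[OF g]] by (metis surjD)
  define c where "c x = Phi x (\<rho> w x)" for x
  have rc: "\<rho> w x = E x (c x)" if "x \<in> U" for x using that unfolding c_def by simp
  show thesis
  proof
    show "c g = p" unfolding c_def w using g by simp
    show "\<forall>x\<in>U. c x \<noteq> 0" if "p \<noteq> 0"
    proof
      fix x assume x: "x \<in> U"
      have "w \<noteq> 0"
        using w linear_0[OF lin[OF g]] that g by (metis Phi_E linear_0 linear_Phi)
      then have "\<rho> w x \<noteq> 0" using inj[OF x] linear_0[OF lin[OF x]] by (metis injD)
      then show "c x \<noteq> 0" using rc[OF x] by (auto simp: linear_0[OF linear_E])
    qed
    fix x assume x: "x \<in> U"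
    have "smooth_on U (\<rho> w)"
      unfolding \<rho>_def D_def
      by (rule smooth_on_compose[OF open_U op smooth_on_fderiv[OF smooth_mult]])
         (auto intro!: smooth_on_Suc[OF open_U pr(2)] smooth_on_const)
    then have cd: "(c has_derivative fderiv c x) (at x)"
      unfolding c_def by (intro smooth_on_imp_has_derivative[OF smooth_on_Phi[OF open_U order_refl]] x)
    have "(\<rho> w has_derivative (\<lambda>h. DE x h (c x) + E x (fderiv c x h))) (at x)"
      by (rule has_derivative_transform_within_open[OF has_derivative_E[OF has_derivative_ident cd x] open_U x])
         (simp add: rc)
    from fun_cong[OF fderiv_eqI[OF this]]
    have "DE x (\<rho> w x) d = DE x (E x d) (c x) + E x (fderiv c x (E x d))" for d
      unfolding comm[OF x] .
    then have "E x (fderiv c x (E x d)) = E x (br (c x) d)" for d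
      using lie_bracket_E[OF x, of "c x" d] rc[OF x] by (metis add_diff_cancel_left')
    then have "fderiv c x (E x d) = br (c x) d" for d by (metis Phi_E x)
    then have "fderiv c x = (\<lambda>h. br (c x) (Phi x h))" using E_Phi[OF x] by metis
    then show "(c has_derivative (\<lambda>h. br (c x) (Phi x h))) (at x)" using cd by simp
  qed
qed

lemma right_invariant_along:
  assumes "\<And>x. x \<in> U \<Longrightarrow> (c has_derivative (\<lambda>h. br (c x) (Phi x h))) (at x)" "geo_flow I \<gamma> v" "t \<in> I"
  shows "((\<lambda>t. c (\<gamma> t)) has_vector_derivative br (c (\<gamma> t)) (v t)) (at t)"
  using has_derivative_compose[OF geo_flowD(2)[OF assms(2,3), unfolded has_vector_derivative_def]
      assms(1)[OF geo_flowD(1)[OF assms(2,3)]]] geo_flowD(1)[OF assms(2,3)]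
  by (simp add: has_vector_derivative_def linear_scale[OF linear_Phi] br.scaleR_right)

lemma geo_flow_components:
  assumes "geo_flow I \<gamma> v" "t \<in> I"
  shows "((\<lambda>t. v t $ 1) has_real_derivative (k - \<tau>) * v t $ 2 * v t $ 3) (at t)"
    "((\<lambda>t. v t $ 2) has_real_derivative (\<tau> - k) * v t $ 1 * v t $ 3) (at t)"
    "((\<lambda>t. v t $ 3) has_real_derivative 0) (at t)"
  using bounded_linear.has_vector_derivative[OF bounded_linear_vec_nth geo_flowD(4)[OF assms], of 1]
    bounded_linear.has_vector_derivative[OF bounded_linear_vec_nth geo_flowD(4)[OF assms], of 2]
    bounded_linear.has_vector_derivative[OF bounded_linear_vec_nth geo_flowD(4)[OF assms], of 3]
  by (simp_all add: lc_def has_real_derivative_iff_has_vector_derivative algebra_simps)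

text \<open>Right-invariant fields generate left translations, which are isometries, so
  \<open>v \<bullet> c\<close> is conserved by Noether's theorem. The value \<open>p\<close> of
  \<open>c\<close> at the common point is arbitrary, and the products with all \<open>p\<close>
  determine the velocity.\<close>

lemma geo_flow_closed_velocity:
  assumes I: "is_interval I" and v: "geo_flow I \<gamma> v" and st: "s \<in> I" "t \<in> I" "\<gamma> s = \<gamma> t"
  shows "v s = v t"
proof -
  have "v s \<bullet> p = v t \<bullet> p" for p
  proof -
    obtain c where c: "\<And>x. x \<in> U \<Longrightarrow> (c has_derivative (\<lambda>h. br (c x) (Phi x h))) (at x)" "c (\<gamma> s) = p"
      using right_invariant_coordinates[OF geo_flowD(1)[OF v st(1)]] by metis
    have "((\<lambda>r. v r \<bullet> c (\<gamma> r)) has_vector_derivative 0) (at r)" if r: "r \<in> I" for r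
    proof -
      have "((\<lambda>r. v r \<bullet> c (\<gamma> r)) has_vector_derivative
          v r \<bullet> br (c (\<gamma> r)) (v r) + - lc (v r) (v r) \<bullet> c (\<gamma> r)) (at r)"
        by (rule bounded_bilinear.has_vector_derivative[OF bounded_bilinear_inner geo_flowD(4)[OF v r]
              right_invariant_along[OF c(1) v r]])
      moreover have "v r \<bullet> br (c (\<gamma> r)) (v r) + - lc (v r) (v r) \<bullet> c (\<gamma> r) = 0"
        by (simp add: lc_def br_def inner_vec3 algebra_simps)
      ultimately show ?thesis by simp
    qed
    from has_vector_derivative_zero_const[OF I this st(1,2)] show ?thesis using st c by simp
  qed
  then show ?thesis using vector_eq_rdot by blast
qed

lemma geo_flow_norm:
  assumes I: "is_interval I" and v: "geo_flow I \<gamma> v" and st: "s \<in> I" "t \<in> I"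
  shows "v s $ 3 = v t $ 3" "(v s $ 1)\<^sup>2 + (v s $ 2)\<^sup>2 = (v t $ 1)\<^sup>2 + (v t $ 2)\<^sup>2"
proof -
  note d = geo_flow_components[OF v]
  show "v s $ 3 = v t $ 3"
    by (rule has_vector_derivative_zero_const[OF I _ st])
       (use d(3) in \<open>simp add: has_real_derivative_iff_has_vector_derivative\<close>)
  have "((\<lambda>t. (v t $ 1)\<^sup>2 + (v t $ 2)\<^sup>2) has_real_derivative 0) (at r)" if "r \<in> I" for r
    by (rule derivative_eq_intros d that refl)+ (simp add: algebra_simps power2_eq_square)
  then show "(v s $ 1)\<^sup>2 + (v s $ 2)\<^sup>2 = (v t $ 1)\<^sup>2 + (v t $ 2)\<^sup>2"
    by (intro has_vector_derivative_zero_const[OF I _ st])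
       (simp add: has_real_derivative_iff_has_vector_derivative)
qed

section \<open>The null cone of the Killing form and its angle function\<close>

definition \<mu> where "\<mu> = \<tau> / sqrt (- \<kappa>)"

text \<open>\<open>\<mu>\<close> is both the tangent of the angle in the theorem and the slope of
  the null cone: \<open>k_mu\<close> is what makes \<open>\<mu>\<^sup>2 * (c\<^sub>1\<^sup>2 +
  c\<^sub>2\<^sup>2) - c\<^sub>3\<^sup>2\<close> invariant under \<open>br\<close>.\<close>

lemma mu_pos: "\<mu> > 0" and k_mu: "k * \<mu>\<^sup>2 = - \<tau>"
  unfolding \<mu>_def k_def using kappa_neg tau_pos by (auto simp: power_divide power2_eq_square field_simps)

text \<open>The null cone of the Killing form is invariant, and the angle of a null vector is a circle-valued
  function on \<open>G\<close>; simple connectedness makes it real-valued.\<close>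

lemma null_angle:
  assumes g: "g \<in> U"
  obtains c \<phi> where "\<And>x. x \<in> U \<Longrightarrow> (c has_derivative (\<lambda>h. br (c x) (Phi x h))) (at x)"
    "c g = vec3 (cos \<phi>0) (sin \<phi>0) \<mu>" "continuous_on U \<phi>" "\<And>x. x \<in> U \<Longrightarrow> c x $ 3 \<noteq> 0"
    "\<And>x. x \<in> U \<Longrightarrow> \<mu> * c x $ 1 = c x $ 3 * cos (\<phi> x)" "\<And>x. x \<in> U \<Longrightarrow> \<mu> * c x $ 2 = c x $ 3 * sin (\<phi> x)"
proof -
  obtain c where c: "\<And>x. x \<in> U \<Longrightarrow> (c has_derivative (\<lambda>h. br (c x) (Phi x h))) (at x)"
    "c g = vec3 (cos \<phi>0) (sin \<phi>0) \<mu>" and nz: "vec3 (cos \<phi>0) (sin \<phi>0) \<mu> \<noteq> 0 \<Longrightarrow> \<forall>x\<in>U. c x \<noteq> 0"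
    using right_invariant_coordinates[OF g] by metis
  have nz: "c x \<noteq> 0" if "x \<in> U" for x using nz mu_pos that by (simp add: vec3_eq_iff)
  \<comment> \<open>A multiple of the Killing form; the initial vector with third coordinate
    \<open>\<mu>\<close> is null for it.\<close>
  define Q where "Q x = \<mu>\<^sup>2 * ((c x $ 1)\<^sup>2 + (c x $ 2)\<^sup>2) - (c x $ 3)\<^sup>2" for x
  have n: "((\<lambda>x. c x $ i) has_derivative (\<lambda>h. br (c x) (Phi x h) $ i)) (at x)" if "x \<in> U" for x i
    by (rule bounded_linear.has_derivative[OF bounded_linear_vec_nth c(1)[OF that]])
  have "(Q has_derivative (\<lambda>h. 0)) (at x)" if x: "x \<in> U" for x
  proof -
    have "(Q has_derivative (\<lambda>h. 2 * \<mu>\<^sup>2 * (c x $ 1 * br (c x) (Phi x h) $ 1 + c x $ 2 * br (c x) (Phi x h) $ 2)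
        - 2 * (c x $ 3 * br (c x) (Phi x h) $ 3))) (at x)"
      unfolding Q_def by (rule derivative_eq_intros n x refl)+ (simp add: fun_eq_iff algebra_simps)
    moreover have "2 * \<mu>\<^sup>2 * (c x $ 1 * br (c x) d $ 1 + c x $ 2 * br (c x) d $ 2) - 2 * (c x $ 3 * br (c x) d $ 3) = 0" for d
    proof -
      have "2 * \<mu>\<^sup>2 * (c x $ 1 * br (c x) d $ 1 + c x $ 2 * br (c x) d $ 2) - 2 * (c x $ 3 * br (c x) d $ 3)
        = 2 * (k * \<mu>\<^sup>2 + \<tau>) * (c x $ 3 * (c x $ 2 * d $ 1 - c x $ 1 * d $ 2))"
        by (simp add: br_def algebra_simps)
      then show ?thesis by (simp add: k_mu)
    qed
    ultimately show ?thesis by simp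
  qed
  from has_derivative_zero_unique_connected[OF open_U connected_U this _ g]
  have "Q x = Q g" if "x \<in> U" for x using that by blast
  moreover have "Q g = 0" unfolding Q_def c(2) by simp
  ultimately have Q: "\<mu>\<^sup>2 * ((c x $ 1)\<^sup>2 + (c x $ 2)\<^sup>2) = (c x $ 3)\<^sup>2" if "x \<in> U" for x
    using that unfolding Q_def by simp
  \<comment> \<open>A null vector without third coordinate is 0, whereas \<open>c\<close> vanishes
    nowhere.\<close>
  have c3: "c x $ 3 \<noteq> 0" if "x \<in> U" for x
  proof
    assume "c x $ 3 = 0"
    then have "(c x $ 1)\<^sup>2 + (c x $ 2)\<^sup>2 = 0" using Q[OF that] mu_pos by simp
    then show False using nz[OF that] \<open>c x $ 3 = 0\<close> by (simp add: vec3_eq_iff sum_power2_eq_zero_iff)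
  qed
  define z where "z x = Complex (\<mu> * c x $ 1 / c x $ 3) (\<mu> * c x $ 2 / c x $ 3)" for x
  have cont: "continuous_on U (\<lambda>x. c x $ i)" for i
    using n has_derivative_continuous by (blast intro: continuous_at_imp_continuous_on)
  have "continuous_on U z"
    unfolding z_def Complex_eq by (intro continuous_intros cont) (use c3 in auto)
  moreover have "z \<in> U \<rightarrow> sphere 0 1"
  proof
    fix x assume x: "x \<in> U"
    have "(\<mu> * c x $ 1 / c x $ 3)\<^sup>2 + (\<mu> * c x $ 2 / c x $ 3)\<^sup>2
        = (\<mu>\<^sup>2 * ((c x $ 1)\<^sup>2 + (c x $ 2)\<^sup>2)) / (c x $ 3)\<^sup>2"
      by (simp add: power_divide power_mult_distrib distrib_left add_divide_distrib)
    then show "z x \<in> sphere 0 1" using c3[OF x] by (simp add: Q[OF x] z_def cmod_def)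
  qed
  \<comment> \<open>Continuous maps from such a set to the circle have a continuous real logarithm.
    Simple connectedness is used here and nowhere else.\<close>
  moreover have "Borsukian U"
    by (intro simply_connected_imp_Borsukian simply_connected_U open_imp_locally_path_connected open_U)
  ultimately obtain \<phi> where \<phi>: "continuous_on U (complex_of_real \<circ> \<phi>)" "\<And>x. x \<in> U \<Longrightarrow> z x = exp (\<i> * of_real (\<phi> x))"
    unfolding Borsukian_continuous_logarithm_circle_real by metis
  have "continuous_on U (\<lambda>x. Re ((complex_of_real \<circ> \<phi>) x))" by (intro continuous_intros \<phi>(1))
  then have "continuous_on U \<phi>" by simp
  moreover have cs: "\<mu> * c x $ 1 / c x $ 3 = cos (\<phi> x)" "\<mu> * c x $ 2 / c x $ 3 = sin (\<phi> x)" if "x \<in> U" for x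
    using arg_cong[OF \<phi>(2)[OF that], of Re] arg_cong[OF \<phi>(2)[OF that], of Im]
    by (simp_all add: z_def cis_conv_exp[symmetric])
  moreover have "\<mu> * c x $ 1 = c x $ 3 * cos (\<phi> x)" "\<mu> * c x $ 2 = c x $ 3 * sin (\<phi> x)" if "x \<in> U" for x
    using c3[OF that] by (simp_all add: cs[OF that, symmetric])
  ultimately show thesis using that c c3 by blast
qed

text \<open>With \<open>w = v\<^sub>1 cos \<phi> + v\<^sub>2 sin \<phi>\<close> one has \<open>\<phi>' = k \<mu> w - k v\<^sub>3\<close>, and \<open>v\<^sub>3 \<phi>\<close> corrected by the periodic term
  \<open>(v\<^sub>2 cos \<phi> - v\<^sub>1 sin \<phi>) / \<mu>\<close> has derivative \<open>- k (v\<^sub>3\<^sup>2 + w\<^sup>2) \<ge> 0\<close>.\<close>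

lemma geo_flow_no_return:
  assumes I: "open I" "is_interval I" and v: "geo_flow I \<gamma> v" and nc: "\<not> \<gamma> constant_on I"
    and st: "s \<in> I" "t \<in> I" "s \<noteq> t" "\<gamma> s = \<gamma> t"
  shows False
proof -
  note D = geo_flowD[OF v]
  have vst: "v s = v t" by (rule geo_flow_closed_velocity[OF I(2) v st(1,2,4)])
  have "v s \<noteq> 0"
  proof
    assume "v s = 0"
    then have "v r = 0" if "r \<in> I" for r
      using geo_flow_norm[OF I(2) v st(1) that] by (simp add: vec3_eq_iff sum_power2_eq_zero_iff)
    then have "(\<gamma> has_vector_derivative 0) (at r)" if "r \<in> I" for r
      using D(2)[OF that] that by (simp add: linear_0[OF linear_E])
    then have "\<gamma> r = \<gamma> s" if "r \<in> I" for r
      using has_vector_derivative_zero_const[OF I(2) _ that st(1)] by blast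
    then show False using nc unfolding constant_on_def by blast
  qed
  \<comment> \<open>The initial angle of the null vector at \<open>\<gamma> s\<close> is free. This
    choice makes the derivative of \<open>F\<close> positive at \<open>s\<close>, even if the
    velocity is horizontal.\<close>
  then obtain \<phi>0 where \<phi>0: "v s $ 3 \<noteq> 0 \<or> v s $ 1 * cos \<phi>0 + v s $ 2 * sin \<phi>0 \<noteq> 0"
  proof (cases "v s $ 3 = 0 \<and> v s $ 1 = 0")
    case True
    then have "v s $ 2 \<noteq> 0" using \<open>v s \<noteq> 0\<close> by (simp add: vec3_eq_iff)
    then show ?thesis using that[of "pi/2"] True by simp
  next
    case False
    then show ?thesis using that[of 0] by auto
  qed
  obtain c \<phi> where c: "\<And>x. x \<in> U \<Longrightarrow> (c has_derivative (\<lambda>h. br (c x) (Phi x h))) (at x)"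
    and cs: "c (\<gamma> s) = vec3 (cos \<phi>0) (sin \<phi>0) \<mu>" and \<phi>: "continuous_on U \<phi>" and c3: "\<And>x. x \<in> U \<Longrightarrow> c x $ 3 \<noteq> 0"
    and c12: "\<And>x. x \<in> U \<Longrightarrow> \<mu> * c x $ 1 = c x $ 3 * cos (\<phi> x)" "\<And>x. x \<in> U \<Longrightarrow> \<mu> * c x $ 2 = c x $ 3 * sin (\<phi> x)"
    using null_angle[OF D(1)[OF st(1)], of \<phi>0] by blast
  define f where "f r = \<phi> (\<gamma> r)" for r
  define w where "w r = v r $ 1 * cos (f r) + v r $ 2 * sin (f r)" for r
  have df: "(f has_real_derivative k * \<mu> * w r - k * v r $ 3) (at r)" if r: "r \<in> I" for r
  proof -
    define a where "a i = c (\<gamma> r) $ i" for i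
    define b where "b i = br (c (\<gamma> r)) (v r) $ i" for i
    have a3: "a 3 \<noteq> 0" using c3[OF D(1)[OF r]] unfolding a_def .
    have a12: "\<mu> * a 1 = a 3 * cos (f r)" "\<mu> * a 2 = a 3 * sin (f r)"
      using c12[OF D(1)[OF r]] unfolding a_def f_def by auto
    have b: "b 1 = k * (a 2 * v r $ 3 - a 3 * v r $ 2)" "b 2 = k * (a 3 * v r $ 1 - a 1 * v r $ 3)"
      unfolding a_def b_def br_def by auto
    have dc: "((\<lambda>r. c (\<gamma> r) $ i) has_real_derivative b i) (at r)" for i
      using bounded_linear.has_vector_derivative[OF bounded_linear_vec_nth right_invariant_along[OF c v r]]
      unfolding b_def by (simp add: has_real_derivative_iff_has_vector_derivative)
    have dq: "((\<lambda>r. \<mu> * c (\<gamma> r) $ i / c (\<gamma> r) $ 3) has_real_derivative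
        (\<mu> * b i * a 3 - \<mu> * a i * b 3) / (a 3 * a 3)) (at r)" for i
      using DERIV_divide[OF DERIV_cmult[OF dc[of i], of \<mu>] dc[of 3]] a3 unfolding a_def by simp
    have "((\<lambda>r. cos (f r)) has_real_derivative (\<mu> * b 1 * a 3 - \<mu> * a 1 * b 3) / (a 3 * a 3)) (at r)"
      by (rule has_field_derivative_transform_within_open[OF dq I(1) r])
        (use c12(1) c3 D(1) in \<open>simp add: f_def\<close>)
    moreover have "((\<lambda>r. sin (f r)) has_real_derivative (\<mu> * b 2 * a 3 - \<mu> * a 2 * b 3) / (a 3 * a 3)) (at r)"
      by (rule has_field_derivative_transform_within_open[OF dq I(1) r])
        (use c12(2) c3 D(1) in \<open>simp add: f_def\<close>)
    moreover have "isCont f r"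
    proof -
      have "isCont \<gamma> r" using D(2)[OF r] has_vector_derivative_continuous by blast
      moreover have "isCont \<phi> (\<gamma> r)" using \<phi> open_U D(1)[OF r] continuous_on_eq_continuous_at by blast
      ultimately show ?thesis unfolding f_def by (rule isCont_o2)
    qed
    ultimately have "(f has_real_derivative ((\<mu> * b 2 * a 3 - \<mu> * a 2 * b 3) / (a 3 * a 3) * cos (f r)
        - (\<mu> * b 1 * a 3 - \<mu> * a 1 * b 3) / (a 3 * a 3) * sin (f r))) (at r)"
      by (intro continuous_angle_has_derivative)
    moreover have "(\<mu> * b 2 * a 3 - \<mu> * a 2 * b 3) / (a 3 * a 3) * cos (f r)
        - (\<mu> * b 1 * a 3 - \<mu> * a 1 * b 3) / (a 3 * a 3) * sin (f r) = k * \<mu> * w r - k * v r $ 3"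
    proof -
      have cs: "cos (f r) = \<mu> * a 1 / a 3" "sin (f r) = \<mu> * a 2 / a 3" using a12 a3 by (simp_all add: field_simps)
      have "(\<mu> * a 1 / a 3)\<^sup>2 + (\<mu> * a 2 / a 3)\<^sup>2 = 1" unfolding cs[symmetric] by simp
      then have n: "\<mu>\<^sup>2 * (a 1)\<^sup>2 + \<mu>\<^sup>2 * (a 2)\<^sup>2 = (a 3)\<^sup>2"
        using a3 by (simp add: power_divide power_mult_distrib field_simps)
      have "((\<mu> * b 2 * a 3 - \<mu> * a 2 * b 3) / (a 3 * a 3) * (\<mu> * a 1 / a 3)
        - (\<mu> * b 1 * a 3 - \<mu> * a 1 * b 3) / (a 3 * a 3) * (\<mu> * a 2 / a 3)) = \<mu>\<^sup>2 * (b 2 * a 1 - b 1 * a 2) / (a 3)\<^sup>2"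
        using a3 by (simp add: field_simps power2_eq_square)
      also have "\<dots> = (k * \<mu>\<^sup>2 * a 3 * (v r $ 1 * a 1 + v r $ 2 * a 2) - k * v r $ 3 * (\<mu>\<^sup>2 * (a 1)\<^sup>2 + \<mu>\<^sup>2 * (a 2)\<^sup>2)) / (a 3)\<^sup>2"
        unfolding b by (simp add: algebra_simps power2_eq_square)
      also have "\<dots> = k * \<mu> * w r - k * v r $ 3"
        unfolding n w_def cs using a3 by (simp add: field_simps power2_eq_square)
      finally show ?thesis unfolding cs .
    qed
    ultimately show ?thesis by simp
  qed
  \<comment> \<open>\<open>f'\<close> itself has no sign. The factor \<open>1 / \<mu>\<close> of the
    trigonometric term is the one for which the cross term in \<open>F'\<close> becomes
    \<open>v\<^sub>3 w (k \<mu>\<^sup>2 + \<tau>) / \<mu>\<close>, and this is 0 by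
    \<open>k_mu\<close>.\<close>
  define F where "F r = v r $ 3 * f r + (v r $ 2 * cos (f r) - v r $ 1 * sin (f r)) / \<mu>" for r
  have dF: "(F has_real_derivative (- k) * ((v r $ 3)\<^sup>2 + (w r)\<^sup>2)) (at r)" if r: "r \<in> I" for r
  proof -
    note dv = geo_flow_components[OF v r]
    have "((\<lambda>r. v r $ 2 * cos (f r) - v r $ 1 * sin (f r)) has_real_derivative
       (\<tau> - k) * v r $ 3 * w r - w r * (k * \<mu> * w r - k * v r $ 3)) (at r)"
      by (rule derivative_eq_intros dv df r refl)+ (simp add: w_def algebra_simps)
    from DERIV_add[OF DERIV_mult[OF dv(3) df[OF r]] DERIV_cdivide[OF this, of \<mu>]]
    have "(F has_real_derivative (v r $ 3 * (k * \<mu> * w r - k * v r $ 3) +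
       ((\<tau> - k) * v r $ 3 * w r - w r * (k * \<mu> * w r - k * v r $ 3)) / \<mu>)) (at r)"
      unfolding F_def by (simp add: mult.commute)
    moreover have "v r $ 3 * (k * \<mu> * w r - k * v r $ 3) +
       ((\<tau> - k) * v r $ 3 * w r - w r * (k * \<mu> * w r - k * v r $ 3)) / \<mu>
       = (- k) * ((v r $ 3)\<^sup>2 + (w r)\<^sup>2) + v r $ 3 * w r * (k * \<mu>\<^sup>2 + \<tau>) / \<mu>"
      using mu_pos by (simp add: field_simps power2_eq_square)
    ultimately show ?thesis by (simp add: k_mu)
  qed
  \<comment> \<open>Only cosine and sine can be compared, since \<open>f s\<close> and
    \<open>\<phi>0\<close> may differ by a multiple of \<open>2 * pi\<close>.\<close>
  have cos: "cos (f s) = cos \<phi>0" "sin (f s) = sin \<phi>0"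
    using c12[OF D(1)[OF st(1)]] mu_pos unfolding cs f_def by auto
  then have pos: "(- k) * ((v s $ 3)\<^sup>2 + (w s)\<^sup>2) > 0"
    using \<phi>0 k_neg unfolding w_def cos by (intro mult_pos_pos) (auto simp: sum_power2_gt_zero_iff)
  \<comment> \<open>\<open>\<phi>\<close> is a function on the group, not merely along the curve,
    and the velocities agree; so every ingredient of \<open>F\<close> returns.\<close>
  have "F s = F t" unfolding F_def f_def st(4) vst ..
  moreover have "(- k) * ((v r $ 3)\<^sup>2 + (w r)\<^sup>2) \<ge> 0" for r
    using k_neg by (intro mult_nonneg_nonneg) auto
  ultimately have "(- k) * ((v s $ 3)\<^sup>2 + (w s)\<^sup>2) = 0"
    by (intro return_imp_zero_derivative[OF I(2) dF _ st(1,2,3)])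
  with pos show False by (metis order_less_irrefl)
qed

end

section \<open>Absence of conjugate points\<close>

text \<open>The bound on \<open>\<bar>f'\<bar>\<close> is two-sided, so the weight
  \<open>exp (- K * t)\<close> serves forwards from \<open>s\<close> and \<open>exp (K * t)\<close>
  backwards. This supplies uniqueness for Jacobi fields and for integral curves.\<close>

lemma gronwall_zero:
  fixes f f' :: "real \<Rightarrow> real"
  assumes I: "is_interval I" and d: "\<And>t. t \<in> I \<Longrightarrow> (f has_real_derivative f' t) (at t)"
    and le: "\<And>t. t \<in> I \<Longrightarrow> \<bar>f' t\<bar> \<le> K * f t" and nn: "\<And>t. t \<in> I \<Longrightarrow> f t \<ge> 0"
    and s: "s \<in> I" "f s = 0" and t: "t \<in> I"
  shows "f t = 0"
proof -
  have "f t \<le> 0"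
  proof (cases "s \<le> t")
    case True
    have "f t * exp (- K * t) \<le> f s * exp (- K * s)"
    proof (rule DERIV_nonpos_imp_nonincreasing[OF True, where f="\<lambda>t. f t * exp (- K * t)"])
      fix x assume "s \<le> x" "x \<le> t"
      then have x: "x \<in> I" using I s t unfolding is_interval_1 by blast
      have "((\<lambda>t. f t * exp (- K * t)) has_real_derivative (f' x - K * f x) * exp (- K * x)) (at x)"
        by (rule derivative_eq_intros d x refl)+ (simp add: algebra_simps)
      moreover have "(f' x - K * f x) * exp (- K * x) \<le> 0"
        using le[OF x] by (intro mult_nonpos_nonneg) auto
      ultimately show "\<exists>y. ((\<lambda>t. f t * exp (- K * t)) has_real_derivative y) (at x) \<and> y \<le> 0" by blast
    qed
    then show ?thesis using s by (simp add: mult_le_0_iff)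
  next
    case False
    have "f t * exp (K * t) \<le> f s * exp (K * s)"
    proof (rule DERIV_nonneg_imp_nondecreasing[where f="\<lambda>t. f t * exp (K * t)"])
      show "t \<le> s" using False by simp
      fix x assume "t \<le> x" "x \<le> s"
      then have x: "x \<in> I" using I s t unfolding is_interval_1 by blast
      have "((\<lambda>t. f t * exp (K * t)) has_real_derivative (f' x + K * f x) * exp (K * x)) (at x)"
        by (rule derivative_eq_intros d x refl)+ (simp add: algebra_simps)
      moreover have "(f' x + K * f x) * exp (K * x) \<ge> 0"
        using le[OF x] by (intro mult_nonneg_nonneg) (auto simp: abs_le_iff)
      ultimately show "\<exists>y. ((\<lambda>t. f t * exp (K * t)) has_real_derivative y) (at x) \<and> y \<ge> 0" by blast
    qed
    then show ?thesis using s by (simp add: mult_le_0_iff)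
  qed
  then show ?thesis using nn[OF t] by simp
qed

lemma real_derivative_zero_const:
  fixes f :: "real \<Rightarrow> real"
  assumes "is_interval I" "\<And>t. t \<in> I \<Longrightarrow> (f has_real_derivative 0) (at t)" "s \<in> I" "t \<in> I"
  shows "f s = f t"
  by (rule has_vector_derivative_zero_const[OF assms(1) _ assms(3,4)])
     (use assms(2) in \<open>simp add: has_real_derivative_iff_has_vector_derivative\<close>)

lemma arccos_in_symmetric_interval_iff:
  assumes "\<bar>x\<bar> \<le> 1" "0 \<le> e" "e \<le> pi"
  shows "arccos x \<in> {e..pi - e} \<longleftrightarrow> \<bar>x\<bar> \<le> cos e"
proof -
  have "e \<le> arccos x \<longleftrightarrow> x \<le> cos e"
    using assms arccos_le_mono[of "cos e" x] cos_mono_le_eq[of "arccos x" e] arccos_lbound arccos_ubound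
    by (smt (verit) cos_arccos_abs)
  moreover have "arccos x \<le> pi - e \<longleftrightarrow> - cos e \<le> x"
    using assms cos_mono_le_eq[of "pi - e" "arccos x"] arccos_lbound arccos_ubound
    by (smt (verit) cos_arccos_abs cos_pi_minus)
  ultimately show ?thesis by auto
qed

context sl2_tilde
begin

lemma disc_div_tau: "(\<tau>\<^sup>2 * x + \<kappa> * y) / \<tau> = \<tau> * x + k * y"
  unfolding k_def using tau_pos by (simp add: add_divide_distrib power2_eq_square)

text \<open>At unit speed the cosine of the slope angle is \<open>v\<^sub>3\<close>, while
  \<open>cos (arctan \<mu>) = 1 / sqrt (1 + \<mu>\<^sup>2)\<close>. Squaring and eliminating the
  horizontal part leaves the sign of the quadratic form.\<close>

lemma slope_angle_iff:
  assumes v: "geo_flow I \<gamma> v" and us: "unit_speed m I \<gamma>" and t: "t \<in> I"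
  shows "(v t $ 1)\<^sup>2 + (v t $ 2)\<^sup>2 + (v t $ 3)\<^sup>2 = 1"
    "slope_angle m u3 \<gamma> t \<in> {arctan \<mu>..pi - arctan \<mu>} \<longleftrightarrow>
       \<tau>\<^sup>2 * (v t $ 3)\<^sup>2 + \<kappa> * ((v t $ 1)\<^sup>2 + (v t $ 2)\<^sup>2) \<le> 0"
proof -
  note D = geo_flowD[OF v t]
  have one: "m (\<gamma> t) (E (\<gamma> t) (v t)) (E (\<gamma> t) (v t)) = 1"
    using us t D unfolding unit_speed_def by metis
  from this show n: "(v t $ 1)\<^sup>2 + (v t $ 2)\<^sup>2 + (v t $ 3)\<^sup>2 = 1"
    by (simp add: m_E[OF D(1)] inner_vec3 power2_eq_square)
  have "m (\<gamma> t) (E (\<gamma> t) (v t)) (u3 (\<gamma> t)) = v t $ 3"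
    using Phi_E[OF D(1), of "v t"] unfolding Phi_def by (metis vec3_nth(3))
  then have s: "slope_angle m u3 \<gamma> t = arccos (v t $ 3)"
    by (simp add: slope_angle_def metric_angle_def orthonormal[OF D(1)] D(3) one)
  have "(v t $ 3)\<^sup>2 \<le> 1" using n by (smt (verit) zero_le_power2)
  then have v3: "\<bar>v t $ 3\<bar> \<le> 1" by (simp add: abs_square_le_1)
  have e: "0 \<le> arctan \<mu>" "arctan \<mu> \<le> pi" using mu_pos arctan_ubound[of \<mu>] pi_gt_zero by (simp, linarith)
  have "slope_angle m u3 \<gamma> t \<in> {arctan \<mu>..pi - arctan \<mu>} \<longleftrightarrow> \<bar>v t $ 3\<bar> \<le> 1 / sqrt (1 + \<mu>\<^sup>2)"
    unfolding s arccos_in_symmetric_interval_iff[OF v3 e] cos_arctan ..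
  also have "\<dots> \<longleftrightarrow> \<bar>v t $ 3\<bar>\<^sup>2 \<le> (1 / sqrt (1 + \<mu>\<^sup>2))\<^sup>2"
    by (subst abs_le_square_iff[symmetric]) auto
  also have "\<dots> \<longleftrightarrow> (v t $ 3)\<^sup>2 * (1 + \<mu>\<^sup>2) \<le> 1"
    by (simp add: power_divide pos_le_divide_eq add_pos_nonneg)
  also have "\<mu>\<^sup>2 = \<tau>\<^sup>2 / (- \<kappa>)" unfolding \<mu>_def using kappa_neg by (simp add: power_divide)
  also have "(v t $ 3)\<^sup>2 * (1 + \<tau>\<^sup>2 / (- \<kappa>)) \<le> 1 \<longleftrightarrow> (v t $ 3)\<^sup>2 * (\<tau>\<^sup>2 - \<kappa>) \<le> - \<kappa>"
  proof -
    have "(v t $ 3)\<^sup>2 * (\<tau>\<^sup>2 - \<kappa>) = ((v t $ 3)\<^sup>2 * (1 + \<tau>\<^sup>2 / (- \<kappa>))) * (- \<kappa>)"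
      using kappa_neg by (simp add: field_simps)
    then show ?thesis using mult_le_cancel_right_pos[of "- \<kappa>" "(v t $ 3)\<^sup>2 * (1 + \<tau>\<^sup>2 / (- \<kappa>))" 1] kappa_neg by simp
  qed
  also have "\<dots> \<longleftrightarrow> \<tau>\<^sup>2 * (v t $ 3)\<^sup>2 + \<kappa> * ((v t $ 1)\<^sup>2 + (v t $ 2)\<^sup>2) \<le> 0"
  proof -
    have e: "(v t $ 1)\<^sup>2 + (v t $ 2)\<^sup>2 = 1 - (v t $ 3)\<^sup>2" using n by simp
    show ?thesis unfolding e by (simp add: algebra_simps)
  qed
  finally show "slope_angle m u3 \<gamma> t \<in> {arctan \<mu>..pi - arctan \<mu>} \<longleftrightarrow>
       \<tau>\<^sup>2 * (v t $ 3)\<^sup>2 + \<kappa> * ((v t $ 1)\<^sup>2 + (v t $ 2)\<^sup>2) \<le> 0" .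
qed

lemma jacobi_flow_components:
  assumes "jacobi_flow I v j d" "t \<in> I"
  shows "((\<lambda>t. j t $ 1) has_real_derivative d t $ 1 - k * (v t $ 2 * j t $ 3 - v t $ 3 * j t $ 2)) (at t)"
    "((\<lambda>t. j t $ 2) has_real_derivative d t $ 2 - k * (v t $ 3 * j t $ 1 - v t $ 1 * j t $ 3)) (at t)"
    "((\<lambda>t. j t $ 3) has_real_derivative d t $ 3 - \<tau> * (v t $ 1 * j t $ 2 - v t $ 2 * j t $ 1)) (at t)"
    "((\<lambda>t. d t $ 1) has_real_derivative (k - \<tau>) * (d t $ 2 * v t $ 3 + v t $ 2 * d t $ 3)) (at t)"
    "((\<lambda>t. d t $ 2) has_real_derivative (\<tau> - k) * (d t $ 1 * v t $ 3 + v t $ 1 * d t $ 3)) (at t)"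
    "((\<lambda>t. d t $ 3) has_real_derivative 0) (at t)"
proof -
  have "(j has_vector_derivative d t - br (v t) (j t)) (at t)"
    "(d has_vector_derivative - (lc (d t) (v t) + lc (v t) (d t))) (at t)"
    using assms unfolding jacobi_flow_def by auto
  note j = bounded_linear.has_vector_derivative[OF bounded_linear_vec_nth this(1)]
    and d = bounded_linear.has_vector_derivative[OF bounded_linear_vec_nth this(2)]
  show "((\<lambda>t. j t $ 1) has_real_derivative d t $ 1 - k * (v t $ 2 * j t $ 3 - v t $ 3 * j t $ 2)) (at t)"
    "((\<lambda>t. j t $ 2) has_real_derivative d t $ 2 - k * (v t $ 3 * j t $ 1 - v t $ 1 * j t $ 3)) (at t)"
    "((\<lambda>t. j t $ 3) has_real_derivative d t $ 3 - \<tau> * (v t $ 1 * j t $ 2 - v t $ 2 * j t $ 1)) (at t)"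
    using j[of 1] j[of 2] j[of 3]
    by (simp_all add: br_def has_real_derivative_iff_has_vector_derivative)
  show "((\<lambda>t. d t $ 1) has_real_derivative (k - \<tau>) * (d t $ 2 * v t $ 3 + v t $ 2 * d t $ 3)) (at t)"
    "((\<lambda>t. d t $ 2) has_real_derivative (\<tau> - k) * (d t $ 1 * v t $ 3 + v t $ 1 * d t $ 3)) (at t)"
    "((\<lambda>t. d t $ 3) has_real_derivative 0) (at t)"
    using d[of 1] d[of 2] d[of 3]
    by (simp_all add: lc_def has_real_derivative_iff_has_vector_derivative algebra_simps)
qed

text \<open>A Jacobi field vanishing at two points is normal, and is determined by \<open>y = v\<^sub>1 j\<^sub>2 - v\<^sub>2 j\<^sub>1\<close>
  and \<open>z = j\<^sub>3\<close>; \<open>c = d\<^sub>3\<close> is constant.\<close>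

lemma jacobi_flow_normal:
  assumes I: "is_interval I" and v: "geo_flow I \<gamma> v" and jd: "jacobi_flow I v j d"
    and us: "\<forall>t\<in>I. (v t $ 1)\<^sup>2 + (v t $ 2)\<^sup>2 + (v t $ 3)\<^sup>2 = 1"
    and 0: "0 \<in> I" "j 0 = 0" and T: "T \<in> I" "T \<noteq> 0" "j T = 0"
    and D: "D = \<tau>\<^sup>2 * (v 0 $ 3)\<^sup>2 + \<kappa> * ((v 0 $ 1)\<^sup>2 + (v 0 $ 2)\<^sup>2)"
  defines "y \<equiv> \<lambda>t. v t $ 1 * j t $ 2 - v t $ 2 * j t $ 1" and "z \<equiv> \<lambda>t. j t $ 3"
    and "\<beta> \<equiv> \<lambda>t. v t $ 1 * d t $ 2 - v t $ 2 * d t $ 1" and "c \<equiv> d 0 $ 3" and "a2 \<equiv> (v 0 $ 1)\<^sup>2 + (v 0 $ 2)\<^sup>2"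
  assumes t: "t \<in> I"
  shows "(y has_real_derivative D / \<tau> * z t + \<beta> t) (at t)" "(z has_real_derivative c - \<tau> * y t) (at t)"
    "(\<beta> has_real_derivative (\<tau> - k) * a2 * c) (at t)"
    "v t $ 1 * j t $ 1 + v t $ 2 * j t $ 2 = - (v 0 $ 3 * z t)"
    "v t $ 1 * d t $ 1 + v t $ 2 * d t $ 2 = - (v 0 $ 3 * c)" "d t $ 3 = c"
    "a2 + (v 0 $ 3)\<^sup>2 = 1" "(v t $ 1)\<^sup>2 + (v t $ 2)\<^sup>2 = a2"
proof -
  note dv = geo_flow_components[OF v] and dj = jacobi_flow_components[OF jd]
  have v3: "v t $ 3 = v 0 $ 3" and a2: "(v t $ 1)\<^sup>2 + (v t $ 2)\<^sup>2 = a2" if "t \<in> I" for t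
    unfolding a2_def using geo_flow_norm[OF I v that 0(1)] by auto
  show "(v t $ 1)\<^sup>2 + (v t $ 2)\<^sup>2 = a2" by (rule a2[OF t])
  show one: "a2 + (v 0 $ 3)\<^sup>2 = 1" unfolding a2_def using us 0(1) by simp
  have d3: "d t $ 3 = c" if "t \<in> I" for t
    unfolding c_def by (rule real_derivative_zero_const[OF I dj(6) that 0(1)])
  show "d t $ 3 = c" by (rule d3[OF t])
  define \<alpha> where "\<alpha> t = v t $ 1 * d t $ 1 + v t $ 2 * d t $ 2" for t
  have "(\<alpha> has_real_derivative 0) (at t)" if "t \<in> I" for t
    unfolding \<alpha>_def by (rule derivative_eq_intros dv dj that refl)+ (simp add: algebra_simps)
  then have \<alpha>: "\<alpha> t = \<alpha> 0" if "t \<in> I" for t by (rule real_derivative_zero_const[OF I _ that 0(1)])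
  \<comment> \<open>The tangential component is affine in \<open>t\<close>. Its zeros at 0 and
    \<open>T\<close> force it to vanish, and its zero slope ties \<open>\<alpha>\<close> to
    \<open>c\<close>.\<close>
  define q where "q t = v t $ 1 * j t $ 1 + v t $ 2 * j t $ 2 + v t $ 3 * j t $ 3" for t
  have dq: "(q has_real_derivative \<alpha> t + v t $ 3 * d t $ 3) (at t)" if "t \<in> I" for t
    unfolding q_def \<alpha>_def by (rule derivative_eq_intros dv dj that refl)+ (simp add: algebra_simps)
  have "((\<lambda>t. q t - (\<alpha> 0 + v 0 $ 3 * c) * t) has_real_derivative 0) (at t)" if "t \<in> I" for t
    by (rule derivative_eq_intros dq that refl)+ (simp add: \<alpha>[OF that] v3[OF that] d3[OF that])
  then have q: "q t - (\<alpha> 0 + v 0 $ 3 * c) * t = q 0" if "t \<in> I" for t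
    using real_derivative_zero_const[OF I _ that 0(1), of "\<lambda>t. q t - (\<alpha> 0 + v 0 $ 3 * c) * t"] by simp
  have "q 0 = 0" "q T = 0" unfolding q_def 0(2) T(3) by auto
  then have \<alpha>0: "\<alpha> 0 + v 0 $ 3 * c = 0" using q[OF T(1)] T(2) by simp
  show "v t $ 1 * d t $ 1 + v t $ 2 * d t $ 2 = - (v 0 $ 3 * c)" using \<alpha>0 \<alpha>[OF t] unfolding \<alpha>_def by simp
  \<comment> \<open>Normality expresses the remaining horizontal component by \<open>z\<close>,
    which closes the system in \<open>y\<close> and \<open>z\<close>.\<close>
  have X: "v t $ 1 * j t $ 1 + v t $ 2 * j t $ 2 = - (v 0 $ 3 * z t)" if "t \<in> I" for t
    using q[OF that] \<alpha>0 \<open>q 0 = 0\<close> v3[OF that] unfolding q_def z_def by simp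
  then show "v t $ 1 * j t $ 1 + v t $ 2 * j t $ 2 = - (v 0 $ 3 * z t)" using t by blast
  have Dt: "D / \<tau> = \<tau> * (v 0 $ 3)\<^sup>2 + k * a2" unfolding D a2_def by (rule disc_div_tau)
  have "(y has_real_derivative - \<tau> * v t $ 3 * (v t $ 1 * j t $ 1 + v t $ 2 * j t $ 2)
      + k * ((v t $ 1)\<^sup>2 + (v t $ 2)\<^sup>2) * z t + \<beta> t) (at t)"
    unfolding y_def z_def \<beta>_def
    by (rule derivative_eq_intros dv dj t refl)+ (simp add: algebra_simps power2_eq_square)
  moreover have "- \<tau> * v t $ 3 * (v t $ 1 * j t $ 1 + v t $ 2 * j t $ 2)
      + k * ((v t $ 1)\<^sup>2 + (v t $ 2)\<^sup>2) * z t + \<beta> t = D / \<tau> * z t + \<beta> t"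
    unfolding X[OF t] v3[OF t] a2[OF t] Dt by (simp add: algebra_simps power2_eq_square)
  ultimately show "(y has_real_derivative D / \<tau> * z t + \<beta> t) (at t)" by simp
  show "(z has_real_derivative c - \<tau> * y t) (at t)"
    using dj(3)[OF t] unfolding z_def y_def d3[OF t] .
  have "(\<beta> has_real_derivative (\<tau> - k) * ((v t $ 1)\<^sup>2 + (v t $ 2)\<^sup>2) * d t $ 3) (at t)"
    unfolding \<beta>_def by (rule derivative_eq_intros dv dj t refl)+ (simp add: algebra_simps power2_eq_square)
  then show "(\<beta> has_real_derivative (\<tau> - k) * a2 * c) (at t)" unfolding a2[OF t] d3[OF t] .
qed

text \<open>The two combinations are the products of \<open>(p, q)\<close> with
  \<open>(a, b)\<close> and with its rotation by a right angle, which span the plane.\<close>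

lemma rotation_zero:
  fixes a b p q :: real
  assumes "a\<^sup>2 + b\<^sup>2 \<noteq> 0" "a * p + b * q = 0" "a * q - b * p = 0"
  shows "p = 0" "q = 0"
proof -
  have "(a\<^sup>2 + b\<^sup>2) * p = a * (a * p + b * q) - b * (a * q - b * p)"
    "(a\<^sup>2 + b\<^sup>2) * q = b * (a * p + b * q) + a * (a * q - b * p)"
    by (simp_all add: algebra_simps power2_eq_square)
  then have "(a\<^sup>2 + b\<^sup>2) * p = 0" "(a\<^sup>2 + b\<^sup>2) * q = 0" unfolding assms(2,3) by simp_all
  then show "p = 0" "q = 0" using assms(1) mult_eq_0_iff by blast+
qed

lemma no_conjugate:
  assumes I: "is_interval I" and v: "geo_flow I \<gamma> v" and jd: "jacobi_flow I v j d"
    and us: "\<forall>t\<in>I. (v t $ 1)\<^sup>2 + (v t $ 2)\<^sup>2 + (v t $ 3)\<^sup>2 = 1"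
    and 0: "0 \<in> I" "j 0 = 0" and T: "T \<in> I" "T \<noteq> 0" "j T = 0"
    and D: "\<tau>\<^sup>2 * (v 0 $ 3)\<^sup>2 + \<kappa> * ((v 0 $ 1)\<^sup>2 + (v 0 $ 2)\<^sup>2) \<le> 0" and t: "t \<in> I"
  shows "j t = 0"
proof -
  define D where "D = \<tau>\<^sup>2 * (v 0 $ 3)\<^sup>2 + \<kappa> * ((v 0 $ 1)\<^sup>2 + (v 0 $ 2)\<^sup>2)"
  define y where "y t = v t $ 1 * j t $ 2 - v t $ 2 * j t $ 1" for t
  define z where "z t = j t $ 3" for t
  define \<beta> where "\<beta> t = v t $ 1 * d t $ 2 - v t $ 2 * d t $ 1" for t
  define c where "c = d 0 $ 3"
  define a2 where "a2 = (v 0 $ 1)\<^sup>2 + (v 0 $ 2)\<^sup>2"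
  note N = jacobi_flow_normal[OF I v jd us 0 T D_def, folded y_def z_def \<beta>_def c_def a2_def]
  have Dt: "D / \<tau> = \<tau> * (v 0 $ 3)\<^sup>2 + k * a2" unfolding D_def a2_def by (rule disc_div_tau)
  have De: "D = \<tau> * (D / \<tau>)" using tau_pos by simp
  \<comment> \<open>A vertical unit velocity would give
    \<open>D = \<tau>\<^sup>2 > 0\<close>.\<close>
  have a2: "a2 > 0"
  proof (rule ccontr)
    assume "\<not> a2 > 0"
    then have "a2 = 0" unfolding a2_def by (smt (verit) zero_le_power2)
    then show False using D N(7)[OF 0(1)] tau_pos unfolding a2_def by simp
  qed
  define p where "p t = D / \<tau> * z t + \<beta> t" for t
  have dp: "(p has_real_derivative \<tau> * c - D * y t) (at t)" if "t \<in> I" for t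
  proof -
    have "(p has_real_derivative D / \<tau> * (c - \<tau> * y t) + (\<tau> - k) * a2 * c) (at t)"
      unfolding p_def by (intro DERIV_add DERIV_cmult N(2,3) that)
    moreover have "D / \<tau> * (c - \<tau> * y t) + (\<tau> - k) * a2 * c = \<tau> * c * (a2 + (v 0 $ 3)\<^sup>2) - \<tau> * (D / \<tau>) * y t"
      unfolding Dt by (simp add: algebra_simps)
    ultimately show ?thesis unfolding N(7)[OF 0(1)] De[symmetric] by simp
  qed
  \<comment> \<open>\<open>p\<close> is \<open>y'\<close>. The derivative of \<open>c * z\<close>
    cancels the mixed term \<open>\<tau> * c * y\<close> coming from \<open>y * p'\<close>, and only
    terms that are nonnegative for \<open>D \<le> 0\<close> remain.\<close>
  define H where "H t = y t * p t + c * z t" for t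
  have "(H has_real_derivative (p t)\<^sup>2 + (- D) * (y t)\<^sup>2 + c\<^sup>2) (at t)" if "t \<in> I" for t
    unfolding H_def by (rule derivative_eq_intros N(1,2)[OF that, folded p_def] dp[OF that] refl)+
      (simp add: algebra_simps power2_eq_square)
  moreover have "(p t)\<^sup>2 + (- D) * (y t)\<^sup>2 + c\<^sup>2 \<ge> 0" for t
    using D unfolding D_def[symmetric] by (intro add_nonneg_nonneg mult_nonneg_nonneg) auto
  moreover have "H 0 = H T" unfolding H_def y_def z_def 0(2) T(3) by simp
  ultimately have "(p 0)\<^sup>2 + (- D) * (y 0)\<^sup>2 + c\<^sup>2 = 0"
    using T(2) by (intro return_imp_zero_derivative[where f=H and f'="\<lambda>t. (p t)\<^sup>2 + (- D) * (y t)\<^sup>2 + c\<^sup>2",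
        OF I _ _ 0(1) T(1)]) auto
  moreover have y0: "y 0 = 0" "z 0 = 0" unfolding y_def z_def 0(2) by auto
  ultimately have pc: "p 0 = 0" "c = 0" by (simp_all add: sum_power2_eq_zero_iff)
  then have "\<beta> 0 = 0" unfolding p_def y0 by simp
  then have \<beta>: "\<beta> t = 0" if "t \<in> I" for t
    using real_derivative_zero_const[OF I _ that 0(1), of \<beta>] N(3) pc by simp
  \<comment> \<open>With \<open>c\<close> and \<open>\<beta>\<close> gone, \<open>y\<close> and
    \<open>z\<close> solve a homogeneous linear system with zero initial values.\<close>
  have "(y t)\<^sup>2 + (z t)\<^sup>2 = 0"
  proof (rule gronwall_zero[OF I _ _ _ 0(1) _ t, where K="\<bar>D / \<tau> - \<tau>\<bar>"])
    fix t assume t: "t \<in> I"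
    show "((\<lambda>t. (y t)\<^sup>2 + (z t)\<^sup>2) has_real_derivative (D / \<tau> - \<tau>) * (2 * y t * z t)) (at t)"
      by (rule derivative_eq_intros N(1,2)[OF t] refl)+ (simp add: \<beta>[OF t] pc algebra_simps)
    have "\<bar>2 * y t * z t\<bar> \<le> (y t)\<^sup>2 + (z t)\<^sup>2"
      using zero_le_power2[of "y t + z t"] zero_le_power2[of "y t - z t"]
      by (simp add: abs_le_iff power2_sum power2_diff)
    then show "\<bar>(D / \<tau> - \<tau>) * (2 * y t * z t)\<bar> \<le> \<bar>D / \<tau> - \<tau>\<bar> * ((y t)\<^sup>2 + (z t)\<^sup>2)"
      unfolding abs_mult[of "D / \<tau> - \<tau>"] by (intro mult_left_mono) auto
  qed (use y0 in auto)
  then have yz: "y t = 0" "z t = 0" by (simp_all add: sum_power2_eq_zero_iff)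
  have "(v t $ 1)\<^sup>2 + (v t $ 2)\<^sup>2 \<noteq> 0" using N(8)[OF t] a2 by simp
  from rotation_zero[OF this _ yz(1)[unfolded y_def]] N(4)[OF t] yz
  have "j t $ 1 = 0" "j t $ 2 = 0" by auto
  then show "j t = 0" using yz(2) unfolding z_def vec3_eq_iff by simp
qed

end

section \<open>Killing fields\<close>

context sl2_tilde
begin

definition X :: "3 \<Rightarrow> ('a \<Rightarrow> real) \<Rightarrow> 'a \<Rightarrow> real" where
  "X i f x = fderiv f x (E x (axis i 1))"

lemma smooth_X: "smooth_on U f \<Longrightarrow> smooth_on U (X i f)"
  unfolding X_def[abs_def] by (rule smooth_on_fderiv_field[OF open_U _ smooth_on_E])

text \<open>The second derivatives of \<open>f\<close> cancel by symmetry; the derivatives of the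
  two frame fields assemble to their bracket.\<close>

lemma X_commutator:
  assumes f: "smooth_on U f" and x: "x \<in> U"
  shows "X i (X l f) x - X l (X i f) x = fderiv f x (E x (br (axis i 1) (axis l 1)))"
proof -
  define S where "S v h = fderiv (\<lambda>y. fderiv f y v) x h" for v h
  have sym: "S v h = S h v" for v h unfolding S_def by (rule symmetric_second_fderiv[OF open_U x f])
  have Sd: "((\<lambda>y. fderiv f y v) has_derivative S v) (at x)" for v
    unfolding S_def by (rule smooth_on_imp_has_derivative[OF smooth_on_fderiv[OF f] x])
  have lS: "linear (\<lambda>v. S v h)" for h unfolding sym[of _ h] by (rule has_derivative_linear[OF Sd])
  have lf: "linear (fderiv f y)" if "y \<in> U" for y
    by (rule has_derivative_linear[OF smooth_on_imp_has_derivative[OF f that]])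
  have *: "fderiv (\<lambda>y. fderiv f y (E y b)) x h = S (E x b) h + fderiv f x (DE x h b)" for b h
  proof -
    have "((\<lambda>y. \<Sum>e\<in>Basis. (E y b \<bullet> e) *\<^sub>R fderiv f y e) has_derivative
        (\<lambda>h. \<Sum>e\<in>Basis. (E x b \<bullet> e) *\<^sub>R S e h + (DE x h b \<bullet> e) *\<^sub>R fderiv f x e)) (at x)"
      by (intro has_derivative_sum has_derivative_scaleR has_derivative_inner_left Sd has_derivative_E_const[OF x])
    then have "((\<lambda>y. fderiv f y (E y b)) has_derivative
        (\<lambda>h. \<Sum>e\<in>Basis. (E x b \<bullet> e) *\<^sub>R S e h + (DE x h b \<bullet> e) *\<^sub>R fderiv f x e)) (at x)"
      by (rule has_derivative_transform_within_open[OF _ open_U x]) (rule linear_expand[OF lf, symmetric])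
    then have "fderiv (\<lambda>y. fderiv f y (E y b)) x h =
        (\<Sum>e\<in>Basis. (E x b \<bullet> e) *\<^sub>R S e h) + (\<Sum>e\<in>Basis. (DE x h b \<bullet> e) *\<^sub>R fderiv f x e)"
      by (simp add: fderiv_eqI sum.distrib)
    then show ?thesis
      unfolding linear_expand[OF lS, symmetric] linear_expand[OF lf[OF x], symmetric] .
  qed
  show ?thesis
    unfolding X_def[abs_def] * sym[of "E x (axis i 1)"] lie_bracket_E[OF x, symmetric] linear_diff[OF lf[OF x]]
    by simp
qed

lemma X_commutators:
  assumes "smooth_on U f" "x \<in> U"
  shows "X 1 (X 2 f) x - X 2 (X 1 f) x = \<tau> * X 3 f x"
    "X 2 (X 3 f) x - X 3 (X 2 f) x = k * X 1 f x"
    "X 3 (X 1 f) x - X 1 (X 3 f) x = k * X 2 f x"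
proof -
  have "br (axis 1 1) (axis 2 1) = \<tau> *\<^sub>R axis 3 1" "br (axis 2 1) (axis 3 1) = k *\<^sub>R axis 1 1"
    "br (axis 3 1) (axis 1 1) = k *\<^sub>R axis 2 1"
    by (simp_all add: br_def vec3_eq_iff axis_def)
  moreover have "linear (fderiv f x)"
    using has_derivative_linear smooth_on_imp_has_derivative assms by blast
  ultimately show "X 1 (X 2 f) x - X 2 (X 1 f) x = \<tau> * X 3 f x"
    "X 2 (X 3 f) x - X 3 (X 2 f) x = k * X 1 f x"
    "X 3 (X 1 f) x - X 1 (X 3 f) x = k * X 2 f x"
    using X_commutator[OF assms] by (simp_all add: linear_scale[OF linear_E] linear_scale X_def)
qed

text \<open>The two-term hypothesis on all of \<open>U\<close> is the shape in which the Killing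
  equations get differentiated below; equations with a single term are padded by a zero
  multiple.\<close>

lemma X_linear:
  assumes "\<forall>x\<in>U. f x = p * g x + q * h x" "smooth_on U g" "smooth_on U h" "x \<in> U"
  shows "X i f x = p * X i g x + q * X i h x"
proof -
  have "((\<lambda>x. p * g x + q * h x) has_derivative (\<lambda>v. p * fderiv g x v + q * fderiv h x v)) (at x)"
    by (intro has_derivative_add has_derivative_mult_right smooth_on_imp_has_derivative[OF _ assms(4)] assms)
  then have "(f has_derivative (\<lambda>v. p * fderiv g x v + q * fderiv h x v)) (at x)"
    by (rule has_derivative_transform_within_open[OF _ open_U assms(4)]) (simp add: assms(1))
  then show ?thesis unfolding X_def by (simp add: fderiv_eqI)
qed

text \<open>The Killing equation says that the difference of
  \<open>a \<mapsto> fderiv c x (E x a)\<close> and \<open>br (c x)\<close> is skew-symmetric. For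
  right-invariant fields this difference is 0.\<close>

lemma killing_frame:
  assumes K: "killing_field U m K" and x: "x \<in> U"
  defines "c \<equiv> \<lambda>x. Phi x (K x)"
  shows "fderiv c x (E x a) \<bullet> b + a \<bullet> fderiv c x (E x b) = br (c x) a \<bullet> b + a \<bullet> br (c x) b"
proof -
  have sK: "smooth_on U K" using K unfolding killing_field_def by blast
  have "smooth_on U c" unfolding c_def by (rule smooth_on_Phi[OF open_U order_refl sK])
  note dc = smooth_on_imp_has_derivative[OF this x]
  have KE: "E y (c y) = K y" if "y \<in> U" for y using that unfolding c_def by simp
  have "(K has_derivative (\<lambda>h. DE x h (c x) + E x (fderiv c x h))) (at x)"
    by (rule has_derivative_transform_within_open[OF has_derivative_E[OF has_derivative_ident dc x] open_U x])
       (rule KE)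
  then have dK: "Phi x (fderiv K x v) = fderiv c x v - dPhi x v (K x)" for v
    by (simp add: fderiv_eqI linear_add[OF linear_Phi[OF x]] x dPhi_eq c_def)
  have mc: "dPhi x (K x) (E x d) = dPhi x (E x d) (K x) - br (c x) d" for d
    using maurer_cartan[OF x, of "K x" "E x d"] x by (simp add: c_def algebra_simps)
  have "fderiv (\<lambda>y. m y (E x a) (E x b)) x (K x) + m x (fderiv K x (E x a)) (E x b)
      + m x (E x a) (fderiv K x (E x b)) = 0"
    using K x unfolding killing_field_def by blast
  then show ?thesis
    unfolding fderiv_m[OF x] m_Phi[OF x] dK mc Phi_E[OF x] by (simp add: inner_diff_left inner_diff_right)
qed

text \<open>Prolongation of the Killing equations: the commutators applied to \<open>c\<^sub>3\<close>, \<open>c\<^sub>1\<close>, \<open>c\<^sub>2\<close> and to \<open>X 1 c\<^sub>2\<close>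
  determine \<open>X 3 c\<^sub>1\<close> and \<open>X 3 c\<^sub>2\<close>. This is the rigidity of the Hopf direction, and it uses \<open>\<tau> \<noteq> k\<close>.\<close>

lemma killing_hopf:
  assumes K: "killing_field U m K" and x: "x \<in> U"
  defines "c \<equiv> \<lambda>i x. Phi x (K x) $ i"
  shows "X 3 (c 1) x = k * c 2 x" "X 3 (c 2) x = - k * c 1 x" "X 3 (c 3) x = 0"
    "X 1 (c 3) x = - \<tau> * c 2 x" "X 2 (c 3) x = \<tau> * c 1 x"
proof -
  have sK: "smooth_on U K" using K unfolding killing_field_def by blast
  have sP: "smooth_on U (\<lambda>x. Phi x (K x))" by (rule smooth_on_Phi[OF open_U order_refl sK])
  have s: "smooth_on U (c i)" for i unfolding c_def by (rule smooth_on_nth[OF open_U sP])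
  have Xc: "X i (c l) x = fderiv (\<lambda>x. Phi x (K x)) x (E x (axis i 1)) $ l" if "x \<in> U" for i l x
    unfolding X_def c_def
    using fderiv_eqI[OF bounded_linear.has_derivative[OF bounded_linear_vec_nth smooth_on_imp_has_derivative[OF sP that]]]
    by metis
  have ax: "a \<bullet> axis i 1 = a $ i" "axis i 1 \<bullet> a = a $ i" for a :: "real^3" and i
    by (simp_all add: inner_axis inner_axis' )
  have K2: "X i (c l) x + X l (c i) x = br (Phi x (K x)) (axis i 1) $ l + br (Phi x (K x)) (axis l 1) $ i"
    if "x \<in> U" for i l x
    using killing_frame[OF K that, of "axis i 1" "axis l 1"] unfolding Xc[OF that] ax .
  have "X 1 (c 1) x = 0 \<and> X 2 (c 2) x = 0 \<and> X 3 (c 3) x = 0 \<and> X 2 (c 1) x = (- 1) * X 1 (c 2) x + 0 * c 1 x \<and>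
    X 1 (c 3) x = (- 1) * X 3 (c 1) x + (- (\<tau> - k)) * c 2 x \<and> X 2 (c 3) x = (- 1) * X 3 (c 2) x + (\<tau> - k) * c 1 x"
    if "x \<in> U" for x
    using K2[OF that, of 1 1] K2[OF that, of 2 2] K2[OF that, of 3 3] K2[OF that, of 1 2] K2[OF that, of 1 3] K2[OF that, of 2 3]
    by (simp add: br_def axis_def c_def algebra_simps)
  then have eB: "\<forall>x\<in>U. X 1 (c 1) x = 0" "\<forall>x\<in>U. X 2 (c 2) x = 0" "\<forall>x\<in>U. X 3 (c 3) x = 0"
    "\<forall>x\<in>U. X 2 (c 1) x = (- 1) * X 1 (c 2) x + 0 * c 1 x"
    "\<forall>x\<in>U. X 1 (c 3) x = (- 1) * X 3 (c 1) x + (- (\<tau> - k)) * c 2 x"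
    "\<forall>x\<in>U. X 2 (c 3) x = (- 1) * X 3 (c 2) x + (\<tau> - k) * c 1 x" by blast+
  note e = eB[THEN bspec]
  note sX = smooth_X[OF s]
  have z: "X i f y = 0" if "\<forall>x\<in>U. f x = 0" "y \<in> U" for i f y
    using X_linear[of f 0 "c 1" 0 "c 1", OF _ s s that(2)] that(1) by simp
  define A where "A = X 1 (c 2)"
  have sA: "smooth_on U A" unfolding A_def by (rule sX)
  have XA: "X i (X 2 (c 1)) y = - X i A y" if "y \<in> U" for i y
    using X_linear[OF eB(4) sX s that] unfolding A_def by simp
  \<comment> \<open>\<open>X 3 A\<close> has two expressions, through \<open>c 2\<close> and through
    \<open>c 1\<close>. The commutator of \<open>X 1\<close> and \<open>X 2\<close> on
    \<open>c 3\<close> yields minus their sum, while \<open>X 3 (c 3) = 0\<close>.\<close>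
  have A3: "\<forall>y\<in>U. X 3 A y = 0"
  proof
    fix y assume y: "y \<in> U"
    have 1: "X 3 A y = X 1 (X 3 (c 2)) y"
      using X_commutators(3)[OF s y, of 2] e(2)[OF y] unfolding A_def by simp
    have 2: "X 2 (X 3 (c 1)) y = - X 3 A y"
      using X_commutators(2)[OF s y, of 1] e(1)[OF y] XA[OF y, of 3] by simp
    have "X 1 (X 2 (c 3)) y = - X 1 (X 3 (c 2)) y" "X 2 (X 1 (c 3)) y = - X 2 (X 3 (c 1)) y"
      using X_linear[OF eB(6) sX s y, of 1] X_linear[OF eB(5) sX s y, of 2] e(1)[OF y] e(2)[OF y] by simp_all
    then show "X 3 A y = 0" using X_commutators(1)[OF s y, of 3] e(3)[OF y] 1 2 by simp
  qed
  have A1: "\<forall>y\<in>U. X 1 A y = (- \<tau>) * X 3 (c 1) y + 0 * c 1 y"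
  proof
    fix y assume y: "y \<in> U"
    have "- X 1 A y = \<tau> * X 3 (c 1) y"
      using X_commutators(1)[OF s y, of 1] XA[OF y, of 1] z[OF eB(1) y, of 2] by simp
    then show "X 1 A y = (- \<tau>) * X 3 (c 1) y + 0 * c 1 y" by simp
  qed
  have A2: "\<forall>y\<in>U. X 2 A y = (- \<tau>) * X 3 (c 2) y + 0 * c 1 y"
  proof
    fix y assume y: "y \<in> U"
    have "- X 2 A y = \<tau> * X 3 (c 2) y"
      using X_commutators(1)[OF s y, of 2] z[OF eB(2) y, of 1] unfolding A_def by simp
    then show "X 2 A y = (- \<tau>) * X 3 (c 2) y + 0 * c 1 y" by simp
  qed
  \<comment> \<open>As \<open>X 3 A\<close> vanishes, the commutators of \<open>A\<close> with the
    Hopf direction become second-order equations for \<open>c 1\<close> and \<open>c 2\<close> along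
    it.\<close>
  have "\<tau> * X 3 (X 3 (c 1)) x = \<tau> * (k * X 3 (c 2) x)" "\<tau> * X 3 (X 3 (c 2)) x = \<tau> * (- k * X 3 (c 1) x)"
    using X_commutators(3)[OF sA x] X_commutators(2)[OF sA x] z[OF A3 x, of 1] z[OF A3 x, of 2]
      X_linear[OF A1 sX s x, of 3] X_linear[OF A2 sX s x, of 3] A1[THEN bspec, OF x] A2[THEN bspec, OF x] by simp_all
  then have c33: "X 3 (X 3 (c 1)) x = k * X 3 (c 2) x" "X 3 (X 3 (c 2)) x = - k * X 3 (c 1) x"
    using tau_pos mult_left_cancel[of \<tau>] by (metis order_less_irrefl)+
  \<comment> \<open>The commutators on \<open>c 3\<close> lower the order to one, at the price of a
    factor \<open>\<tau> - k\<close>. It is nonzero as \<open>k < 0 < \<tau>\<close>; at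
    \<open>\<tau> = k\<close> the metric would be round and have further Killing fields.\<close>
  have "(\<tau> - k) * X 3 (c 2) x = (\<tau> - k) * (- k * c 1 x)"
    using X_commutators(3)[OF s x, of 3] z[OF eB(3) x, of 1] X_linear[OF eB(5) sX s x, of 3] e(6)[OF x] c33
    by (simp add: algebra_simps)
  moreover have "(\<tau> - k) * X 3 (c 1) x = (\<tau> - k) * (k * c 2 x)"
    using X_commutators(2)[OF s x, of 3] z[OF eB(3) x, of 2] X_linear[OF eB(6) sX s x, of 3] e(5)[OF x] c33
    by (simp add: algebra_simps)
  moreover have "\<tau> - k \<noteq> 0" using tau_pos k_neg by simp
  ultimately show c3: "X 3 (c 1) x = k * c 2 x" "X 3 (c 2) x = - k * c 1 x"
    by (metis mult_left_cancel)+
  \<comment> \<open>With the two preceding equations: along the Hopf field \<open>c\<close> changes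
    as for a right-invariant field, that is, \<open>K\<close> commutes with the Hopf field.\<close>
  show "X 3 (c 3) x = 0" by (rule e(3)[OF x])
  show "X 1 (c 3) x = - \<tau> * c 2 x" "X 2 (c 3) x = \<tau> * c 1 x"
    using e(5)[OF x] e(6)[OF x] unfolding c3 by (simp_all add: algebra_simps)
qed

text \<open>Compared with \<open>z' = c - \<tau> y\<close>, the first equation forces
  \<open>c = 0\<close> for restrictions of Killing fields. The other two say that on a vertical
  geodesic the horizontal part merely rotates.\<close>

lemma killing_along:
  assumes K: "killing_field U m K" and v: "geo_flow I \<gamma> v" and t: "t \<in> I"
  defines "c \<equiv> \<lambda>t. Phi (\<gamma> t) (K (\<gamma> t))"
  shows "((\<lambda>t. c t $ 3) has_real_derivative \<tau> * (v t $ 2 * c t $ 1 - v t $ 1 * c t $ 2)) (at t)"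
    "v t $ 1 = 0 \<Longrightarrow> v t $ 2 = 0 \<Longrightarrow> ((\<lambda>t. c t $ 1) has_real_derivative k * v t $ 3 * c t $ 2) (at t)"
    "v t $ 1 = 0 \<Longrightarrow> v t $ 2 = 0 \<Longrightarrow> ((\<lambda>t. c t $ 2) has_real_derivative - k * v t $ 3 * c t $ 1) (at t)"
proof -
  note D = geo_flowD[OF v t]
  have sK: "smooth_on U K" using K unfolding killing_field_def by blast
  have s: "smooth_on U (\<lambda>x. Phi x (K x) $ i)" for i
    by (rule smooth_on_nth[OF open_U smooth_on_Phi[OF open_U order_refl sK]])
  have d: "((\<lambda>t. c t $ i) has_real_derivative
      (v t $ 1 * X 1 (\<lambda>x. Phi x (K x) $ i) (\<gamma> t) + v t $ 2 * X 2 (\<lambda>x. Phi x (K x) $ i) (\<gamma> t)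
       + v t $ 3 * X 3 (\<lambda>x. Phi x (K x) $ i) (\<gamma> t))) (at t)" for i
  proof -
    note sd = smooth_on_imp_has_derivative[OF s D(1)]
    note l = has_derivative_linear[OF sd]
    have "E (\<gamma> t) (v t) = (v t $ 1) *\<^sub>R E (\<gamma> t) (axis 1 1) + (v t $ 2) *\<^sub>R E (\<gamma> t) (axis 2 1)
        + (v t $ 3) *\<^sub>R E (\<gamma> t) (axis 3 1)"
      by (simp add: E_def axis_def)
    then have "fderiv (\<lambda>x. Phi x (K x) $ i) (\<gamma> t) (E (\<gamma> t) (v t)) =
       v t $ 1 * X 1 (\<lambda>x. Phi x (K x) $ i) (\<gamma> t) + v t $ 2 * X 2 (\<lambda>x. Phi x (K x) $ i) (\<gamma> t)
       + v t $ 3 * X 3 (\<lambda>x. Phi x (K x) $ i) (\<gamma> t)"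
      unfolding X_def by (simp add: linear_add[OF l] linear_scale[OF l])
    note eq = this
    show ?thesis
      using has_derivative_compose[OF D(2)[unfolded has_vector_derivative_def] sd]
      unfolding eq[symmetric] by (simp add: c_def has_field_derivative_def linear_scale[OF l] mult_commute_abs)
  qed
  show "((\<lambda>t. c t $ 3) has_real_derivative \<tau> * (v t $ 2 * c t $ 1 - v t $ 1 * c t $ 2)) (at t)"
    using d[of 3] unfolding killing_hopf[OF K D(1)] by (simp add: c_def algebra_simps)
  show "((\<lambda>t. c t $ 1) has_real_derivative k * v t $ 3 * c t $ 2) (at t)" if "v t $ 1 = 0" "v t $ 2 = 0"
    using d[of 1] unfolding killing_hopf[OF K D(1)] that by (simp add: c_def algebra_simps)
  show "((\<lambda>t. c t $ 2) has_real_derivative - k * v t $ 3 * c t $ 1) (at t)" if "v t $ 1 = 0" "v t $ 2 = 0"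
    using d[of 2] unfolding killing_hopf[OF K D(1)] that by (simp add: c_def algebra_simps)
qed

end

section \<open>Completeness\<close>

text \<open>Global bounds make Picard iteration a contraction of all bounded continuous functions,
  with no invariant ball to maintain; the choice of \<open>d\<close> provides the factor
  \<open>d * L < 1\<close>.\<close>

lemma picard_bounded:
  fixes f :: "real \<Rightarrow> 'a::euclidean_space \<Rightarrow> 'a"
  assumes cont: "continuous_on UNIV (\<lambda>(t, x). f t x)"
    and bound: "\<And>t x. norm (f t x) \<le> M"
    and lip: "\<And>t x y. norm (f t x - f t y) \<le> L * norm (x - y)"
    and d: "0 < d" "d * L < 1" and L: "0 \<le> L"
  obtains x where "continuous_on {a..a + d} x" "x a = x0"
    "\<And>t. t \<in> {a<..<a + d} \<Longrightarrow> (x has_vector_derivative f t (x t)) (at t)"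
    "\<And>t. t \<in> {a..a + d} \<Longrightarrow> norm (x t - x0) \<le> M * d"
proof -
  \<comment> \<open>Freezing the time outside the interval makes the iterates bounded continuous
    functions on the whole line, as the type \<open>bcontfun\<close> demands.\<close>
  define clamp where "clamp t = max a (min t (a + d))" for t
  have cl: "clamp t \<in> {a..a + d}" for t using d unfolding clamp_def by auto
  have cl_cont: "continuous_on UNIV clamp" unfolding clamp_def by (intro continuous_intros)
  define P where "P \<phi> t = x0 + integral {a..clamp t} (\<lambda>s. f s (\<phi> s))" for \<phi> :: "real \<Rightarrow> 'a" and t
  have fc: "continuous_on S (\<lambda>s. f s (\<phi> s))" if "continuous_on UNIV \<phi>" for \<phi> S
  proof -
    have "continuous_on S (\<lambda>s. (s, \<phi> s))"
      using continuous_on_subset[OF that] by (intro continuous_on_Pair continuous_on_id) auto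
    from continuous_on_compose2[OF cont this] show ?thesis by simp
  qed
  have int: "(\<lambda>s. f s (\<phi> s)) integrable_on {a..b}" if "continuous_on UNIV \<phi>" for \<phi> b
    by (rule integrable_continuous_real[OF fc[OF that]])
  have intc: "continuous_on {a..a + d} (\<lambda>t. integral {a..t} (\<lambda>s. f s (\<phi> s)))" if "continuous_on UNIV \<phi>" for \<phi>
    by (rule indefinite_integral_continuous_1[OF int[OF that]])
  have Pc: "continuous_on UNIV (P \<phi>)" if "continuous_on UNIV \<phi>" for \<phi>
    unfolding P_def
    by (intro continuous_on_add continuous_on_const continuous_on_compose2[OF intc[OF that] cl_cont]) (use cl in auto)
  have Pb: "norm (P \<phi> t - x0) \<le> M * d" if "continuous_on UNIV \<phi>" for \<phi> t
  proof -
    have "norm (integral {a..clamp t} (\<lambda>s. f s (\<phi> s))) \<le> M * (clamp t - a)"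
      by (rule integral_bound) (use cl[of t] fc[OF that] bound in auto)
    also have "\<dots> \<le> M * d"
      using cl[of t] order_trans[OF norm_ge_zero bound] by (intro mult_left_mono) auto
    finally show ?thesis unfolding P_def by simp
  qed
  have Pbc: "P \<phi> \<in> bcontfun" if "continuous_on UNIV \<phi>" for \<phi>
  proof -
    have "bounded (range (P \<phi>))"
      unfolding bounded_iff
      by (rule exI[of _ "norm x0 + M * d"]) (use Pb[OF that] norm_triangle_sub in \<open>smt (verit) rangeE\<close>)
    then show ?thesis using Pc[OF that] by (simp add: bcontfun_def)
  qed
  define Q where "Q \<phi> = Bcontfun (P (apply_bcontfun \<phi>))" for \<phi> :: "real \<Rightarrow>\<^sub>C 'a"
  have Q: "apply_bcontfun (Q \<phi>) = P (apply_bcontfun \<phi>)" for \<phi>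
    unfolding Q_def by (rule Bcontfun_inverse[OF Pbc]) simp
  have "\<exists>!\<phi>. Q \<phi> = \<phi>"
  proof (rule banach_fix_type[of "d * L"])
    show "0 \<le> d * L" "d * L < 1" using d L by auto
    show "\<forall>\<phi> \<psi>. dist (Q \<phi>) (Q \<psi>) \<le> d * L * dist \<phi> \<psi>"
    proof (intro allI dist_bound)
      fix \<phi> \<psi> :: "real \<Rightarrow>\<^sub>C 'a" and t
      have 1: "norm (f s (\<phi> s) - f s (\<psi> s)) \<le> L * dist \<phi> \<psi>" for s
        using order_trans[OF lip[unfolded dist_norm[symmetric]] mult_left_mono[OF dist_bounded[of \<phi> s \<psi>] L]] by (simp add: dist_norm)
      have "dist (Q \<phi> t) (Q \<psi> t) = norm (integral {a..clamp t} (\<lambda>s. f s (\<phi> s) - f s (\<psi> s)))"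
        unfolding Q P_def by (simp add: dist_norm integral_diff[OF int int])
      also have "\<dots> \<le> (L * dist \<phi> \<psi>) * (clamp t - a)"
        by (rule integral_bound) (use cl[of t] fc[of \<phi>] fc[of \<psi>] 1 in \<open>auto intro!: continuous_intros\<close>)
      also have "\<dots> \<le> (L * dist \<phi> \<psi>) * d"
        using cl[of t] L by (intro mult_left_mono) auto
      finally show "dist (Q \<phi> t) (Q \<psi> t) \<le> d * L * dist \<phi> \<psi>" by (simp add: mult_ac)
    qed
  qed
  then obtain \<phi> where "Q \<phi> = \<phi>" by blast
  then have fixed: "apply_bcontfun \<phi> = P (apply_bcontfun \<phi>)" using Q by metis
  show thesis
  proof
    show "continuous_on {a..a + d} (apply_bcontfun \<phi>)" by simp
    have "clamp a = a" using d unfolding clamp_def by simp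
    then show "\<phi> a = x0" by (subst fixed) (simp add: P_def)
    show "norm (\<phi> t - x0) \<le> M * d" for t by (subst fixed) (rule Pb, simp)
    fix t assume t: "t \<in> {a<..<a + d}"
    have "((\<lambda>t. integral {a..t} (\<lambda>s. f s (\<phi> s))) has_vector_derivative f t (\<phi> t)) (at t within {a..a + d})"
      by (rule integral_has_vector_derivative[OF fc]) (use t in auto)
    then have "((\<lambda>t. integral {a..t} (\<lambda>s. f s (\<phi> s))) has_vector_derivative f t (\<phi> t)) (at t)"
      using t at_within_interior[of t "{a..a + d}"] by (simp add: interior_atLeastAtMost_real)
    then have "((\<lambda>t. x0 + integral {a..t} (\<lambda>s. f s (\<phi> s))) has_vector_derivative f t (\<phi> t)) (at t)"
      by (auto intro!: derivative_eq_intros)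
    then show "(\<phi> has_vector_derivative f t (\<phi> t)) (at t)"
    proof (rule has_vector_derivative_transform[of _ _ _ "{a<..<a + d}"])
      fix s assume "s \<in> {a<..<a + d}"
      then have "clamp s = s" unfolding clamp_def by auto
      then show "x0 + integral {a..s} (\<lambda>s. f s (\<phi> s)) = \<phi> s" by (subst (2) fixed) (simp add: P_def)
    qed (use t in auto)
  qed
qed

lemma smooth_on_lipschitz:
  fixes f :: "'a::euclidean_space \<Rightarrow> 'b::real_normed_vector"
  assumes f: "smooth_on S f" and C: "compact C" "convex C" "C \<subseteq> S"
  obtains L where "L \<ge> 0" "\<And>x y. x \<in> C \<Longrightarrow> y \<in> C \<Longrightarrow> norm (f x - f y) \<le> L * norm (x - y)"
proof -
  have "\<exists>B. \<forall>x\<in>C. norm (fderiv f x b) \<le> B" for b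
  proof -
    have "continuous_on C (\<lambda>x. fderiv f x b)"
      using continuous_on_subset[OF smooth_on_imp_continuous_on[OF smooth_on_fderiv[OF f]] C(3)] .
    then have "bounded ((\<lambda>x. fderiv f x b) ` C)" using compact_continuous_image C(1) compact_imp_bounded by blast
    then show ?thesis unfolding bounded_iff by auto
  qed
  then obtain B where B: "\<And>b x. x \<in> C \<Longrightarrow> norm (fderiv f x b) \<le> B b" by metis
  define L where "L = (\<Sum>b\<in>Basis. \<bar>B b\<bar>)"
  have L: "L \<ge> 0" unfolding L_def by (simp add: sum_nonneg)
  have d: "(f has_derivative fderiv f x) (at x)" if "x \<in> C" for x
    using smooth_on_imp_has_derivative[OF f] that C(3) by blast
  have o: "onorm (fderiv f x) \<le> L" if x: "x \<in> C" for x
  proof (rule onorm_bound[OF L])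
    fix v
    have "norm (fderiv f x v) = norm (\<Sum>b\<in>Basis. (v \<bullet> b) *\<^sub>R fderiv f x b)"
      using linear_expand[OF has_derivative_linear[OF d[OF x]], of v] by simp
    also have "\<dots> \<le> (\<Sum>b\<in>Basis. norm ((v \<bullet> b) *\<^sub>R fderiv f x b))" by (rule norm_sum)
    also have "\<dots> \<le> (\<Sum>b\<in>Basis. norm v * \<bar>B b\<bar>)"
    proof (rule sum_mono)
      fix b :: 'a assume "b \<in> Basis"
      then have "\<bar>v \<bullet> b\<bar> \<le> norm v" by (rule Basis_le_norm)
      moreover have "norm (fderiv f x b) \<le> \<bar>B b\<bar>" using B[OF x, of b] by linarith
      ultimately show "norm ((v \<bullet> b) *\<^sub>R fderiv f x b) \<le> norm v * \<bar>B b\<bar>"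
        by (simp add: mult_mono)
    qed
    finally show "norm (fderiv f x v) \<le> L * norm v" unfolding L_def by (simp add: sum_distrib_left mult.commute)
  qed
  have "norm (f x - f y) \<le> L * norm (x - y)" if "x \<in> C" "y \<in> C" for x y
    by (rule differentiable_bound[OF C(2) _ o that]) (use d has_derivative_at_withinI in blast)
  with L show thesis using that by blast
qed

context sl2_tilde
begin

lemma E_lipschitz:
  assumes "compact C" "convex C" "C \<subseteq> U"
  obtains L where "L \<ge> 0"
    "\<And>x y c. x \<in> C \<Longrightarrow> y \<in> C \<Longrightarrow> norm (E x c - E y c) \<le> L * norm c * norm (x - y)"
proof -
  obtain L1 where L1: "L1 \<ge> 0" "\<And>x y. x \<in> C \<Longrightarrow> y \<in> C \<Longrightarrow> norm (u1 x - u1 y) \<le> L1 * norm (x - y)"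
    using smooth_on_lipschitz[OF smooth_u(1) assms] by blast
  obtain L2 where L2: "L2 \<ge> 0" "\<And>x y. x \<in> C \<Longrightarrow> y \<in> C \<Longrightarrow> norm (u2 x - u2 y) \<le> L2 * norm (x - y)"
    using smooth_on_lipschitz[OF smooth_u(2) assms] by blast
  obtain L3 where L3: "L3 \<ge> 0" "\<And>x y. x \<in> C \<Longrightarrow> y \<in> C \<Longrightarrow> norm (u3 x - u3 y) \<le> L3 * norm (x - y)"
    using smooth_on_lipschitz[OF smooth_u(3) assms] by blast
  have "norm (E x c - E y c) \<le> (L1 + L2 + L3) * norm c * norm (x - y)" if "x \<in> C" "y \<in> C" for x y c
  proof -
    have n: "\<bar>c $ i\<bar> \<le> norm c" for i using component_le_norm_cart by blast
    have "E x c - E y c = (c $ 1) *\<^sub>R (u1 x - u1 y) + (c $ 2) *\<^sub>R (u2 x - u2 y) + (c $ 3) *\<^sub>R (u3 x - u3 y)"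
      by (simp add: E_def algebra_simps)
    then have "norm (E x c - E y c) \<le> \<bar>c $ 1\<bar> * norm (u1 x - u1 y) + \<bar>c $ 2\<bar> * norm (u2 x - u2 y) + \<bar>c $ 3\<bar> * norm (u3 x - u3 y)"
      using norm_triangle_le[OF add_mono[OF norm_triangle_ineq order_refl]] by (simp add: norm_triangle_mono)
    also have "\<dots> \<le> norm c * (L1 * norm (x - y)) + norm c * (L2 * norm (x - y)) + norm c * (L3 * norm (x - y))"
      using that by (intro add_mono mult_mono n L1 L2 L3) auto
    finally show ?thesis by (simp add: algebra_simps)
  qed
  moreover have "L1 + L2 + L3 \<ge> 0" using L1 L2 L3 by simp
  ultimately show thesis using that by blast
qed

text \<open>The set of agreement is closed in \<open>J\<close> by continuity. It is open because the
  Lipschitz bound on a ball feeds \<open>gronwall_zero\<close> with the squared distance;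
  connectedness does the rest.\<close>

lemma frame_flow_unique:
  assumes J: "open J" "is_interval J"
    and x: "\<And>t. t \<in> J \<Longrightarrow> x t \<in> U \<and> (x has_vector_derivative E (x t) (v t)) (at t)"
    and y: "\<And>t. t \<in> J \<Longrightarrow> y t \<in> U \<and> (y has_vector_derivative E (y t) (v t)) (at t)"
    and v: "\<And>t. t \<in> J \<Longrightarrow> norm (v t) \<le> 1" and t1: "t1 \<in> J" "x t1 = y t1" and t: "t \<in> J"
  shows "x t = y t"
proof -
  have cx: "continuous_on J x" and cy: "continuous_on J y"
    using x y by (meson continuous_at_imp_continuous_on has_vector_derivative_continuous)+
  define A where "A = {t \<in> J. x t = y t}"
  have "A = {t \<in> J. x t - y t = 0}" unfolding A_def by auto
  then have "closedin (top_of_set J) A"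
    using continuous_closedin_preimage_constant[of J "\<lambda>t. x t - y t" 0] cx cy
    by (auto intro: continuous_intros)
  moreover have "open A"
    unfolding open_contains_ball
  proof
    fix s assume s: "s \<in> A"
    then have sJ: "s \<in> J" and xy: "x s = y s" unfolding A_def by auto
    obtain r where r: "r > 0" "cball (x s) r \<subseteq> U"
      using open_U x[OF sJ] open_contains_cball by blast
    have "continuous (at s) x" "continuous (at s) y"
      using x[OF sJ] y[OF sJ] has_vector_derivative_continuous by blast+
    then obtain e1 e2 where e: "e1 > 0" "\<And>t. dist t s < e1 \<Longrightarrow> dist (x t) (x s) < r"
      "e2 > 0" "\<And>t. dist t s < e2 \<Longrightarrow> dist (y t) (y s) < r"
      using r(1) unfolding continuous_at_eps_delta by (metis dist_norm)
    obtain e3 where e3: "e3 > 0" "ball s e3 \<subseteq> J" using J(1) sJ open_contains_ball by blast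
    define B where "B = ball s (min e1 (min e2 e3))"
    have B: "s \<in> B" "B \<subseteq> J" "is_interval B"
      using e e3 unfolding B_def by (auto simp: is_interval_ball_real subset_iff)
    have in_cball: "x t \<in> cball (x s) r" "y t \<in> cball (x s) r" if "t \<in> B" for t
      using e(2)[of t] e(4)[of t] that unfolding B_def xy by (auto simp: dist_commute)
    obtain L where L: "L \<ge> 0" "\<And>p q c. p \<in> cball (x s) r \<Longrightarrow> q \<in> cball (x s) r \<Longrightarrow> norm (E p c - E q c) \<le> L * norm c * norm (p - q)"
      using E_lipschitz[OF compact_cball convex_cball r(2)] by metis
    have "(x t - y t) \<bullet> (x t - y t) = 0" if t: "t \<in> B" for t
    proof (rule gronwall_zero[OF B(3) _ _ _ B(1) _ t, where K="2 * L"])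
      fix t assume t: "t \<in> B"
      then have tJ: "t \<in> J" using B by blast
      have "((\<lambda>t. x t - y t) has_vector_derivative (E (x t) (v t) - E (y t) (v t))) (at t)"
        using x[OF tJ] y[OF tJ] by (intro has_vector_derivative_diff) auto
      from bounded_bilinear.has_vector_derivative[OF bounded_bilinear_inner this this]
      show "((\<lambda>t. (x t - y t) \<bullet> (x t - y t)) has_real_derivative 2 * ((x t - y t) \<bullet> (E (x t) (v t) - E (y t) (v t)))) (at t)"
        by (simp add: has_real_derivative_iff_has_vector_derivative inner_commute)
      have "\<bar>(x t - y t) \<bullet> (E (x t) (v t) - E (y t) (v t))\<bar> \<le> norm (x t - y t) * norm (E (x t) (v t) - E (y t) (v t))"
        by (rule Cauchy_Schwarz_ineq2)
      also have "\<dots> \<le> norm (x t - y t) * (L * 1 * norm (x t - y t))"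
        using L(2)[OF in_cball[OF t], of "v t"] mult_mono[OF mult_left_mono[OF v[OF tJ] L(1)] order_refl[of "norm (x t - y t)"]] L(1)
        by (intro mult_left_mono) auto
      finally show "\<bar>2 * ((x t - y t) \<bullet> (E (x t) (v t) - E (y t) (v t)))\<bar> \<le> 2 * L * ((x t - y t) \<bullet> (x t - y t))"
        by (simp add: dot_square_norm power2_eq_square mult_ac abs_mult)
    qed (use xy in auto)
    then have "B \<subseteq> A" using B(2) unfolding A_def by auto
    then show "\<exists>e>0. ball s e \<subseteq> A" using e e3 unfolding B_def by (intro exI[of _ "min e1 (min e2 e3)"]) auto
  qed
  then have "openin (top_of_set J) A" unfolding A_def by (auto intro: open_subset)
  ultimately have "A = {} \<or> A = J"
    using J(2) is_interval_connected connected_clopen by blast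
  then show ?thesis using t1 t unfolding A_def by blast
qed

text \<open>The point is that \<open>r\<close> depends neither on \<open>t1\<close> nor on
  \<open>g\<close>: solutions are built near the identity and moved to \<open>g\<close> by a left
  translation, which preserves the equation.\<close>

lemma frame_flow_exists:
  assumes v: "continuous_on UNIV v" "\<And>t. norm (v t) \<le> 1"
  obtains r where "r > 0" "\<And>t1 g. g \<in> U \<Longrightarrow> \<exists>x. x t1 = g \<and>
    (\<forall>t\<in>{t1 - r<..<t1 + r}. x t \<in> U \<and> (x has_vector_derivative E (x t) (v t)) (at t))"
proof -
  let ?M = "\<lambda>(x, y). x \<otimes>\<^bsub>G\<^esub> y"
  interpret G: group G by (rule group)
  obtain R where R: "R > 0" "cball \<one>\<^bsub>G\<^esub> R \<subseteq> U" using open_U G.one_closed open_contains_cball by blast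
  let ?C = "cball \<one>\<^bsub>G\<^esub> R"
  obtain L where L: "L \<ge> 0" "\<And>p q c. p \<in> ?C \<Longrightarrow> q \<in> ?C \<Longrightarrow> norm (E p c - E q c) \<le> L * norm c * norm (p - q)"
    using E_lipschitz[OF compact_cball convex_cball R(2)] by metis
  have u_bound: "\<exists>B. \<forall>x\<in>?C. norm (u x) \<le> B" if "smooth_on U u" for u :: "'a \<Rightarrow> 'a"
    using compact_imp_bounded[OF compact_continuous_image[OF continuous_on_subset[OF smooth_on_imp_continuous_on[OF that] R(2)] compact_cball]]
    unfolding bounded_iff by auto
  obtain B1 B2 B3 where B: "\<And>x. x \<in> ?C \<Longrightarrow> norm (u1 x) \<le> B1" "\<And>x. x \<in> ?C \<Longrightarrow> norm (u2 x) \<le> B2" "\<And>x. x \<in> ?C \<Longrightarrow> norm (u3 x) \<le> B3"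
    using u_bound[OF smooth_u(1)] u_bound[OF smooth_u(2)] u_bound[OF smooth_u(3)] by blast
  define M where "M = B1 + B2 + B3"
  \<comment> \<open>Projecting to a ball around the identity makes the field globally bounded and
    Lipschitz.\<close>
  define \<pi> where "\<pi> = closest_point ?C"
  have C: "closed ?C" "convex ?C" "?C \<noteq> {}" using R(1) by auto
  have \<pi>: "\<pi> x \<in> ?C" for x unfolding \<pi>_def using closest_point_in_set[OF C(1,3)] .
  have \<pi>_cont: "continuous_on UNIV \<pi>" unfolding \<pi>_def by (rule continuous_on_closest_point[OF C(2,1,3)])
  define f where "f t x = E (\<pi> x) (v t)" for t x
  have Mb: "norm (f t x) \<le> M" for t x
  proof -
    have n: "\<bar>v t $ i\<bar> \<le> 1" for i using component_le_norm_cart[of "v t" i] v(2)[of t] by linarith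
    have "norm ((v t $ i) *\<^sub>R w) \<le> norm w" for i and w :: 'a
      using mult_right_mono[OF n[of i] norm_ge_zero[of w]] by simp
    then have "norm ((v t $ 1) *\<^sub>R u1 (\<pi> x)) \<le> B1" "norm ((v t $ 2) *\<^sub>R u2 (\<pi> x)) \<le> B2" "norm ((v t $ 3) *\<^sub>R u3 (\<pi> x)) \<le> B3"
      using B[OF \<pi>[of x]] order_trans by blast+
    then show ?thesis unfolding f_def E_def M_def by (intro norm_triangle_mono)
  qed
  have lip: "norm (f t x - f t y) \<le> L * norm (x - y)" for t x y
  proof -
    have "norm (f t x - f t y) \<le> L * norm (v t) * norm (\<pi> x - \<pi> y)"
      unfolding f_def by (rule L(2)[OF \<pi> \<pi>])
    also have "\<dots> \<le> L * 1 * norm (x - y)"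
      using v(2) L(1) closest_point_lipschitz[OF C(2,1,3), of x y] unfolding \<pi>_def dist_norm
      by (intro mult_mono) auto
    finally show ?thesis by simp
  qed
  have fc: "continuous_on UNIV (\<lambda>(t, x). f t x)"
  proof -
    have u: "continuous_on UNIV (\<lambda>p. u (\<pi> (snd p)))" if "smooth_on U u" for u :: "'a \<Rightarrow> 'a"
      by (rule continuous_on_compose2[OF continuous_on_subset[OF smooth_on_imp_continuous_on[OF that] R(2)]
            continuous_on_compose2[OF \<pi>_cont continuous_on_snd[OF continuous_on_id]]]) (use \<pi> in auto)
    have w: "continuous_on UNIV (\<lambda>p::real \<times> 'a. v (fst p) $ i)" for i
      by (intro continuous_on_component continuous_on_compose2[OF v(1) continuous_on_fst[OF continuous_on_id]]) auto
    show ?thesis unfolding f_def E_def case_prod_beta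
      by (intro continuous_on_add continuous_on_scaleR u w smooth_u)
  qed
  \<comment> \<open>The first bound keeps the solution in the ball, where the projection is the
    identity; the second gives the contraction.\<close>
  define d where "d = min (R / (\<bar>M\<bar> + 1)) (1 / (2 * (L + 1)))"
  have d: "d > 0" "d * L < 1" "M * d \<le> R"
  proof -
    show d0: "d > 0" unfolding d_def using R L by (auto intro!: divide_pos_pos add_nonneg_pos)
    have "d * L \<le> 1 / (2 * (L + 1)) * L" using L unfolding d_def by (intro mult_right_mono) auto
    also have "\<dots> < 1" using L by (simp add: field_simps)
    finally show "d * L < 1" .
    have "M * d \<le> (\<bar>M\<bar> + 1) * d" using d0 by (intro mult_right_mono) auto
    also have "\<dots> \<le> (\<bar>M\<bar> + 1) * (R / (\<bar>M\<bar> + 1))" unfolding d_def by (intro mult_left_mono) auto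
    also have "\<dots> = R" by simp
    finally show "M * d \<le> R" .
  qed
  show thesis
  proof (rule that)
    show "d / 2 > 0" using d by simp
    fix t1 g assume g: "g \<in> U"
    \<comment> \<open>Starting half an interval early puts \<open>t1\<close> in the interior; the
      value at \<open>t1\<close> is then translated to \<open>g\<close>.\<close>
    obtain x where x: "x (t1 - d/2) = \<one>\<^bsub>G\<^esub>"
      "\<And>t. t \<in> {t1 - d/2<..<t1 - d/2 + d} \<Longrightarrow> (x has_vector_derivative f t (x t)) (at t)"
      "\<And>t. t \<in> {t1 - d/2..t1 - d/2 + d} \<Longrightarrow> norm (x t - \<one>\<^bsub>G\<^esub>) \<le> M * d"
      using picard_bounded[OF fc Mb lip d(1,2) L(1), of "t1 - d/2" "\<one>\<^bsub>G\<^esub>"] by metis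
    have xC: "x t \<in> ?C" if "t \<in> {t1 - d/2..t1 - d/2 + d}" for t
      using order_trans[OF x(3)[OF that] d(3)] by (simp add: dist_norm norm_minus_commute)
    have xd: "(x has_vector_derivative E (x t) (v t)) (at t)" if t: "t \<in> {t1 - d/2<..<t1 + d/2}" for t
    proof -
      have "\<pi> (x t) = x t" unfolding \<pi>_def by (rule closest_point_self[OF xC]) (use t in auto)
      then show ?thesis using x(2)[of t] t unfolding f_def by simp
    qed
    have xU: "x t \<in> U" if t: "t \<in> {t1 - d/2<..<t1 + d/2}" for t using xC[of t] t R(2) by auto
    have x1: "x t1 \<in> U" using xU[of t1] d by simp
    define a where "a = g \<otimes>\<^bsub>G\<^esub> inv\<^bsub>G\<^esub> (x t1)"
    have a: "a \<in> U" unfolding a_def using g x1 by simp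
    show "\<exists>x. x t1 = g \<and> (\<forall>t\<in>{t1 - d/2<..<t1 + d/2}. x t \<in> U \<and> (x has_vector_derivative E (x t) (v t)) (at t))"
    proof (intro exI[of _ "\<lambda>t. a \<otimes>\<^bsub>G\<^esub> x t"] conjI ballI)
      show "a \<otimes>\<^bsub>G\<^esub> x t1 = g" unfolding a_def using g x1 by (simp add: G.m_assoc)
      fix t assume t: "t \<in> {t1 - d/2<..<t1 + d/2}"
      show "a \<otimes>\<^bsub>G\<^esub> x t \<in> U" using a xU[OF t] by simp
      have M: "(?M has_derivative fderiv ?M (a, x t)) (at (a, x t))"
        by (rule smooth_on_imp_has_derivative[OF smooth_mult]) (use a xU[OF t] in auto)
      have "((\<lambda>t. (a, x t)) has_derivative (\<lambda>h. (0, h *\<^sub>R E (x t) (v t)))) (at t)"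
        using xd[OF t] unfolding has_vector_derivative_def by (auto intro!: derivative_eq_intros)
      from has_derivative_compose[OF this M]
      have "((\<lambda>t. a \<otimes>\<^bsub>G\<^esub> x t) has_derivative (\<lambda>h. fderiv ?M (a, x t) (h *\<^sub>R (0, E (x t) (v t))))) (at t)" by simp
      then show "((\<lambda>t. a \<otimes>\<^bsub>G\<^esub> x t) has_vector_derivative E (a \<otimes>\<^bsub>G\<^esub> x t) (v t)) (at t)"
        unfolding has_vector_derivative_def left_invariant_E[OF a xU[OF t]]
          linear_scale[OF has_derivative_linear[OF M]] .
    qed
  qed
qed

section \<open>Explicit velocity coordinates and complete geodesics\<close>

definition euler_flow :: "real^3 \<Rightarrow> real \<Rightarrow> real^3" where
  "euler_flow p t = vec3 (p $ 1 * cos ((\<tau> - k) * p $ 3 * t) - p $ 2 * sin ((\<tau> - k) * p $ 3 * t))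
     (p $ 1 * sin ((\<tau> - k) * p $ 3 * t) + p $ 2 * cos ((\<tau> - k) * p $ 3 * t)) (p $ 3)"

lemma has_vector_derivative_vec3:
  assumes "(f has_real_derivative f') (at t)" "(g has_real_derivative g') (at t)" "(h has_real_derivative h') (at t)"
  shows "((\<lambda>t. vec3 (f t) (g t) (h t)) has_vector_derivative vec3 f' g' h') (at t)"
proof -
  have s: "((\<lambda>t. f t *\<^sub>R b) has_vector_derivative f' *\<^sub>R b) (at t)" if "(f has_real_derivative f') (at t)"
    for f f' and b :: "real^3"
    using has_vector_derivative_scaleR[OF that has_vector_derivative_const[of b]] by simp
  show ?thesis unfolding vec3_def by (intro has_vector_derivative_add s assms)
qed

lemma euler_flow:
  shows "(euler_flow p has_vector_derivative - lc (euler_flow p t) (euler_flow p t)) (at t)"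
    "euler_flow p 0 = p" "norm (euler_flow p t) = norm p" "continuous_on UNIV (euler_flow p)"
proof -
  let ?w = "(\<tau> - k) * p $ 3"
  have "((\<lambda>t. vec3 (p $ 1 * cos (?w * t) - p $ 2 * sin (?w * t)) (p $ 1 * sin (?w * t) + p $ 2 * cos (?w * t)) (p $ 3))
      has_vector_derivative vec3 (- ?w * (p $ 1 * sin (?w * t) + p $ 2 * cos (?w * t)))
        (?w * (p $ 1 * cos (?w * t) - p $ 2 * sin (?w * t))) 0) (at t)" for t
    by (rule has_vector_derivative_vec3; (rule derivative_eq_intros refl)+; simp add: algebra_simps)
  moreover have "vec3 (- ?w * (p $ 1 * sin (?w * t) + p $ 2 * cos (?w * t)))
        (?w * (p $ 1 * cos (?w * t) - p $ 2 * sin (?w * t))) 0 = - lc (euler_flow p t) (euler_flow p t)" for t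
    by (simp add: lc_def euler_flow_def vec3_eq_iff algebra_simps)
  ultimately show d: "(euler_flow p has_vector_derivative - lc (euler_flow p t) (euler_flow p t)) (at t)" for t
    unfolding euler_flow_def[abs_def] by simp
  show "continuous_on UNIV (euler_flow p)"
    using d by (meson continuous_at_imp_continuous_on has_vector_derivative_continuous)
  show "euler_flow p 0 = p" by (simp add: euler_flow_def vec3_eq_iff)
  have "(p $ 1 * cos x - p $ 2 * sin x)\<^sup>2 + (p $ 1 * sin x + p $ 2 * cos x)\<^sup>2 = ((p $ 1)\<^sup>2 + (p $ 2)\<^sup>2) * ((sin x)\<^sup>2 + (cos x)\<^sup>2)" for x
    by algebra
  then show "norm (euler_flow p t) = norm p"
    by (simp add: norm_eq_sqrt_inner inner_vec3 euler_flow_def power2_eq_square[symmetric])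
qed

text \<open>\<open>v\<^sub>3\<close> is constant, so both horizontal parts turn at the same rate and
  their distance is conserved.\<close>

lemma geo_flow_euler:
  assumes I: "is_interval I" "0 \<in> I" and v: "geo_flow I \<gamma> v" and t: "t \<in> I"
  shows "v t = euler_flow (v 0) t"
proof -
  let ?p = "v 0"
  let ?w = "(\<tau> - k) * ?p $ 3"
  define a where "a t = ?p $ 1 * cos (?w * t) - ?p $ 2 * sin (?w * t)" for t
  define b where "b t = ?p $ 1 * sin (?w * t) + ?p $ 2 * cos (?w * t)" for t
  have ab: "(a has_real_derivative - ?w * b t) (at t)" "(b has_real_derivative ?w * a t) (at t)" for t
    unfolding a_def b_def by ((rule derivative_eq_intros refl)+, simp add: algebra_simps)+
  have v3: "v t $ 3 = ?p $ 3" if "t \<in> I" for t using geo_flow_norm(1)[OF I(1) v that I(2)] .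
  have "((\<lambda>t. (v t $ 1 - a t)\<^sup>2 + (v t $ 2 - b t)\<^sup>2) has_real_derivative 0) (at t)" if "t \<in> I" for t
    by (rule derivative_eq_intros geo_flow_components(1,2)[OF v that] ab refl)+
       (simp add: v3[OF that] algebra_simps)
  from real_derivative_zero_const[OF I(1) this t I(2)]
  have "(v t $ 1 - a t)\<^sup>2 + (v t $ 2 - b t)\<^sup>2 = 0" by (simp add: a_def b_def)
  then have "v t $ 1 = a t" "v t $ 2 = b t" by (simp_all add: sum_power2_eq_zero_iff)
  then show ?thesis using v3[OF t] by (simp add: vec3_eq_iff euler_flow_def a_def b_def)
qed

text \<open>A proper domain contains a time whose \<open>r\<close>-neighbourhood is not inside it.
  The solution of uniform duration \<open>r\<close> through that point extends the geodesic, against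
  maximality.\<close>

lemma unit_maximal_geodesic_complete:
  assumes max: "maximal_geodesic U m I \<gamma>" and I0: "0 \<in> I" and v: "geo_flow I \<gamma> v" and n: "norm (v 0) = 1"
  shows "I = UNIV"
proof (rule ccontr)
  assume "I \<noteq> UNIV"
  have I: "open I" "is_interval I" using max unfolding maximal_geodesic_def geodesic_def by auto
  let ?V = "euler_flow (v 0)"
  have \<gamma>: "\<gamma> t \<in> U \<and> (\<gamma> has_vector_derivative E (\<gamma> t) (?V t)) (at t)" if "t \<in> I" for t
    using geo_flowD(1,2)[OF v that] geo_flow_euler[OF I(2) I0 v that] by simp
  have Vn: "norm (?V t) \<le> 1" for t by (simp add: euler_flow(3) n)
  obtain r where r: "r > 0" "\<And>t1 g. g \<in> U \<Longrightarrow> \<exists>x. x t1 = g \<and>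
    (\<forall>t\<in>{t1 - r<..<t1 + r}. x t \<in> U \<and> (x has_vector_derivative E (x t) (?V t)) (at t))"
    using frame_flow_exists[OF euler_flow(4) Vn] by metis
  obtain t1 where t1: "t1 \<in> I" "\<not> {t1 - r<..<t1 + r} \<subseteq> I"
  proof (rule ccontr)
    assume "\<not> thesis"
    then have all: "{t1 - r<..<t1 + r} \<subseteq> I" if "t1 \<in> I" for t1 using that \<open>\<And>t1. t1 \<in> I \<Longrightarrow> \<not> {t1 - r<..<t1 + r} \<subseteq> I \<Longrightarrow> thesis\<close> by blast
    \<comment> \<open>Steps of \<open>r/2\<close> stay strictly inside the open neighbourhoods of
      radius \<open>r\<close>.\<close>
    have "{- (real i * (r/2))..real i * (r/2)} \<subseteq> I" for i
    proof (induction i)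
      case (Suc i)
      define a where "a = real i * (r/2)"
      have a: "real (Suc i) * (r/2) = a + r/2" "a \<ge> 0" unfolding a_def using r(1) by (simp_all add: algebra_simps add_divide_distrib)
      have IH: "{- a..a} \<subseteq> I" using Suc unfolding a_def .
      then have "- a \<in> I" "a \<in> I" using a(2) by auto
      note w = all[OF this(1)] all[OF this(2)]
      show ?case unfolding a(1)
      proof
        fix t assume t: "t \<in> {- (a + r/2)..a + r/2}"
        have "t \<in> {- a..a} \<or> t \<in> {- a - r<..<- a + r} \<or> t \<in> {a - r<..<a + r}"
        proof (cases "t < - a")
          case True then show ?thesis using t r(1) by simp
        next
          case False then show ?thesis using t r(1) by (cases "t \<le> a") simp_all
        qed
        then show "t \<in> I" using w IH by blast
      qed
    qed (use I0 in simp)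
    moreover have "\<exists>i. t \<in> {- (real i * (r/2))..real i * (r/2)}" for t
    proof -
      obtain i where "\<bar>t\<bar> / (r/2) \<le> real i" using real_arch_simple by blast
      then have "\<bar>t\<bar> \<le> real i * (r/2)" using r(1) by (simp add: pos_divide_le_eq)
      then show ?thesis by (intro exI[of _ i]) auto
    qed
    ultimately show False using \<open>I \<noteq> UNIV\<close> by blast
  qed
  let ?W = "{t1 - r<..<t1 + r}"
  obtain x where x: "x t1 = \<gamma> t1" "\<And>t. t \<in> ?W \<Longrightarrow> x t \<in> U \<and> (x has_vector_derivative E (x t) (?V t)) (at t)"
    using r(2)[of "\<gamma> t1" t1] \<gamma>[OF t1(1)] by blast
  have t1W: "t1 \<in> ?W" using r(1) by simp
  have agree: "\<gamma> t = x t" if "t \<in> I \<inter> ?W" for t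
  proof (rule frame_flow_unique[of "I \<inter> ?W" \<gamma> ?V x t1])
    show "open (I \<inter> ?W)" using I(1) by auto
    show "is_interval (I \<inter> ?W)" by (rule is_interval_Int[OF I(2) is_interval_oo])
    show "x t \<in> U \<and> (x has_vector_derivative E (x t) (?V t)) (at t)" if "t \<in> I \<inter> ?W" for t
      using x(2) that by blast
    show "\<gamma> t \<in> U \<and> (\<gamma> has_vector_derivative E (\<gamma> t) (?V t)) (at t)" if "t \<in> I \<inter> ?W" for t
      using \<gamma> that by blast
    show "t1 \<in> I \<inter> ?W" using t1(1) t1W by blast
  qed (use x(1) Vn that in simp_all)
  define \<delta> where "\<delta> t = (if t \<in> I then \<gamma> t else x t)" for t
  have "geo_flow (I \<union> ?W) \<delta> ?V"
    unfolding geo_flow_def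
  proof (intro ballI conjI)
    fix t assume t: "t \<in> I \<union> ?W"
    show "(?V has_vector_derivative - lc (?V t) (?V t)) (at t)" by (rule euler_flow)
    show "\<delta> t \<in> U" using t \<gamma> x(2) unfolding \<delta>_def by auto
    show "(\<delta> has_vector_derivative E (\<delta> t) (?V t)) (at t)"
    proof (cases "t \<in> I")
      case True
      then show ?thesis
        using has_vector_derivative_transform[of \<gamma> _ t I \<delta>] \<gamma>[OF True] I(1) unfolding \<delta>_def by auto
    next
      case False
      then have tW: "t \<in> ?W" using t by blast
      show ?thesis
        using has_vector_derivative_transform[of x _ t ?W \<delta>] x(2)[OF tW] tW agree False unfolding \<delta>_def by auto
    qed
  qed
  moreover have "open (I \<union> ?W)" "I \<union> ?W \<noteq> {}" using I(1) I0 by auto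
  moreover have "is_interval (I \<union> ?W)"
    unfolding is_interval_connected_1 using I(2) t1(1) t1W
    by (intro connected_Un) (auto simp: is_interval_connected_1)
  ultimately have "geodesic U m (I \<union> ?W) \<delta>" unfolding geodesic_iff_geo_flow by blast
  moreover have "\<forall>t\<in>I. \<delta> t = \<gamma> t" unfolding \<delta>_def by simp
  ultimately have "I \<union> ?W = I" using max unfolding maximal_geodesic_def by blast
  then show False using t1(2) by blast
qed

end

section \<open>Conjugate points and the main theorem\<close>

context sl2_tilde
begin

text \<open>The linear system is solved explicitly; vanishing at \<open>2 * x / sqrt D\<close>
  becomes tan x = l x, and the intermediate value theorem finds a root. The strict bounds on
  \<open>x\<close> later separate this zero from those of Killing fields.\<close>

lemma conjugate_point_exists:
  fixes p :: "real^3"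
  assumes n: "(p $ 1)\<^sup>2 + (p $ 2)\<^sup>2 + (p $ 3)\<^sup>2 = 1"
    and D: "D = \<tau>\<^sup>2 * (p $ 3)\<^sup>2 + \<kappa> * ((p $ 1)\<^sup>2 + (p $ 2)\<^sup>2)" "D > 0"
  obtains x j d where "pi \<le> x" "x < 3 * pi / 2" "(p $ 1)\<^sup>2 + (p $ 2)\<^sup>2 > 0 \<Longrightarrow> pi < x"
    "jacobi_flow UNIV (euler_flow p) j d" "j 0 = 0" "j (2 * x / sqrt D) = 0" "\<exists>s. j s \<noteq> 0"
proof -
  define a where "a = sqrt ((p $ 1)\<^sup>2 + (p $ 2)\<^sup>2)"
  define b where "b = p $ 3"
  have a2: "a\<^sup>2 = (p $ 1)\<^sup>2 + (p $ 2)\<^sup>2" unfolding a_def by simp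
  have ab: "a\<^sup>2 + b\<^sup>2 = 1" unfolding a2 b_def using n by simp
  \<comment> \<open>The unit horizontal direction; for vertical \<open>p\<close> any unit vector
    serves.\<close>
  obtain p0 q0 where pq: "p $ 1 = a * p0" "p $ 2 = a * q0" "p0\<^sup>2 + q0\<^sup>2 = 1"
  proof (cases "a = 0")
    case True
    then have "p $ 1 = 0" "p $ 2 = 0" using a2 by (simp_all add: sum_power2_eq_zero_iff)
    then show ?thesis using that[of 1 0] True by simp
  next
    case False
    have "(p $ 1 / a)\<^sup>2 + (p $ 2 / a)\<^sup>2 = 1"
      using False by (simp add: power_divide add_divide_distrib[symmetric] a2[symmetric])
    then show ?thesis using that[of "p $ 1 / a" "p $ 2 / a"] False by simp
  qed
  have Dt: "D / \<tau> = \<tau> * b\<^sup>2 + k * a\<^sup>2" unfolding D(1) a2 b_def by (rule disc_div_tau)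
  have one: "D / \<tau> + (\<tau> - k) * a\<^sup>2 = \<tau>"
  proof -
    have "D / \<tau> + (\<tau> - k) * a\<^sup>2 = \<tau> * (a\<^sup>2 + b\<^sup>2)" unfolding Dt by (simp add: algebra_simps)
    then show ?thesis unfolding ab by simp
  qed
  define \<nu> where "\<nu> = sqrt D"
  have \<nu>: "\<nu> > 0" "\<nu> * \<nu> = D" unfolding \<nu>_def using D(2) by auto
  define l where "l = 1 - D / \<tau>\<^sup>2"
  \<comment> \<open>In this form \<open>l\<close> is visibly nonnegative, and zero exactly for
    vertical \<open>p\<close>.\<close>
  have l: "l = a\<^sup>2 * (1 - \<kappa> / \<tau>\<^sup>2)"
  proof -
    have b2: "b\<^sup>2 = 1 - a\<^sup>2" using ab by simp
    have "D = \<tau>\<^sup>2 * (1 - a\<^sup>2) + \<kappa> * a\<^sup>2" unfolding D(1) a2[symmetric] b_def[symmetric] b2 ..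
    then show ?thesis unfolding l_def using tau_pos by (simp add: field_simps)
  qed
  have lpos: "1 - \<kappa> / \<tau>\<^sup>2 > 0" using kappa_neg tau_pos by (simp add: divide_neg_pos less_trans[of _ 0 1])
  \<comment> \<open>The equation tan x = l x cleared of its denominator, hence continuous up to
    \<open>3 * pi / 2\<close>.\<close>
  define g where "g x = sin x - l * x * cos x" for x
  have g: "g (3 * pi / 2) \<le> 0" "0 \<le> g pi"
  proof -
    have "g pi = l * pi" unfolding g_def by simp
    then show "0 \<le> g pi" unfolding l using lpos by simp
    have "sin (3 / 2 * pi) = -1" "cos (3 / 2 * pi) = 0" using sin_3over2_pi cos_3over2_pi by auto
    then show "g (3 * pi / 2) \<le> 0" unfolding g_def by simp
  qed
  obtain x where x: "pi \<le> x" "x \<le> 3 * pi / 2" "g x = 0"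
  proof -
    have "continuous_on {pi..3 * pi / 2} g" unfolding g_def by (intro continuous_intros)
    from IVT2'[OF g _ this] show ?thesis using that by auto
  qed
  have sx: "sin x = l * x * cos x" using x(3) unfolding g_def by simp
  have cx: "cos x \<noteq> 0"
  proof
    assume "cos x = 0"
    then have "sin x = 0" using sx by simp
    with \<open>cos x = 0\<close> show False using sin_cos_squared_add[of x] by simp
  qed
  have "3 * pi / 2 = 3 / 2 * pi" by simp
  then have "x \<noteq> 3 * pi / 2" using cx cos_3over2_pi by metis
  then have x2: "x < 3 * pi / 2" using x(2) by simp
  have x1: "pi < x" if "(p $ 1)\<^sup>2 + (p $ 2)\<^sup>2 > 0"
  proof -
    have "x \<noteq> pi"
    proof
      assume "x = pi"
      then have "l = 0" using x(3) unfolding g_def by simp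
      then show False using mult_pos_pos[OF that lpos] unfolding l a2 by (metis less_irrefl)
    qed
    then show ?thesis using x(1) by simp
  qed
  \<comment> \<open>\<open>y\<close> at the final time is
    \<open>2 * sin x * (A * cos x / \<nu> + \<tau> * c / D * sin x)\<close>. The zeros of
    \<open>sin x\<close> belong to \<open>c = 0\<close>; these \<open>c\<close> and \<open>A\<close>
    kill the other factor, and vanishing of \<open>w\<close> then amounts to
    \<open>g x = 0\<close>.\<close>
  define c where "c = \<nu> * cos x"
  define A where "A = - \<tau> * sin x"
  define \<omega> where "\<omega> = (\<tau> - k) * b"
  define P where "P t = p0 * cos (\<omega> * t) - q0 * sin (\<omega> * t)" for t
  define Q where "Q t = p0 * sin (\<omega> * t) + q0 * cos (\<omega> * t)" for t
  define y where "y t = A * sin (\<nu> * t) / \<nu> + \<tau> * c / D * (1 - cos (\<nu> * t))" for t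
  define w where "w t = c * t - \<tau> * A / D * (1 - cos (\<nu> * t)) - \<tau>\<^sup>2 * c / D * (t - sin (\<nu> * t) / \<nu>)" for t
  define B where "B t = A + (\<tau> - k) * a\<^sup>2 * c * t" for t
  \<comment> \<open>In the notation of \<open>jacobi_flow_normal\<close>, \<open>y\<close> and
    \<open>z\<close> are here \<open>a * y\<close> and \<open>a * w\<close>. Dividing by
    \<open>a\<close> keeps the field nonzero on vertical geodesics, where
    \<open>a = 0\<close>.\<close>
  define j where "j t = vec3 (- b * w t * P t - y t * Q t) (- b * w t * Q t + y t * P t) (a * w t)" for t
  define d where "d t = vec3 (- b * c * P t - B t * Q t) (- b * c * Q t + B t * P t) (a * c)" for t
  have V: "euler_flow p t $ 1 = a * P t" "euler_flow p t $ 2 = a * Q t" "euler_flow p t $ 3 = b" for t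
    unfolding euler_flow_def pq P_def Q_def \<omega>_def b_def by (simp_all add: algebra_simps)
  have dPQ: "(P has_real_derivative - \<omega> * Q t) (at t)" "(Q has_real_derivative \<omega> * P t) (at t)" for t
    unfolding P_def Q_def by ((rule derivative_eq_intros refl)+, simp add: algebra_simps)+
  have PQ: "(P t)\<^sup>2 + (Q t)\<^sup>2 = 1" for t
  proof -
    have "(P t)\<^sup>2 + (Q t)\<^sup>2 = (p0\<^sup>2 + q0\<^sup>2) * ((sin (\<omega> * t))\<^sup>2 + (cos (\<omega> * t))\<^sup>2)"
      unfolding P_def Q_def by algebra
    then show ?thesis unfolding pq(3) by simp
  qed
  have dB: "(B has_real_derivative (\<tau> - k) * a\<^sup>2 * c) (at t)" for t
    unfolding B_def by (rule derivative_eq_intros refl)+ simp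
  have dy: "(y has_real_derivative D / \<tau> * w t + B t) (at t)" for t
  proof -
    have "((\<lambda>t. A / \<nu> * sin (\<nu> * t) + \<tau> * c / D * (1 - cos (\<nu> * t))) has_real_derivative
        A / \<nu> * (cos (\<nu> * t) * \<nu>) + \<tau> * c / D * (sin (\<nu> * t) * \<nu>)) (at t)"
      by (rule derivative_eq_intros refl)+ simp
    moreover have "A / \<nu> * (cos (\<nu> * t) * \<nu>) + \<tau> * c / D * (sin (\<nu> * t) * \<nu>)
        = A * cos (\<nu> * t) + \<tau> * c * sin (\<nu> * t) / \<nu>"
      unfolding \<nu>(2)[symmetric] using \<nu>(1) by simp
    moreover have "D / \<tau> * w t + B t = (D / \<tau> + (\<tau> - k) * a\<^sup>2 - \<tau>) * c * t + A * cos (\<nu> * t) + \<tau> * c * sin (\<nu> * t) / \<nu>"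
      unfolding w_def B_def using tau_pos D(2) \<nu>(1) by (simp add: field_simps power2_eq_square)
    ultimately show ?thesis unfolding y_def one by simp
  qed
  have dw: "(w has_real_derivative c - \<tau> * y t) (at t)" for t
  proof -
    have d: "((\<lambda>t. c * t - \<tau> * A / D * (1 - cos (\<nu> * t)) - \<tau>\<^sup>2 * c / D * (t - 1 / \<nu> * sin (\<nu> * t))) has_real_derivative
        c - \<tau> * A / D * (sin (\<nu> * t) * \<nu>) - \<tau>\<^sup>2 * c / D * (1 - 1 / \<nu> * (cos (\<nu> * t) * \<nu>))) (at t)"
      by (rule derivative_eq_intros refl)+ (simp add: mult_ac)
    have eq: "c - \<tau> * A / D * (sin (\<nu> * t) * \<nu>) - \<tau>\<^sup>2 * c / D * (1 - 1 / \<nu> * (cos (\<nu> * t) * \<nu>)) = c - \<tau> * y t"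
      unfolding y_def \<nu>(2)[symmetric] using \<nu>(1) by (simp add: field_simps power2_eq_square)
    show ?thesis using d[unfolded eq] unfolding w_def by simp
  qed
  have "jacobi_flow UNIV (euler_flow p) j d"
    unfolding jacobi_flow_def
  proof (intro ballI conjI)
    fix t
    have "(j has_vector_derivative vec3
        (- b * ((c - \<tau> * y t) * P t + w t * (- \<omega> * Q t)) - ((D / \<tau> * w t + B t) * Q t + y t * (\<omega> * P t)))
        (- b * ((c - \<tau> * y t) * Q t + w t * (\<omega> * P t)) + ((D / \<tau> * w t + B t) * P t + y t * (- \<omega> * Q t)))
        (a * (c - \<tau> * y t))) (at t)"
      unfolding j_def
      by (rule has_vector_derivative_vec3; (rule derivative_eq_intros dPQ dy dw refl)+; simp add: algebra_simps)
    moreover have "vec3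
        (- b * ((c - \<tau> * y t) * P t + w t * (- \<omega> * Q t)) - ((D / \<tau> * w t + B t) * Q t + y t * (\<omega> * P t)))
        (- b * ((c - \<tau> * y t) * Q t + w t * (\<omega> * P t)) + ((D / \<tau> * w t + B t) * P t + y t * (- \<omega> * Q t)))
        (a * (c - \<tau> * y t)) = d t - br (euler_flow p t) (j t)"
    proof -
      have "a * (y t * ((P t)\<^sup>2 + (Q t)\<^sup>2)) = a * y t" by (simp add: PQ)
      then have "a * (P t * (P t * y t)) + a * (Q t * (Q t * y t)) = a * y t"
        by (simp add: algebra_simps power2_eq_square)
      from arg_cong[OF this, of "\<lambda>s. \<tau> * s"]
      show ?thesis
        unfolding Dt by (simp add: vec3_eq_iff br_def V d_def j_def \<omega>_def algebra_simps power2_eq_square)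
    qed
    ultimately show "(j has_vector_derivative d t - br (euler_flow p t) (j t)) (at t)" by simp
    have "(d has_vector_derivative vec3
        (- b * c * (- \<omega> * Q t) - ((\<tau> - k) * a\<^sup>2 * c * Q t + B t * (\<omega> * P t)))
        (- b * c * (\<omega> * P t) + ((\<tau> - k) * a\<^sup>2 * c * P t + B t * (- \<omega> * Q t))) 0) (at t)"
      unfolding d_def
      by (rule has_vector_derivative_vec3; (rule derivative_eq_intros dPQ dB refl)+; simp add: algebra_simps)
    moreover have "vec3
        (- b * c * (- \<omega> * Q t) - ((\<tau> - k) * a\<^sup>2 * c * Q t + B t * (\<omega> * P t)))
        (- b * c * (\<omega> * P t) + ((\<tau> - k) * a\<^sup>2 * c * P t + B t * (- \<omega> * Q t))) 0
        = - (lc (d t) (euler_flow p t) + lc (euler_flow p t) (d t))"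
      by (simp add: vec3_eq_iff lc_def V d_def \<omega>_def algebra_simps power2_eq_square)
    ultimately show "(d has_vector_derivative - (lc (d t) (euler_flow p t) + lc (euler_flow p t) (d t))) (at t)" by simp
  qed
  moreover have "j 0 = 0" unfolding j_def y_def w_def by (simp add: vec3_eq_iff)
  moreover have "j (2 * x / sqrt D) = 0"
  proof -
    define T where "T = 2 * x / sqrt D"
    have T: "\<nu> * T = 2 * x" "T = 2 * x / \<nu>" unfolding T_def \<nu>_def using D(2) by simp_all
    have "y T = 2 * sin x * (A * cos x / \<nu> + \<tau> * c / D * sin x)"
      unfolding y_def T(1) sin_double cos_double_sin by (simp add: algebra_simps power2_eq_square)
    also have "A * cos x / \<nu> + \<tau> * c / D * sin x = 0"
      unfolding A_def c_def \<nu>(2)[symmetric] using \<nu>(1) by (simp add: field_simps)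
    finally have "y T = 0" by simp
    moreover have "w T = 0"
    proof -
      have E: "D * (\<nu> * cs) * (2 * x / \<nu>) - \<tau> * (- \<tau> * sn) * (2 * sn\<^sup>2) - \<tau>\<^sup>2 * (\<nu> * cs) * (2 * x / \<nu> - 2 * sn * cs / \<nu>)
        = 2 * (D * x * cs + \<tau>\<^sup>2 * sn * (sn\<^sup>2 + cs\<^sup>2) - \<tau>\<^sup>2 * x * cs)" for sn cs :: real
        using \<nu>(1) by (simp add: field_simps power2_eq_square)
      have "D * w T = D * c * T - \<tau> * A * (2 * (sin x)\<^sup>2) - \<tau>\<^sup>2 * c * (T - 2 * sin x * cos x / \<nu>)"
        unfolding w_def T(1) sin_double cos_double_sin using D(2) by (simp add: field_simps)
      also have "\<dots> = 2 * (D * x * cos x + \<tau>\<^sup>2 * sin x * ((sin x)\<^sup>2 + (cos x)\<^sup>2) - \<tau>\<^sup>2 * x * cos x)"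
        unfolding T(2) A_def c_def by (rule E)
      also have "\<dots> = 2 * \<tau>\<^sup>2 * (sin x - l * x * cos x)"
        unfolding l_def using tau_pos by (simp add: field_simps)
      also have "\<dots> = 0" using sx by simp
      finally show ?thesis using D(2) by simp
    qed
    ultimately show ?thesis unfolding T_def[symmetric] j_def by (simp add: vec3_eq_iff)
  qed
  moreover have "\<exists>s. j s \<noteq> 0"
  proof (rule ccontr)
    assume "\<nexists>s. j s \<noteq> 0"
    then have z: "- b * w t * P t - y t * Q t = 0" "- b * w t * Q t + y t * P t = 0" "a * w t = 0" for t
      unfolding j_def by (simp_all add: vec3_eq_iff)
    have w0: "w t = 0" for t
    proof -
      have "(P t)\<^sup>2 + (Q t)\<^sup>2 \<noteq> 0" by (simp add: PQ)
      then have "b * w t = 0"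
        using rotation_zero(1)[of "P t" "Q t" "b * w t" "y t"] z(1,2)[of t] by (simp add: algebra_simps)
      moreover have "w t = a * (a * w t) + b * (b * w t)"
      proof -
        have "w t = (a\<^sup>2 + b\<^sup>2) * w t" by (simp add: ab)
        then show ?thesis by (simp add: algebra_simps power2_eq_square)
      qed
      ultimately show ?thesis using z(3)[of t] by (metis add.right_neutral mult_zero_right)
    qed
    have "w = (\<lambda>t. 0)" using w0 by (rule ext)
    then have "(w has_real_derivative 0) (at 0)" by simp
    then have "c - \<tau> * y 0 = 0" using dw[of 0] DERIV_unique by blast
    then have "c = 0" unfolding y_def by simp
    then show False unfolding c_def using \<nu>(1) cx by simp
  qed
  ultimately show thesis using that x(1) x2 x1 by blast
qed

text \<open>If the geodesic is not vertical, \<open>c = 0\<close> makes \<open>y\<close> a multiple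
  of \<open>sin (\<nu> * t)\<close> and \<open>z\<close> of \<open>1 - cos (\<nu> * t)\<close>, and
  a second zero would need \<open>sin x = 0\<close>. On a vertical geodesic, where
  \<open>x = pi\<close> is allowed, the horizontal part has constant length and \<open>z\<close> is
  constant.\<close>

lemma isotropic_jacobi_zero:
  assumes v: "geo_flow UNIV \<gamma> v" and us: "\<forall>t. (v t $ 1)\<^sup>2 + (v t $ 2)\<^sup>2 + (v t $ 3)\<^sup>2 = 1"
    and D: "D = \<tau>\<^sup>2 * (v 0 $ 3)\<^sup>2 + \<kappa> * ((v 0 $ 1)\<^sup>2 + (v 0 $ 2)\<^sup>2)" "D > 0"
    and x: "pi \<le> x" "x < 3 * pi / 2" "(v 0 $ 1)\<^sup>2 + (v 0 $ 2)\<^sup>2 > 0 \<Longrightarrow> pi < x"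
    and J: "isotropic_jacobi_field U m UNIV \<gamma> J" "J 0 = 0" "J (2 * x / sqrt D) = 0"
  shows "J t = 0"
proof -
  note I = is_interval_univ open_UNIV
  obtain K where K: "killing_field U m K" and JK: "\<And>t. J t = K (\<gamma> t)"
    using J(1) unfolding isotropic_jacobi_field_def by auto
  obtain j d where jd: "jacobi_flow UNIV v j d" and Jj: "\<And>t. J t = E (\<gamma> t) (j t)" and jP: "\<And>t. j t = Phi (\<gamma> t) (J t)"
    using jacobi_field_imp_flow[OF I(2) v] J(1) unfolding isotropic_jacobi_field_def by (metis UNIV_I)
  have jK: "j t = Phi (\<gamma> t) (K (\<gamma> t))" for t using jP JK by simp
  define T where "T = 2 * x / sqrt D"
  have T: "T \<noteq> 0" unfolding T_def using less_le_trans[OF pi_gt_zero x(1)] D(2) by simp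
  have j0: "j 0 = 0" "j T = 0"
    unfolding T_def jP J linear_0[OF linear_Phi[OF geo_flowD(1)[OF v UNIV_I]]] by auto
  define y where "y t = v t $ 1 * j t $ 2 - v t $ 2 * j t $ 1" for t
  define z where "z t = j t $ 3" for t
  define \<beta> where "\<beta> t = v t $ 1 * d t $ 2 - v t $ 2 * d t $ 1" for t
  define c where "c = d 0 $ 3"
  define a2 where "a2 = (v 0 $ 1)\<^sup>2 + (v 0 $ 2)\<^sup>2"
  have us': "\<forall>t\<in>UNIV. (v t $ 1)\<^sup>2 + (v t $ 2)\<^sup>2 + (v t $ 3)\<^sup>2 = 1" using us by simp
  note N = jacobi_flow_normal[OF I(1) v jd us' UNIV_I j0(1) UNIV_I T j0(2) D(1) UNIV_I,
      folded y_def z_def \<beta>_def c_def a2_def]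
  note KA = killing_along[OF K v UNIV_I, folded jK z_def]
  \<comment> \<open>\<open>killing_along\<close> and \<open>jacobi_flow_normal\<close> both compute
    the derivative of \<open>z\<close>; the results differ by \<open>c\<close>.\<close>
  have c: "c = 0"
  proof -
    have "(z has_real_derivative \<tau> * (v 0 $ 2 * j 0 $ 1 - v 0 $ 1 * j 0 $ 2)) (at 0)"
      using KA(1)[of 0] .
    from DERIV_unique[OF this N(2)] show ?thesis by (simp add: y_def algebra_simps)
  qed
  have "j t = 0"
  proof (cases "a2 > 0")
    case False
    then have "a2 = 0" unfolding a2_def by (smt (verit) zero_le_power2)
    then have v0: "v t $ 1 = 0" "v t $ 2 = 0" for t
      using N(8)[of t] by (simp_all add: sum_power2_eq_zero_iff)
    have "((\<lambda>t. (j t $ 1)\<^sup>2 + (j t $ 2)\<^sup>2) has_real_derivative 0) (at t)" for t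
      by (rule derivative_eq_intros KA(2,3)[OF v0] refl)+ (simp add: algebra_simps)
    from real_derivative_zero_const[OF I(1) this UNIV_I UNIV_I, of t 0]
    have "j t $ 1 = 0" "j t $ 2 = 0" using j0 by (simp_all add: sum_power2_eq_zero_iff)
    moreover have "(z has_real_derivative 0) (at t)" for t
      using N(2)[of t] by (simp add: c y_def v0)
    from real_derivative_zero_const[OF I(1) this UNIV_I UNIV_I, of t 0]
    have "z t = 0" unfolding z_def j0 by simp
    ultimately show ?thesis by (simp add: vec3_eq_iff z_def)
  next
    case True
    define \<nu> where "\<nu> = sqrt D"
    have \<nu>: "\<nu> > 0" "\<nu> * \<nu> = D" unfolding \<nu>_def using D(2) by auto
    define A where "A = \<beta> 0"
    have \<beta>: "\<beta> t = A" for t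
      using real_derivative_zero_const[OF I(1) _ UNIV_I UNIV_I, of \<beta>] N(3) unfolding c A_def by simp
    \<comment> \<open>Uniqueness by energy: \<open>e\<close> is the deviation of \<open>y\<close>
      from the expected sine, \<open>f\<close> is its derivative, and
      \<open>D * e\<^sup>2 + f\<^sup>2\<close> is conserved.\<close>
    define e where "e t = y t - A / \<nu> * sin (\<nu> * t)" for t
    define f where "f t = D / \<tau> * z t + A - A * cos (\<nu> * t)" for t
    have de: "(e has_real_derivative f t) (at t)" for t
      unfolding e_def f_def by (rule derivative_eq_intros N(1) refl)+ (use \<nu>(1) in \<open>simp add: \<beta>\<close>)
    have df: "(f has_real_derivative - D * e t) (at t)" for t
    proof -
      have "(f has_real_derivative D / \<tau> * (c - \<tau> * y t) + A * (sin (\<nu> * t) * \<nu>)) (at t)"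
        unfolding f_def by (rule derivative_eq_intros N(2) refl)+ simp
      moreover have "D / \<tau> * (c - \<tau> * y t) + A * (sin (\<nu> * t) * \<nu>) = - D * e t"
        unfolding e_def c \<nu>(2)[symmetric] using \<nu>(1) tau_pos by (simp add: algebra_simps)
      ultimately show ?thesis by simp
    qed
    have "((\<lambda>t. D * (e t)\<^sup>2 + (f t)\<^sup>2) has_real_derivative 0) (at t)" for t
      by (rule derivative_eq_intros de df refl)+ (simp add: algebra_simps)
    from real_derivative_zero_const[OF I(1) this UNIV_I UNIV_I, of _ 0]
    have ef: "D * (e t)\<^sup>2 + (f t)\<^sup>2 = 0" for t by (simp add: e_def f_def y_def z_def j0)
    have ef: "e t = 0" "f t = 0" for t
    proof -
      have "D * (e t)\<^sup>2 \<ge> 0" "(f t)\<^sup>2 \<ge> 0" using D(2) by simp_all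
      then have "D * (e t)\<^sup>2 = 0" "(f t)\<^sup>2 = 0" using ef[of t] by linarith+
      then show "e t = 0" "f t = 0" using D(2) by simp_all
    qed
    have "pi < x" using x(3) True unfolding a2_def by blast
    moreover have "x < 2 * pi" using x(2) pi_gt_zero by linarith
    ultimately have sx: "sin x < 0" by (rule sin_lt_zero)
    have T': "\<nu> * T = 2 * x" unfolding T_def \<nu>_def using D(2) by simp
    have "f T = A * (2 * (sin x)\<^sup>2)"
      unfolding f_def z_def j0(2) T' cos_double_sin by (simp add: algebra_simps)
    then have "A * (2 * (sin x)\<^sup>2) = 0" using ef(2)[of T] by simp
    then have A: "A = 0" using sx by simp
    have yz: "y t = 0" "z t = 0"
      using ef[of t] D(2) tau_pos unfolding e_def f_def A by simp_all
    have "(v t $ 1)\<^sup>2 + (v t $ 2)\<^sup>2 \<noteq> 0" using N(8)[of t] True by simp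
    from rotation_zero[OF this _ yz(1)[unfolded y_def]] N(4)[of t] yz
    have "j t $ 1 = 0" "j t $ 2 = 0" by auto
    then show "j t = 0" using yz(2) unfolding z_def vec3_eq_iff by simp
  qed
  then show ?thesis unfolding Jj by (simp add: linear_0[OF linear_E])
qed

text \<open>For \<open>D \<le> 0\<close> isotropy is vacuous, as nothing is conjugate. For
  \<open>D > 0\<close> one conjugate point without a Killing field refutes it, and completeness
  ensures that its parameter belongs to \<open>I\<close>.\<close>

lemma isotropic_geodesic_iff:
  assumes max: "maximal_geodesic U m I \<gamma>" and us: "unit_speed m I \<gamma>" and I0: "0 \<in> I" and t: "t \<in> I"
  shows "isotropic_geodesic U m I \<gamma> \<longleftrightarrow> slope_angle m u3 \<gamma> t \<in> {arctan \<mu>..pi - arctan \<mu>}"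
proof -
  obtain v where I: "open I" "is_interval I" and v: "geo_flow I \<gamma> v"
    using max unfolding maximal_geodesic_def geodesic_iff_geo_flow by blast
  define D where "D = \<tau>\<^sup>2 * (v 0 $ 3)\<^sup>2 + \<kappa> * ((v 0 $ 1)\<^sup>2 + (v 0 $ 2)\<^sup>2)"
  have n: "\<forall>t\<in>I. (v t $ 1)\<^sup>2 + (v t $ 2)\<^sup>2 + (v t $ 3)\<^sup>2 = 1"
    using slope_angle_iff(1)[OF v us] by blast
  have slope: "slope_angle m u3 \<gamma> t \<in> {arctan \<mu>..pi - arctan \<mu>} \<longleftrightarrow> D \<le> 0"
    unfolding slope_angle_iff(2)[OF v us t] D_def geo_flow_norm[OF I(2) v t I0] ..
  show ?thesis
  proof (cases "D \<le> 0")
    case True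
    have "\<not> conjugate_at m I \<gamma> T" for T
    proof
      assume "conjugate_at m I \<gamma> T"
      then obtain J s where T: "T \<in> I" "T \<noteq> 0" and J: "jacobi_field m I \<gamma> J" "J 0 = 0" "J T = 0"
        and s: "s \<in> I" "J s \<noteq> 0" unfolding conjugate_at_def by blast
      obtain j d where jd: "jacobi_flow I v j d" and Jj: "\<And>t. t \<in> I \<Longrightarrow> J t = E (\<gamma> t) (j t)"
        and jP: "\<And>t. j t = Phi (\<gamma> t) (J t)"
        using jacobi_field_imp_flow[OF I(1) v J(1)] by blast
      have "j 0 = 0" "j T = 0"
        unfolding jP J using linear_0[OF linear_Phi] geo_flowD(1)[OF v] I0 T(1) by auto
      from no_conjugate[OF I(2) v jd n I0 this(1) T this(2) True[unfolded D_def] s(1)]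
      show False using s Jj[OF s(1)] by (simp add: linear_0[OF linear_E])
    qed
    then show ?thesis using slope True unfolding isotropic_geodesic_def by blast
  next
    case False
    then have Dpos: "D > 0" by simp
    have n0: "(v 0 $ 1)\<^sup>2 + (v 0 $ 2)\<^sup>2 + (v 0 $ 3)\<^sup>2 = 1" using n I0 by blast
    then have "norm (v 0) = 1" by (simp add: norm_eq_sqrt_inner inner_vec3 power2_eq_square)
    from unit_maximal_geodesic_complete[OF max I0 v this] have IU: "I = UNIV" .
    note v = v[unfolded IU]
    have ve: "v = euler_flow (v 0)"
      using geo_flow_euler[OF is_interval_univ UNIV_I v UNIV_I] by (rule ext)
    obtain x j d where x: "pi \<le> x" "x < 3 * pi / 2" "(v 0 $ 1)\<^sup>2 + (v 0 $ 2)\<^sup>2 > 0 \<Longrightarrow> pi < x"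
      and jd: "jacobi_flow UNIV (euler_flow (v 0)) j d" "j 0 = 0" "j (2 * x / sqrt D) = 0" "\<exists>s. j s \<noteq> 0"
      using conjugate_point_exists[OF n0 D_def Dpos] by metis
    define T where "T = 2 * x / sqrt D"
    have T: "T \<noteq> 0" unfolding T_def using less_le_trans[OF pi_gt_zero x(1)] Dpos by simp
    define J where "J t = E (\<gamma> t) (j t)" for t
    have "jacobi_field m UNIV \<gamma> J"
      unfolding J_def[abs_def] by (rule jacobi_flow_imp_field[OF open_UNIV v]) (use jd(1) ve in simp)
    moreover obtain s where "j s \<noteq> 0" using jd(4) by blast
    then have "J s \<noteq> 0"
      unfolding J_def using Phi_E[OF geo_flowD(1)[OF v UNIV_I]] linear_0[OF linear_Phi[OF geo_flowD(1)[OF v UNIV_I]]]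
      by metis
    moreover have "J 0 = 0" "J T = 0" unfolding J_def T_def jd(2,3) by (simp_all add: linear_0[OF linear_E])
    ultimately have "conjugate_at m I \<gamma> T" unfolding conjugate_at_def IU using T by blast
    moreover have "\<not> isotropic_conjugate_at U m I \<gamma> T"
      using isotropic_jacobi_zero[OF v _ D_def Dpos x] n unfolding isotropic_conjugate_at_def IU T_def by blast
    ultimately show ?thesis using slope False unfolding isotropic_geodesic_def by blast
  qed
qed

end

theorem corollary5p8:
  fixes \<kappa> \<tau> \<epsilon> :: real
    and G :: "'a::euclidean_space monoid"
    and m :: "'a metric_tensor"
    and u1 u2 u3 :: "'a \<Rightarrow> 'a"
  assumes "\<kappa> < 0" and "\<tau> > 0"
    and "\<epsilon> = arctan (\<tau> / sqrt (- \<kappa>))"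
    and "SL2_tilde \<kappa> \<tau> G m u1 u2 u3"
  shows "(\<forall>I \<gamma>. maximal_geodesic (carrier G) m I \<gamma> \<and> \<not> \<gamma> constant_on I \<longrightarrow> inj_on \<gamma> I) \<and>
    (\<forall>I \<gamma>. maximal_geodesic (carrier G) m I \<gamma> \<and> unit_speed m I \<gamma> \<and> 0 \<in> I \<longrightarrow>
       (\<forall>t\<in>I. isotropic_geodesic (carrier G) m I \<gamma> \<longleftrightarrow> slope_angle m u3 \<gamma> t \<in> {\<epsilon>..pi - \<epsilon>}))"
proof -
  interpret sl2_tilde \<kappa> \<tau> G m u1 u2 u3 using assms by unfold_locales
  have "inj_on \<gamma> I" if "maximal_geodesic U m I \<gamma>" "\<not> \<gamma> constant_on I" for I \<gamma>
  proof (rule inj_onI, rule ccontr)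
    fix s t assume "s \<in> I" "t \<in> I" "\<gamma> s = \<gamma> t" "s \<noteq> t"
    then show False
      using geo_flow_no_return that unfolding maximal_geodesic_def geodesic_iff_geo_flow by metis
  qed
  moreover have "\<epsilon> = arctan \<mu>" unfolding assms(3) \<mu>_def ..
  ultimately show ?thesis using isotropic_geodesic_iff by simp
qed

end
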